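(* There exists a quasipositive surface having two quasipositive diagrams which are not related by any finite sequence of inflations, deflations, slips, slides, twirls and turns.
   Context: **Quasipositive surfaces and fence diagrams.** A quasipositive diagram is determined by an integer $b\ge1$ and a finite word in symbols $(i,j)$, $1\le i<j\le b$: it is the diagram of the surface consisting of $b$ disjoint parallel disks together with, for each letter $(i,j)$ in order, one positively half-twisted band joining disks $i$ and $j$ and passing in front of the disks in between, so that the boundary is the closure of the corresponding product of braids $\sigma_{i,j}=(\sigma_i\cdots\sigma_{j-2})\sigma_{j-1}(\sigma_i\cdots\sigma_{j-2})^{-1}$. It is represented by its fence diagram: $b$ horizontal lines numbered from top to bottom, and from left to right one vertical segment joining lines $i$ and $j$ for each letter $(i,j)$. A Seifert surface is quasipositive if it has a quasipositive diagram, i.e. is ambient isotopic to a surface of this form; each such description is a quasipositive diagram of the surface. **Moves (in terms of fence diagrams).** - Inflation: insert a new horizontal line (at any height) together with one new vertical segment (at any position) joining it to an existing horizontal line. Deflation: the inverse. - Slip: exchange two consecutive vertical segments $(i,j)$, $(k,l)$ whose four endpoints lie on distinct lines and whose intervals $[i,j]$, $[k,l]$ are disjoint or nested. - Slide: for $i<j<k$, replace consecutive vertical segments (read left to right) according to $(i,j)(j,k)\leftrightarrow(i,k)(i,j)$ or $(i,j)(j,k)\leftrightarrow(j,k)(i,k)$. - Twirl: move the top horizontal line to the bottom, keeping the left-to-right order of the vertical segments and which lines they join (so $(1,j)$ becomes $(j-1,b)$ and $(i,j)$ with $i\ge2$ becomes $(i-1,j-1)$), or the inverse. - Turn: move the leftmost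 vertical segment to the far right, or the inverse. *)

theory Defs
  imports "HOL-Analysis.Analysis"
begin

section \<open>Quasipositive diagrams\<close>

text \<open>A diagram is a number of lines (disks), numbered from top to bottom starting with 1,
  together with the word of its vertical segments (bands), read from left to right.\<close>

type_synonym fence = "nat \<times> (nat \<times> nat) list"

definition fence_diagram :: "fence \<Rightarrow> bool" where
  "fence_diagram D \<longleftrightarrow> 1 \<le> fst D \<and> (\<forall>(i, j) \<in> set (snd D). 1 \<le> i \<and> i < j \<and> j \<le> fst D)"


section \<open>Oriented surfaces in space and ambient isotopy\<close>

text \<open>Coordinates \<open>(x, y, z)\<close> of Euclidean 3-space, a right-handed frame: \<open>x\<close> points to the right
  and \<open>z\<close> upwards in the fence diagram, \<open>y\<close> points away from the viewer.\<close>

type_synonym point = "real \<times> real \<times> real"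

text \<open>An orientation of a surface is recorded by the set of those embeddings of the closed unit
  disk into the surface that respect the orientation. On an orientable surface, the embeddings of
  the disk into one component form exactly two isotopy classes, interchanged by complex conjugation,
  and an orientation selects one of them in each component. (Values off the disk are irrelevant.)\<close>

type_synonym oriented_surface = "point set \<times> (complex \<Rightarrow> point) set"

definition disk_isotopic :: "point set \<Rightarrow> (complex \<Rightarrow> point) \<Rightarrow> (complex \<Rightarrow> point) \<Rightarrow> bool" where
  "disk_isotopic S =
     homotopic_with_canon (\<lambda>f. inj_on f (cball 0 1)) (cball 0 1) S"

definition ambient_isotopic :: "oriented_surface \<Rightarrow> oriented_surface \<Rightarrow> bool" where
  "ambient_isotopic S S' \<longleftrightarrow>
     (\<exists>h. homotopic_with (homeomorphic_map euclidean euclidean) euclidean euclidean id h \<and>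
          h ` fst S = fst S' \<and>
          (\<lambda>e. h \<circ> e) ` snd S = snd S')"


section \<open>The surface of a diagram\<close>

text \<open>Disk \<open>k\<close> is a horizontal rectangle at height \<open>-k\<close> behind the plane \<open>y = 0\<close>, so that line \<open>k\<close>
  of the fence is its front edge; \<open>n\<close> is the number of bands.\<close>

definition fence_disk :: "nat \<Rightarrow> nat \<Rightarrow> point set" where
  "fence_disk n k = {(x, y, z). 0 \<le> x \<and> x \<le> real n + 1 \<and> 0 \<le> y \<and> y \<le> 1 \<and> z = - real k}"

text \<open>The band at horizontal position \<open>p\<close>: the parameter \<open>t\<close> runs along the core from disk \<open>i\<close> down to
  disk \<open>j\<close>, and \<open>s\<close> runs across. The horizontal cross-direction, proportional to
  \<open>((1 - 2 t) / 4, t (1 - t))\<close>, makes half a turn, and \<open>y < 0\<close> for \<open>0 < t < 1\<close>, so the band passes in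
  front of the disks in between. Sign of the twist: with the disks oriented counterclockwise as
  seen from above, the front edges are traversed to the right; the edge \<open>s = -1\<close>, running from
  upper left to lower right, crosses in front of the edge \<open>s = 1\<close>, running from lower left to upper
  right, which is a positive crossing.\<close>

definition fence_band :: "real \<Rightarrow> nat \<Rightarrow> nat \<Rightarrow> point set" where
  "fence_band p i j =
     {(p + s * (1 - 2 * t) / 4, - ((2 - s) * t * (1 - t)), - (real i + t * (real j - real i))) | s t.
        -1 \<le> s \<and> s \<le> 1 \<and> 0 \<le> t \<and> t \<le> 1}"

definition fence_set :: "fence \<Rightarrow> point set" where
  "fence_set D =
     (\<Union>k\<in>{1..fst D}. fence_disk (length (snd D)) k) \<union>
     (\<Union>p\<in>{..<length (snd D)}. fence_band (real p + 1) (fst (snd D ! p)) (snd (snd D ! p)))"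

text \<open>A counterclockwise (seen from above) round disk in disk \<open>k\<close>. As the bands have odd half-twists,
  these local orientations for all \<open>k\<close> fit together to an orientation of the surface.\<close>

definition std_disk :: "nat \<Rightarrow> nat \<Rightarrow> complex \<Rightarrow> point" where
  "std_disk n k u = ((real n + 1 + Re u) / 2, (1 + Im u) / 2, - real k)"

definition fence_surface :: "fence \<Rightarrow> oriented_surface" where
  "fence_surface D =
     (fence_set D,
      {e. \<exists>k\<in>{1..fst D}. disk_isotopic (fence_set D) (std_disk (length (snd D)) k) e})"

definition is_diagram_of :: "fence \<Rightarrow> oriented_surface \<Rightarrow> bool" where
  "is_diagram_of D S \<longleftrightarrow> fence_diagram D \<and> ambient_isotopic S (fence_surface D)"

text \<open>That \<open>S\<close> is a Seifert surface (a compact oriented surface without closed components) need not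
  be required separately: this holds for the surface of a diagram and is preserved by ambient
  isotopy.\<close>

definition quasipositive :: "oriented_surface \<Rightarrow> bool" where
  "quasipositive S \<longleftrightarrow> (\<exists>D. is_diagram_of D S)"


section \<open>Moves\<close>

text \<open>Renumbering of the existing lines when a new line with number \<open>h\<close> is inserted.\<close>

definition shift_line :: "nat \<Rightarrow> nat \<Rightarrow> nat" where
  "shift_line h i = (if i < h then i else Suc i)"

inductive inflation :: "fence \<Rightarrow> fence \<Rightarrow> bool" where
  "\<lbrakk>h \<in> {1..b + 1}; k \<in> {1..b}; k' = shift_line h k;
    w' = map (map_prod (shift_line h) (shift_line h)) u @ [(min h k', max h k')] @
         map (map_prod (shift_line h) (shift_line h)) v\<rbrakk>
   \<Longrightarrow> inflation (b, u @ v) (b + 1, w')"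

inductive slip :: "fence \<Rightarrow> fence \<Rightarrow> bool" where
  "\<lbrakk>distinct [i, j, k, l];
    {i..j} \<inter> {k..l} = {} \<or> {i..j} \<subseteq> {k..l} \<or> {k..l} \<subseteq> {i..j}\<rbrakk>
   \<Longrightarrow> slip (b, u @ [(i, j), (k, l)] @ v) (b, u @ [(k, l), (i, j)] @ v)"

inductive slide :: "fence \<Rightarrow> fence \<Rightarrow> bool" where
  "\<lbrakk>i < j; j < k\<rbrakk> \<Longrightarrow> slide (b, u @ [(i, j), (j, k)] @ v) (b, u @ [(i, k), (i, j)] @ v)"
| "\<lbrakk>i < j; j < k\<rbrakk> \<Longrightarrow> slide (b, u @ [(i, j), (j, k)] @ v) (b, u @ [(j, k), (i, k)] @ v)"

definition twirl_segment :: "nat \<Rightarrow> nat \<times> nat \<Rightarrow> nat \<times> nat" where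
  "twirl_segment b = (\<lambda>(i, j). if i = 1 then (j - 1, b) else (i - 1, j - 1))"

inductive twirl :: "fence \<Rightarrow> fence \<Rightarrow> bool" where
  "twirl (b, w) (b, map (twirl_segment b) w)"

inductive turn :: "fence \<Rightarrow> fence \<Rightarrow> bool" where
  "turn (b, a # w) (b, w @ [a])"

definition fence_move :: "fence \<Rightarrow> fence \<Rightarrow> bool" where
  "fence_move D D' \<longleftrightarrow> fence_diagram D \<and> fence_diagram D' \<and>
     (inflation D D' \<or> slip D D' \<or> slide D D' \<or> twirl D D' \<or> turn D D')"

text \<open>The equivalence closure admits finite sequences of moves and of their inverses (deflations
  being the inverses of inflations).\<close>

definition move_equivalent :: "fence \<Rightarrow> fence \<Rightarrow> bool" where
  "move_equivalent = equivclp fence_move"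

end

theory Submission
  imports Defs "HOL-Analysis.Analysis"
begin

text \<open>The moves preserve not only the surface but also its boundary as a transverse link. Weighting
  the boundary components \<open>K\<^sub>a\<close> by integers \<open>c\<^sub>a\<close>, the set of values of the quadratic form with
  coefficients \<open>lk(K\<^sub>a, K\<^sub>b)\<close> off the diagonal and the self-linking numbers (writhe minus number of
  strands) on the diagonal is therefore an invariant of a diagram up to moves. For the words
  \<open>(1,2)(3,4)(2,3)(2,4)(1,2)\<close> and \<open>(1,2)(2,4)(3,4)(2,3)(1,2)\<close> it differs: the first form takes the
  value \<open>-2\<close>, all values of the second are incongruent to \<open>2\<close> modulo \<open>4\<close>.

  The two surfaces are nevertheless isotopic. Disk 3 with its bands to the disks 2 and 4 is a single
  long band, parallel to the band \<open>(2,4)\<close>. Drawn as two vertical ribbons from disk 2 to disk 4, these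
  make half a turn and three half turns, and the two fences differ in which of them is the more
  twisted one. A full rotation of the tube around the arc that follows one ribbon down and the
  other one up moves the full twist from one ribbon to the other. The half turn about an axis in
  direction \<open>y\<close> interchanges the situation at the two fences, so the second fence needs no
  construction of its own.\<close>

section \<open>Compactly supported homeomorphisms\<close>

text \<open>Since \<open>ambient_isotopic\<close> compares point sets, every stage is an explicit
  self-map of space with an exact image. The isotopy itself is supplied by the Alexander trick, so
  compact support is carried along throughout. A ribbon meeting each level in one segment is given
  by a center and a direction per level, and deforming it takes just a homotopy of these data with
  nonvanishing direction (\<open>ribbon_isotopy\<close>). The obstacle is disk 3, which lies in a
  single level and has to be tilted before this applies. The other pieces are preserved as sets,
  disk 1 even pointwise, so that the orientation follows. Why the fences differ: the disks 2, 3, 4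
  and their bands form an annulus whose boundary circles have self-linking numbers -3 and -1. Disk 1
  and its two bands to disk 2 add a second annulus, joined to the -3 circle in
  \<open>fence_left\<close> and to the -1 circle in \<open>fence_right\<close>. Up to isotopy the
  surface does not see this choice; the form does.\<close>

text \<open>Such a map is a homeomorphism: it is open by invariance of domain, and its image is closed.\<close>

definition compactly_supported :: "('a::euclidean_space \<Rightarrow> 'a) \<Rightarrow> bool" where
  "compactly_supported h \<longleftrightarrow>
     continuous_on UNIV h \<and> inj h \<and> (\<exists>R. \<forall>x. R \<le> norm x \<longrightarrow> h x = x)"

lemma compactly_supported_bij:
  assumes "compactly_supported h"
  shows "bij h"
proof -
  obtain R where R: "\<And>x. R \<le> norm x \<Longrightarrow> h x = x" and c: "continuous_on UNIV h" and i: "inj h"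
    using assms by (auto simp: compactly_supported_def)
  have "open (range h)"
    using invariance_of_domain[OF c open_UNIV i] .
  moreover have "closed (range h)"
  proof -
    have "range h = h ` cball 0 R \<union> - ball 0 R"
    proof (intro subset_antisym subsetI)
      fix y assume "y \<in> range h"
      then obtain x where "y = h x" by auto
      then show "y \<in> h ` cball 0 R \<union> - ball 0 R"
        using R[of x] by (cases "norm x \<le> R") auto
    next
      fix y assume "y \<in> h ` cball 0 R \<union> - ball 0 R"
      then show "y \<in> range h"
      proof
        assume "y \<in> - ball 0 R"
        then have "h y = y" using R[of y] by simp
        then show ?thesis by (metis rangeI)
      qed auto
    qed
    moreover have "compact (h ` cball 0 R)"
      using c by (intro compact_continuous_image) (auto intro: continuous_on_subset)
    ultimately show ?thesis by (simp add: closed_Un compact_imp_closed closed_Compl)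
  qed
  ultimately have "range h = UNIV"
    using connected_UNIV unfolding connected_clopen by auto
  with i show ?thesis by (simp add: bij_def)
qed

lemma compactly_supported_homeomorphic_map:
  assumes "compactly_supported h"
  shows "homeomorphic_map euclidean euclidean h"
proof -
  have c: "continuous_on UNIV h" and b: "bij h"
    using assms compactly_supported_bij by (auto simp: compactly_supported_def)
  have "open_map euclidean euclidean h"
    unfolding open_map_def
    using invariance_of_domain[of _ h] c b
    by (auto simp: bij_def intro: continuous_on_subset inj_on_subset)
  then show ?thesis
    using c b by (intro bijective_open_imp_homeomorphic_map) (auto simp: bij_def)
qed

lemma compactly_supported_id: "compactly_supported id"
  by (auto simp: compactly_supported_def)

lemma compactly_supported_comp:
  assumes "compactly_supported f" "compactly_supported g"
  shows "compactly_supported (g \<circ> f)"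
proof -
  obtain R S where "\<And>x. R \<le> norm x \<Longrightarrow> f x = x" "\<And>x. S \<le> norm x \<Longrightarrow> g x = x"
    using assms by (auto simp: compactly_supported_def)
  then show ?thesis
    using assms unfolding compactly_supported_def
    by (intro conjI continuous_on_compose inj_compose exI[of _ "max R S"])
      (auto intro: continuous_on_subset)
qed

lemma compactly_supported_inv:
  assumes "compactly_supported h"
  shows "compactly_supported (inv h)"
proof -
  have b: "bij h" using assms by (rule compactly_supported_bij)
  have "continuous_on UNIV (inv h)"
    using continuous_on_inverse_open[of UNIV h] assms b
    by (auto simp: compactly_supported_def bij_def)
  moreover obtain R where R: "\<And>x. R \<le> norm x \<Longrightarrow> h x = x"
    using assms by (auto simp: compactly_supported_def)
  moreover have "R \<le> norm x \<Longrightarrow> inv h x = x" for x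
    using R[of x] b by (metis bij_inv_eq_iff)
  ultimately show ?thesis
    using b by (auto simp: compactly_supported_def bij_imp_bij_inv bij_is_inj)
qed

text \<open>Meant for the half turn \<open>flip\<close>, which has no compact support itself. The
  bound \<open>C\<close> on the change of norms locates the support of the conjugate.\<close>

lemma compactly_supported_conj:
  fixes r :: "'a::euclidean_space \<Rightarrow> 'a"
  assumes "compactly_supported h" "continuous_on UNIV r" "\<And>x. r (r x) = x"
    and "\<And>x. norm x \<le> norm (r x) + C"
  shows "compactly_supported (r \<circ> h \<circ> r)"
proof -
  obtain R where R: "\<And>x. R \<le> norm x \<Longrightarrow> h x = x"
    using assms by (auto simp: compactly_supported_def)
  have "inj r" using assms(3) by (metis injI)
  moreover have "(r \<circ> h \<circ> r) x = x" if "R + C \<le> norm x" for x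
    using assms(4)[of x] that R[of "r x"] by (simp add: assms(3))
  ultimately show ?thesis
    using assms(1,2) unfolding compactly_supported_def
    by (intro conjI continuous_on_compose inj_compose exI[of _ "R + C"])
      (auto intro: continuous_on_subset)
qed

text \<open>The Alexander trick.\<close>

lemma compactly_supported_isotopic_id:
  assumes "compactly_supported h"
  shows "homotopic_with (homeomorphic_map euclidean euclidean) euclidean euclidean id h"
proof -
  obtain R where R: "\<And>x. R \<le> norm x \<Longrightarrow> h x = x" and c: "continuous_on UNIV h" and i: "inj h"
    using assms by (auto simp: compactly_supported_def)
  define d where "d x = h x - x" for x
  \<comment> \<open>For nonzero \<open>t\<close> this is \<open>t h(x / t)\<close>. Splitting off
    the identity gives \<open>k (0, x) = x\<close>, whatever \<open>inverse 0\<close> is, and leaves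
    a summand of norm at most a constant times \<open>t\<close>, hence continuity at
    \<open>t = 0\<close>.\<close>
  define k where "k = (\<lambda>(t::real, x). x + t *\<^sub>R d (inverse t *\<^sub>R x))"
  have cd: "continuous_on UNIV d"
    unfolding d_def by (intro continuous_intros c)
  have "bounded (d ` cball 0 R)"
    by (intro compact_imp_bounded compact_continuous_image continuous_on_subset[OF cd]) auto
  then obtain C where C: "\<And>x. norm x \<le> R \<Longrightarrow> norm (d x) \<le> C"
    unfolding bounded_iff by (metis imageI mem_cball_0)
  have dC: "norm (d x) \<le> \<bar>C\<bar>" for x
    using C[of x] R[of x] by (cases "norm x \<le> R") (auto simp: d_def)
  have k_eq: "k (t, x) = t *\<^sub>R h (inverse t *\<^sub>R x)" if "t \<noteq> 0" for t x
    using that by (simp add: k_def d_def algebra_simps)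
  have "continuous (at p within {0..1} \<times> UNIV) k" for p :: "real \<times> 'a"
  proof -
    obtain t x where p: "p = (t, x)" by force
    have "continuous (at p within {0..1} \<times> UNIV) (\<lambda>p. fst p *\<^sub>R d (inverse (fst p) *\<^sub>R snd p))"
    proof (cases "t = 0")
      case True
      have "((\<lambda>p. \<bar>C\<bar> * \<bar>fst p\<bar>) \<longlongrightarrow> \<bar>C\<bar> * \<bar>fst p\<bar>) (at p within {0..1} \<times> UNIV)"
        by (intro tendsto_intros)
      then have "((\<lambda>p. \<bar>C\<bar> * \<bar>fst p\<bar>) \<longlongrightarrow> 0) (at p within {0..1} \<times> UNIV)"
        using p True by simp
      moreover have "\<forall>\<^sub>F q in at p within {0..1} \<times> UNIV.
          norm (fst q *\<^sub>R d (inverse (fst q) *\<^sub>R snd q)) \<le> \<bar>C\<bar> * \<bar>fst q\<bar>"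
      proof (rule always_eventually, rule allI)
        fix q :: "real \<times> 'a"
        show "norm (fst q *\<^sub>R d (inverse (fst q) *\<^sub>R snd q)) \<le> \<bar>C\<bar> * \<bar>fst q\<bar>"
          using mult_left_mono[OF dC abs_ge_zero[of "fst q"]] by (simp add: mult.commute)
      qed
      ultimately have "((\<lambda>p. fst p *\<^sub>R d (inverse (fst p) *\<^sub>R snd p)) \<longlongrightarrow> 0)
          (at p within {0..1} \<times> UNIV)"
        by (rule Lim_null_comparison[rotated])
      moreover have "fst p *\<^sub>R d (inverse (fst p) *\<^sub>R snd p) = 0" using p True by simp
      ultimately show ?thesis unfolding continuous_within by (simp only:)
    next
      case False
      have nz: "fst p \<noteq> 0" using False p by simp
      have d: "isCont d y" for y using cd by (simp add: continuous_on_eq_continuous_at)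
      have "isCont (\<lambda>p. inverse (fst p) *\<^sub>R snd p) p"
        unfolding isCont_def
        by (intro tendsto_scaleR tendsto_inverse tendsto_fst tendsto_snd tendsto_ident_at nz)
      then have "isCont (\<lambda>p. d (inverse (fst p) *\<^sub>R snd p)) p"
        by (rule isCont_o2[OF _ d])
      then have "isCont (\<lambda>p. fst p *\<^sub>R d (inverse (fst p) *\<^sub>R snd p)) p"
        by (intro continuous_scaleR continuous_fst continuous_ident)
      then show ?thesis by (rule continuous_at_imp_continuous_at_within)
    qed
    then have "continuous (at p within {0..1} \<times> UNIV)
        (\<lambda>p. snd p + fst p *\<^sub>R d (inverse (fst p) *\<^sub>R snd p))"
      by (intro continuous_add continuous_snd continuous_ident)
    then show ?thesis by (simp add: k_def case_prod_unfold)
  qed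
  then have "continuous_on ({0..1} \<times> UNIV) k"
    by (simp add: continuous_on_eq_continuous_within)
  moreover have "homeomorphic_map euclidean euclidean (\<lambda>x. k (t, x))" if "t \<in> {0..1}" for t
  proof (cases "t = 0")
    case True
    then have "(\<lambda>x. k (t, x)) = id" by (auto simp: k_def)
    then show ?thesis by simp
  next
    case False
    have "compactly_supported (\<lambda>x. t *\<^sub>R h (inverse t *\<^sub>R x))"
      unfolding compactly_supported_def
    proof (intro conjI exI[of _ "t * R"] allI impI)
      show "continuous_on UNIV (\<lambda>x. t *\<^sub>R h (inverse t *\<^sub>R x))"
        by (intro continuous_intros continuous_on_compose2[OF c]) auto
      show "inj (\<lambda>x. t *\<^sub>R h (inverse t *\<^sub>R x))"
        using False by (intro injI) (simp add: inj_eq[OF i])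
      fix x :: 'a assume "t * R \<le> norm x"
      then have "R \<le> norm (inverse t *\<^sub>R x)"
        using False that by (auto simp: field_simps)
      then show "t *\<^sub>R h (inverse t *\<^sub>R x) = x" using R False by simp
    qed
    then show ?thesis
      using compactly_supported_homeomorphic_map k_eq[OF False] by simp
  qed
  moreover have "k (0, x) = id x" "k (1, x) = h x" for x
    by (simp_all add: k_def d_def)
  ultimately show ?thesis
    unfolding homotopic_with_def
    by (intro exI[of _ k]) (auto simp: prod_topology_subtopology(1) simp flip: euclidean_product_topology)
qed

section \<open>Ambient isotopy of fence surfaces\<close>

lemma disk_isotopicI:
  fixes k :: "real \<Rightarrow> complex \<Rightarrow> point"
  assumes "continuous_on ({0..1} \<times> cball 0 1) (\<lambda>p. k (fst p) (snd p))"
    and "\<And>t u. t \<in> {0..1} \<Longrightarrow> norm u \<le> 1 \<Longrightarrow> k t u \<in> S"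
    and "\<And>t. t \<in> {0..1} \<Longrightarrow> inj_on (k t) (cball 0 1)"
    and "\<And>u. k 0 u = f u" "\<And>u. k 1 u = g u"
  shows "disk_isotopic S f g"
  unfolding disk_isotopic_def homotopic_with_def
proof (rule exI[of _ "\<lambda>p. k (fst p) (snd p)"], intro conjI)
  show "continuous_map (prod_topology (top_of_set {0..1}) (top_of_set (cball 0 1))) (top_of_set S)
      (\<lambda>p. k (fst p) (snd p))"
    using assms(1,2) by (auto simp: prod_topology_subtopology_eu)
qed (use assms in auto)

lemma disk_isotopic_sym: "disk_isotopic S f g \<Longrightarrow> disk_isotopic S g f"
  unfolding disk_isotopic_def by (rule homotopic_with_symD)

lemma disk_isotopic_trans:
  "disk_isotopic S f g \<Longrightarrow> disk_isotopic S g h \<Longrightarrow> disk_isotopic S f h"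
  unfolding disk_isotopic_def by (rule homotopic_with_trans)

lemma disk_isotopic_image:
  assumes "disk_isotopic S f g" "continuous_on S h" "inj h" "h ` S \<subseteq> T"
  shows "disk_isotopic T (h \<circ> f) (h \<circ> g)"
proof -
  have "homotopic_with_canon (\<lambda>f. inj_on (h \<circ> f) (cball 0 1)) (cball 0 1) S f g"
    using assms(1) unfolding disk_isotopic_def
    by (rule homotopic_with_mono) (auto intro: comp_inj_on inj_on_subset[OF assms(3)])
  then show ?thesis
    unfolding disk_isotopic_def
    by (rule homotopic_with_compose_continuous_left) (use assms in auto)
qed

lemma disk_isotopic_cong:
  assumes "disk_isotopic S f g" "\<And>u. norm u \<le> 1 \<Longrightarrow> f' u = f u" "\<And>u. norm u \<le> 1 \<Longrightarrow> g' u = g u"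
  shows "disk_isotopic S f' g'"
  using assms(1) unfolding disk_isotopic_def
  by (rule homotopic_with_eq) (auto simp: assms(2,3) inj_on_def)

text \<open>Recentring, growing and turning back all happen inside a convex rectangle. The slim
  ellipse near \<open>P\<close> is where a disk lies that has come along a band; its angle will be 0
  at the upper and \<open>pi\<close> at the lower end of the band.\<close>

lemma std_disk_isotopic_flat:
  fixes P :: real
  assumes k: "fence_disk n k \<subseteq> S" and P: "1 \<le> P" "P \<le> real n"
  shows "disk_isotopic S (\<lambda>u. (P + Re (cis \<theta> * u) / 8, (1 + Im (cis \<theta> * u)) / 2, - real k))
           (std_disk n k)"
proof -
  define f where "f t u = (((1 - t) * P + t * ((n + 1) / 2)) +
      ((1 - t) / 8 + t / 2) * Re (cis ((1 - t) * \<theta>) * u),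
      (1 + Im (cis ((1 - t) * \<theta>) * u)) / 2, - real k)" for t :: real and u
  show ?thesis
  proof (rule disk_isotopicI)
    show "continuous_on ({0..1} \<times> cball 0 1) (\<lambda>p. f (fst p) (snd p))"
      unfolding f_def by (intro continuous_intros) auto
    show "f 0 u = (P + Re (cis \<theta> * u) / 8, (1 + Im (cis \<theta> * u)) / 2, - real k)"
      "f 1 u = std_disk n k u" for u
      by (simp_all add: f_def std_disk_def field_simps)
    fix t :: real assume t: "t \<in> {0..1}"
    define A where "A = (1 - t) / 8 + t / 2"
    have A: "0 < A" unfolding A_def using t by (cases "t = 0") (auto intro: add_nonneg_pos)
    show "inj_on (f t) (cball 0 1)"
    proof (rule inj_onI)
      fix u v assume "f t u = f t v"
      then have "cis ((1 - t) * \<theta>) * u = cis ((1 - t) * \<theta>) * v"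
        using A by (intro complex_eqI) (simp_all add: f_def A_def)
      then show "u = v" by simp
    qed
    fix u :: complex assume u: "norm u \<le> 1"
    define w where "w = cis ((1 - t) * \<theta>) * u"
    have "norm w \<le> 1" using u by (simp add: w_def norm_mult)
    then have w: "\<bar>Re w\<bar> \<le> 1" "\<bar>Im w\<bar> \<le> 1"
      using abs_Re_le_cmod[of w] abs_Im_le_cmod[of w] by linarith+
    have "\<bar>A * Re w\<bar> \<le> A" using w(1) A by (simp add: abs_mult mult_le_cancel_left1)
    moreover have "A \<le> (1 - t) * P + t * ((n + 1) / 2)"
    proof -
      have "(1 - t) * (1 / 8) \<le> (1 - t) * P" "t * (1 / 2) \<le> t * ((n + 1) / 2)"
        using t P by (intro mult_left_mono; simp)+
      then show ?thesis unfolding A_def by linarith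
    qed
    moreover have "(1 - t) * P + t * ((n + 1) / 2) + A \<le> n + 1"
    proof -
      have "(1 - t) * (P + 1 / 8) \<le> (1 - t) * (n + 1)" "t * ((n + 1) / 2 + 1 / 2) \<le> t * (n + 1)"
        using t P by (intro mult_left_mono; simp add: field_simps)+
      then show ?thesis by (simp add: A_def algebra_simps)
    qed
    ultimately have "f t u \<in> fence_disk n k"
      using w(2) by (auto simp: f_def fence_disk_def A_def simp flip: w_def)
    then show "f t u \<in> S" using k by auto
  qed
qed

text \<open>The core of a band is prolonged into the two adjacent disks for \<open>t < 0\<close> and \<open>t > 1\<close>.\<close>

definition strip :: "real \<Rightarrow> nat \<Rightarrow> nat \<Rightarrow> real \<Rightarrow> real \<Rightarrow> point" where
  "strip P i j s t = (let c = max 0 (min 1 t) in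
     (P + s * (1 - 2 * c) / 4,
      - ((2 - s) * c * (1 - c)) + max 0 (- t) + max 0 (t - 1),
      - (real i + c * (real j - real i))))"

text \<open>The height gives the clamped parameter \<open>c\<close>. At the two ends,
  \<open>x\<close> gives \<open>s\<close> and \<open>y\<close> the prolongation. In between,
  \<open>x\<close> loses \<open>s\<close> at \<open>t = 1/2\<close>, where the band is seen edge-on,
  but \<open>y\<close> determines it because \<open>c (1 - c)\<close> is nonzero.\<close>

lemma strip_inject:
  assumes "i < j" "\<bar>s\<bar> \<le> 1" "\<bar>s'\<bar> \<le> 1" "strip P i j s t = strip P i j s' t'"
  shows "s = s' \<and> t = t'"
proof -
  define c c' where "c = max 0 (min 1 t)" and "c' = max 0 (min 1 t')"
  have x: "s * (1 - 2 * c) = s' * (1 - 2 * c')"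
    and y: "- ((2 - s) * c * (1 - c)) + max 0 (- t) + max 0 (t - 1) =
      - ((2 - s') * c' * (1 - c')) + max 0 (- t') + max 0 (t' - 1)"
    and z: "c * (real j - real i) = c' * (real j - real i)"
    using assms(4) by (simp_all add: strip_def Let_def c_def c'_def)
  have cc: "c' = c" using z assms(1) by simp
  show ?thesis
  proof (cases "c = 0 \<or> c = 1")
    case True
    then have "t \<le> 0 \<and> t' \<le> 0 \<or> 1 \<le> t \<and> 1 \<le> t'"
      using cc c_def c'_def by linarith
    then show ?thesis using x y True unfolding cc by auto
  next
    case False
    then have t: "t = c" "t' = c" "0 < c" "c < 1" using cc c_def c'_def by linarith+
    then have "(2 - s) * (c * (1 - c)) = (2 - s') * (c * (1 - c))"
      using y unfolding cc by (simp add: mult.assoc)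
    then show ?thesis using t by simp
  qed
qed

lemma strip_in_fence:
  assumes "fence_disk n i \<subseteq> S" "fence_disk n j \<subseteq> S" "fence_band P i j \<subseteq> S"
    and "1 \<le> P" "P \<le> real n" "\<bar>s\<bar> \<le> 1" "-1 \<le> t" "t \<le> 2"
  shows "strip P i j s t \<in> S"
proof -
  consider "t \<le> 0" | "0 \<le> t" "t \<le> 1" | "1 \<le> t" by linarith
  then show ?thesis
  proof cases
    case 1
    then have "strip P i j s t \<in> fence_disk n i"
      using assms(4-) by (auto simp: strip_def fence_disk_def abs_if split: if_splits)
    then show ?thesis using assms(1) by auto
  next
    case 2
    then have "strip P i j s t \<in> fence_band P i j"
      using assms(6) unfolding fence_band_def strip_def Let_def
      by (intro CollectI exI[of _ s] exI[of _ t]) auto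
    then show ?thesis using assms(3) by auto
  next
    case 3
    then have "strip P i j s t \<in> fence_disk n j"
      using assms(4-) by (auto simp: strip_def fence_disk_def abs_if split: if_splits)
    then show ?thesis using assms(2) by auto
  qed
qed

text \<open>A disk slides along the prolonged core, from \<open>-1 \<le> t \<le> 0\<close> to
  \<open>1 \<le> t \<le> 2\<close>. Owing to the half twist it arrives turned by \<open>pi\<close>
  rather than reflected, which is why the counterclockwise disks in all levels fit into one
  orientation.\<close>

lemma std_disk_isotopic_band:
  assumes D: "fence_diagram (b, w)" and ij: "(i, j) \<in> set w"
  shows "disk_isotopic (fence_set (b, w)) (std_disk (length w) i) (std_disk (length w) j)"
proof -
  let ?n = "length w" and ?S = "fence_set (b, w)"
  obtain p where p: "p < ?n" "w ! p = (i, j)" using ij by (auto simp: in_set_conv_nth)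
  define P where "P = real p + 1"
  have P: "1 \<le> P" "P \<le> real ?n" using p by (auto simp: P_def)
  have l: "1 \<le> i" "i < j" "j \<le> b" using D ij by (auto simp: fence_diagram_def)
  have sub: "fence_disk ?n i \<subseteq> ?S" "fence_disk ?n j \<subseteq> ?S" "fence_band P i j \<subseteq> ?S"
    using l p by (force simp: fence_set_def P_def)+
  \<comment> \<open>The minus sign at \<open>Im u\<close> makes \<open>y\<close> increase with
    \<open>Im u\<close> in the upper disk; in the lower one both coordinates come out
    reversed.\<close>
  define f where "f t u = strip P i j (Re u / 2) (- 1 / 2 + 2 * t - Im u / 2)" for t :: real and u
  have "disk_isotopic ?S (f 0) (f 1)"
  proof (rule disk_isotopicI[where k = f])
    show "continuous_on ({0..1} \<times> cball 0 1) (\<lambda>p. f (fst p) (snd p))"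
      unfolding f_def strip_def Let_def by (intro continuous_intros) auto
    fix t :: real assume t: "t \<in> {0..1}"
    have B: "\<bar>Re u\<bar> \<le> 1" "\<bar>Im u\<bar> \<le> 1" if "norm u \<le> 1" for u :: complex
      using that abs_Re_le_cmod[of u] abs_Im_le_cmod[of u] by linarith+
    show "inj_on (f t) (cball 0 1)"
    proof (rule inj_onI)
      fix u v :: complex assume "u \<in> cball 0 1" "v \<in> cball 0 1" and e: "f t u = f t v"
      then have "\<bar>Re u / 2\<bar> \<le> 1" "\<bar>Re v / 2\<bar> \<le> 1" using B(1)[of u] B(1)[of v] by auto
      from strip_inject[OF l(2) this e[unfolded f_def]]
      show "u = v" by (simp add: complex_eq_iff)
    qed
    fix u :: complex assume "norm u \<le> 1"
    then show "f t u \<in> ?S"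
      unfolding f_def using B[of u] t by (intro strip_in_fence[OF sub P]) (auto simp: abs_if split: if_splits)
  qed auto
  moreover have "disk_isotopic ?S (f 0) (std_disk ?n i)"
  proof (rule disk_isotopic_cong[OF std_disk_isotopic_flat[OF sub(1) P, of 0]])
    fix u :: complex assume "norm u \<le> 1"
    then have "\<bar>Im u\<bar> \<le> 1" using abs_Im_le_cmod[of u] by linarith
    then have "max 0 (min 1 (- 1 / 2 + 2 * 0 - Im u / 2)) = 0"
      "max 0 (- (- 1 / 2 + 2 * 0 - Im u / 2)) = 1 / 2 + Im u / 2"
      "max 0 (- 1 / 2 + 2 * 0 - Im u / 2 - 1) = 0" by simp_all
    then show "f 0 u = (P + Re (cis 0 * u) / 8, (1 + Im (cis 0 * u)) / 2, - real i)"
      unfolding f_def strip_def Let_def by (simp add: add_divide_distrib)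
  qed auto
  moreover have "disk_isotopic ?S (f 1) (std_disk ?n j)"
  proof (rule disk_isotopic_cong[OF std_disk_isotopic_flat[OF sub(2) P, of pi]])
    fix u :: complex assume "norm u \<le> 1"
    then have "\<bar>Im u\<bar> \<le> 1" using abs_Im_le_cmod[of u] by linarith
    then have "max 0 (min 1 (- 1 / 2 + 2 * 1 - Im u / 2)) = 1"
      "max 0 (- (- 1 / 2 + 2 * 1 - Im u / 2)) = 0"
      "max 0 (- 1 / 2 + 2 * 1 - Im u / 2 - 1) = 1 / 2 - Im u / 2" by simp_all
    then show "f 1 u = (P + Re (cis pi * u) / 8, (1 + Im (cis pi * u)) / 2, - real j)"
      unfolding f_def strip_def Let_def by (simp add: diff_divide_distrib)
  qed auto
  ultimately show ?thesis
    by (meson disk_isotopic_sym disk_isotopic_trans)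
qed

text \<open>A connected surface is oriented by a single embedded disk. The standard one in disk 1 is
  fixed by \<open>h\<close>, so \<open>h\<close> respects the orientations without being traced
  anywhere else.\<close>

lemma ambient_isotopic_fences:
  assumes h: "compactly_supported h" "h ` fence_set D = fence_set D'"
    and fix1: "\<And>x. x \<in> fence_disk n 1 \<Longrightarrow> h x = x"
    and n: "length (snd D) = n" "length (snd D') = n" and b: "1 \<le> fst D" "1 \<le> fst D'"
    and con: "\<And>k. k \<in> {1..fst D} \<Longrightarrow> disk_isotopic (fence_set D) (std_disk n 1) (std_disk n k)"
    and con': "\<And>k. k \<in> {1..fst D'} \<Longrightarrow> disk_isotopic (fence_set D') (std_disk n 1) (std_disk n k)"
  shows "ambient_isotopic (fence_surface D) (fence_surface D')"
proof -
  have bij: "bij h" by (rule compactly_supported_bij[OF h(1)])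
  have or: "snd (fence_surface D) = {e. disk_isotopic (fence_set D) (std_disk n 1) e}"
    using con b disk_isotopic_trans unfolding fence_surface_def n snd_conv by fastforce
  have or': "snd (fence_surface D') = {e. disk_isotopic (fence_set D') (std_disk n 1) e}"
    using con' b disk_isotopic_trans unfolding fence_surface_def n snd_conv by fastforce
  have std: "h (std_disk n 1 u) = std_disk n 1 u" "inv h (std_disk n 1 u) = std_disk n 1 u"
    if "norm u \<le> 1" for u
  proof -
    have "std_disk n 1 u \<in> fence_disk n 1"
      using that abs_Re_le_cmod[of u] abs_Im_le_cmod[of u]
      by (auto simp: std_disk_def fence_disk_def abs_if split: if_splits)
    then show h1: "h (std_disk n 1 u) = std_disk n 1 u" by (rule fix1)
    then show "inv h (std_disk n 1 u) = std_disk n 1 u"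
      using bij by (metis bij_inv_eq_iff)
  qed
  have "(\<lambda>e. h \<circ> e) ` {e. disk_isotopic (fence_set D) (std_disk n 1) e} =
      {e. disk_isotopic (fence_set D') (std_disk n 1) e}"
  proof (intro subset_antisym subsetI)
    fix e' assume "e' \<in> (\<lambda>e. h \<circ> e) ` {e. disk_isotopic (fence_set D) (std_disk n 1) e}"
    then obtain e where e: "disk_isotopic (fence_set D) (std_disk n 1) e" "e' = h \<circ> e" by auto
    have "disk_isotopic (fence_set D') (h \<circ> std_disk n 1) (h \<circ> e)"
      using e h bij by (intro disk_isotopic_image[of "fence_set D"])
        (auto simp: compactly_supported_def intro: continuous_on_subset)
    then show "e' \<in> {e. disk_isotopic (fence_set D') (std_disk n 1) e}"
      using e(2) std by (auto elim!: disk_isotopic_cong)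
  next
    fix e assume "e \<in> {e. disk_isotopic (fence_set D') (std_disk n 1) e}"
    then have e: "disk_isotopic (fence_set D') (std_disk n 1) e" by simp
    have "inv h ` fence_set D' = fence_set D"
      using h(2) bij by (metis bij_is_inj image_inv_f_f)
    then have "disk_isotopic (fence_set D) (inv h \<circ> std_disk n 1) (inv h \<circ> e)"
      using e compactly_supported_inv[OF h(1)]
      by (intro disk_isotopic_image[of "fence_set D'"])
        (auto simp: compactly_supported_def intro: continuous_on_subset)
    then have "disk_isotopic (fence_set D) (std_disk n 1) (inv h \<circ> e)"
      using std by (auto elim!: disk_isotopic_cong)
    moreover have "e = h \<circ> (inv h \<circ> e)"
      using bij by (simp add: fun_eq_iff bij_is_surj surj_f_inv_f)
    ultimately show "e \<in> (\<lambda>e. h \<circ> e) ` {e. disk_isotopic (fence_set D) (std_disk n 1) e}"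
      by blast
  qed
  then show ?thesis
    unfolding ambient_isotopic_def or or'
    using compactly_supported_isotopic_id[OF h(1)] h(2)
    by (intro exI[of _ h]) (simp add: fence_surface_def)
qed

section \<open>Moving twisted ribbons\<close>

lemma compactly_supportedI:
  fixes h :: "point \<Rightarrow> point"
  assumes "continuous_on UNIV h" "inj h"
    and "\<And>x y z. M < \<bar>x\<bar> \<or> M < \<bar>y\<bar> \<or> M < \<bar>z\<bar> \<Longrightarrow> h (x, y, z) = (x, y, z)"
  shows "compactly_supported h"
  unfolding compactly_supported_def
proof (intro conjI exI[of _ "3 * M + 1"] allI impI)
  fix p :: point assume p: "3 * M + 1 \<le> norm p"
  obtain x y z where xyz: "p = (x, y, z)" by (cases p)
  have "norm p \<le> \<bar>x\<bar> + (\<bar>y\<bar> + \<bar>z\<bar>)"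
    unfolding xyz using norm_Pair_le[of x "(y, z)"] norm_Pair_le[of y z] by simp
  then show "h p = p" using p assms(3) xyz by (smt (verit))
qed (use assms in auto)

text \<open>Horizontal planes are identified with the complex plane.\<close>

definition ribbon :: "real set \<Rightarrow> (real \<Rightarrow> complex) \<Rightarrow> (real \<Rightarrow> complex) \<Rightarrow> point set" where
  "ribbon I c v =
     {(Re (c z + of_real s * v z), Im (c z + of_real s * v z), z) | s z. \<bar>s\<bar> \<le> 1 \<and> z \<in> I}"

text \<open>The identity plus this cut-off affine field will be the map of a plane, injective
  because of the Lipschitz constant 1/2. As in a product rule, the slope
  \<open>1 / (R0 - R1)\<close> of the cut-off meets the bound
  \<open>norm \<delta> + norm \<kappa> * R0\<close> of the field, and the slope
  \<open>norm \<kappa>\<close> of the field meets the bound 1 of the cut-off.\<close>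

lemma bump_lipschitz:
  fixes \<delta> \<kappa> d d' :: complex and R0 R1 :: real
  defines "g \<equiv> \<lambda>r. max 0 (min 1 ((R0 - r) / (R0 - R1)))"
  assumes R: "0 < R1" "R1 < R0"
    and small: "(norm \<delta> + norm \<kappa> * R0) / (R0 - R1) + norm \<kappa> \<le> 1 / 2"
  shows "norm (of_real (g (norm d)) * (\<delta> + \<kappa> * d) - of_real (g (norm d')) * (\<delta> + \<kappa> * d'))
    \<le> norm (d - d') / 2"
proof -
  have g01: "0 \<le> g r" "g r \<le> 1" for r by (auto simp: g_def)
  have g0: "g r = 0" if "R0 \<le> r" for r
    using divide_nonpos_pos[of "R0 - r" "R0 - R1"] that R unfolding g_def by linarith
  have gl: "\<bar>g r - g r'\<bar> \<le> \<bar>r - r'\<bar> / (R0 - R1)" for r r'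
  proof -
    have "\<bar>g r - g r'\<bar> \<le> \<bar>(R0 - r) / (R0 - R1) - (R0 - r') / (R0 - R1)\<bar>"
      unfolding g_def by linarith
    also have "\<dots> = \<bar>r - r'\<bar> / (R0 - R1)"
      using R by (simp add: diff_divide_distrib[symmetric] abs_minus_commute)
    finally show ?thesis .
  qed
  \<comment> \<open>The field is bounded only within radius \<open>R0\<close>, so one point is
    assumed to lie there. By symmetry this leaves the case of two outer points, where both terms
    vanish.\<close>
  have *: "norm (of_real (g (norm d)) * (\<delta> + \<kappa> * d) - of_real (g (norm d')) * (\<delta> + \<kappa> * d'))
      \<le> norm (d - d') / 2" if "norm d' \<le> R0" for d d'
  proof -
    have "of_real (g (norm d)) * (\<delta> + \<kappa> * d) - of_real (g (norm d')) * (\<delta> + \<kappa> * d') =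
        of_real (g (norm d)) * (\<kappa> * (d - d')) + of_real (g (norm d) - g (norm d')) * (\<delta> + \<kappa> * d')"
      by (simp add: algebra_simps)
    also have "norm \<dots> \<le> norm (of_real (g (norm d)) * (\<kappa> * (d - d'))) +
        norm (of_real (g (norm d) - g (norm d')) * (\<delta> + \<kappa> * d'))"
      by (rule norm_triangle_ineq)
    also have "\<dots> = g (norm d) * (norm \<kappa> * norm (d - d')) + \<bar>g (norm d) - g (norm d')\<bar> * norm (\<delta> + \<kappa> * d')"
      using g01 by (simp only: norm_mult norm_of_real abs_of_nonneg)
    also have "\<dots> \<le> 1 * (norm \<kappa> * norm (d - d')) +
        (norm (d - d') / (R0 - R1)) * (norm \<delta> + norm \<kappa> * R0)"
    proof (intro add_mono mult_mono)
      show "\<bar>g (norm d) - g (norm d')\<bar> \<le> norm (d - d') / (R0 - R1)"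
        using gl[of "norm d" "norm d'"] norm_triangle_ineq3[of d d'] R
        by (meson diff_gt_0_iff_gt divide_right_mono less_imp_le order_trans)
      have "norm (\<delta> + \<kappa> * d') \<le> norm \<delta> + norm \<kappa> * norm d'"
        using norm_triangle_ineq[of \<delta> "\<kappa> * d'"] by (simp add: norm_mult)
      also have "\<dots> \<le> norm \<delta> + norm \<kappa> * R0" using that by (simp add: mult_left_mono)
      finally show "norm (\<delta> + \<kappa> * d') \<le> norm \<delta> + norm \<kappa> * R0" .
    qed (use g01 R in auto)
    also have "\<dots> = ((norm \<delta> + norm \<kappa> * R0) / (R0 - R1) + norm \<kappa>) * norm (d - d')"
      by (simp add: algebra_simps)
    also have "\<dots> \<le> 1 / 2 * norm (d - d')" using small by (rule mult_right_mono) simp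
    finally show ?thesis by simp
  qed
  consider "norm d' \<le> R0" | "norm d \<le> R0" | "R0 \<le> norm d" "R0 \<le> norm d'" by linarith
  then show ?thesis
  proof cases
    case 2
    from *[OF this, of d'] show ?thesis by (simp add: norm_minus_commute)
  qed (use * g0 in auto)
qed

text \<open>In each level the map is affine within \<open>R1\<close> of the center, with factor
  \<open>v' / v\<close>, so it carries \<open>c + s v\<close> to \<open>c' + s v'\<close>; beyond
  \<open>R0\<close> it is the identity. For so small a step it is injective by
  \<open>bump_lipschitz\<close>.\<close>

lemma ribbon_step:
  fixes c c' v v' :: "real \<Rightarrow> complex"
  assumes ab: "a \<le> b" and R: "0 < R1" "R1 < R0"
    and cont: "continuous_on {a..b} c" "continuous_on {a..b} c'"
      "continuous_on {a..b} v" "continuous_on {a..b} v'"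
    and v: "\<And>z. z \<in> {a..b} \<Longrightarrow> v z \<noteq> 0" "\<And>z. z \<in> {a..b} \<Longrightarrow> norm (v z) \<le> R1"
    and ends: "c a = c' a" "c b = c' b" "v a = v' a" "v b = v' b"
    and small: "\<And>z. z \<in> {a..b} \<Longrightarrow>
      (norm (c' z - c z) + norm (v' z / v z - 1) * R0) / (R0 - R1) + norm (v' z / v z - 1) \<le> 1 / 2"
  obtains G where "compactly_supported G" "G ` ribbon {a..b} c v = ribbon {a..b} c' v'"
    "\<And>x y z. z \<notin> {a<..<b} \<or> R0 \<le> norm (Complex x y - c z) \<Longrightarrow> G (x, y, z) = (x, y, z)"
proof -
  \<comment> \<open>Levels are clamped to \<open>[a, b]\<close>, where the data are continuous. At
    both ends the field vanishes by \<open>ends\<close>, so the map is the identity above and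
    below.\<close>
  define k where "k z = max a (min b z)" for z
  have k: "k z \<in> {a..b}" "z \<in> {a..b} \<Longrightarrow> k z = z" for z using ab by (auto simp: k_def)
  define g where "g r = max 0 (min 1 ((R0 - r) / (R0 - R1)))" for r
  define \<delta> where "\<delta> z = c' (k z) - c (k z)" for z
  define \<kappa> where "\<kappa> z = v' (k z) / v (k z) - 1" for z
  define u where "u z w = of_real (g (norm (w - c (k z)))) * (\<delta> z + \<kappa> z * (w - c (k z)))" for z :: real and w :: complex
  define G :: "point \<Rightarrow> point" where
    "G = (\<lambda>(x, y, z). (x + Re (u z (Complex x y)), y + Im (u z (Complex x y)), z))"
  have lip: "norm (u z w - u z w') \<le> norm (w - w') / 2" for z :: real and w w' :: complex
    using bump_lipschitz[where d = "w - c (k z)" and d' = "w' - c (k z)", OF R small[OF k(1)[of z]]]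
    unfolding u_def g_def \<delta>_def \<kappa>_def by simp
  have ck: "continuous_on UNIV (\<lambda>z. f (k z))" if "continuous_on {a..b} f" for f :: "real \<Rightarrow> complex"
    using k(1) by (intro continuous_on_compose2[OF that]) (auto simp: k_def intro!: continuous_intros)
  have ck2: "continuous_on UNIV (\<lambda>p::point. f (k (snd (snd p))))" if "continuous_on {a..b} f" for f :: "real \<Rightarrow> complex"
    by (rule continuous_on_compose2[OF ck[OF that]]) (auto intro!: continuous_intros)
  have "continuous_on UNIV (\<lambda>p::point. u (snd (snd p)) (Complex (fst p) (fst (snd p))))"
  proof -
    have e: "Complex x y = of_real x + \<i> * of_real y" for x y by (simp add: complex_eq_iff)
    show ?thesis
      unfolding u_def \<delta>_def \<kappa>_def g_def e
      by (intro continuous_intros ck2 cont) (use R v(1)[OF k(1)] in auto)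
  qed
  then have "continuous_on UNIV G"
    unfolding G_def case_prod_unfold by (intro continuous_intros)
  moreover have "inj G"
  proof (rule injI)
    fix p q assume e: "G p = G q"
    obtain x y z x' y' z' where p: "p = (x, y, z)" "q = (x', y', z')" by (cases p, cases q)
    have z: "z' = z" and "Complex x y + u z (Complex x y) = Complex x' y' + u z (Complex x' y')"
      using e by (auto simp: G_def p complex_eq_iff)
    then have "u z (Complex x' y') - u z (Complex x y) = Complex x y - Complex x' y'"
      by (simp add: algebra_simps)
    then have "norm (Complex x y - Complex x' y') \<le> norm (Complex x' y' - Complex x y) / 2"
      using lip[of z "Complex x' y'" "Complex x y"] by simp
    then have "norm (Complex x y - Complex x' y') \<le> 0" by (simp add: norm_minus_commute)
    then show "p = q" using z p by simp
  qed
  moreover have fix0: "G (x, y, z) = (x, y, z)" if "z \<notin> {a<..<b} \<or> R0 \<le> norm (Complex x y - c (k z))" for x y z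
  proof (cases "z \<in> {a<..<b}")
    case True
    then have "(R0 - norm (Complex x y - c (k z))) / (R0 - R1) \<le> 0"
      using that R by (intro divide_nonpos_pos) auto
    then show ?thesis by (simp add: G_def u_def g_def)
  next
    case False
    then have "k z = a \<or> k z = b" using ab by (auto simp: k_def)
    then have "\<delta> z = 0" "\<kappa> z = 0" using ends v(1)[of a] v(1)[of b] ab by (auto simp: \<delta>_def \<kappa>_def)
    then show ?thesis by (simp add: G_def u_def)
  qed
  moreover obtain C where C: "\<And>z. z \<in> {a..b} \<Longrightarrow> norm (c z) \<le> C"
    using compact_imp_bounded[OF compact_continuous_image[OF cont(1) compact_Icc]]
    unfolding bounded_iff by blast
  ultimately have "compactly_supported G"
  proof (intro compactly_supportedI[of _ "C + R0 + \<bar>a\<bar> + \<bar>b\<bar>"])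
    fix x y z assume *: "C + R0 + \<bar>a\<bar> + \<bar>b\<bar> < \<bar>x\<bar> \<or> C + R0 + \<bar>a\<bar> + \<bar>b\<bar> < \<bar>y\<bar> \<or> C + R0 + \<bar>a\<bar> + \<bar>b\<bar> < \<bar>z\<bar>"
    have "0 \<le> C" using C[of a] ab norm_ge_zero[of "c a"] by (simp del: norm_ge_zero)
    then have "z \<notin> {a<..<b} \<or> C + R0 \<le> \<bar>x\<bar> \<or> C + R0 \<le> \<bar>y\<bar>" using * R by auto
    moreover have "R0 \<le> norm (Complex x y - c (k z))" if "C + R0 \<le> \<bar>x\<bar> \<or> C + R0 \<le> \<bar>y\<bar>"
    proof -
      have "C + R0 \<le> norm (Complex x y)"
        using that abs_Re_le_cmod[of "Complex x y"] abs_Im_le_cmod[of "Complex x y"] by auto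
      then show ?thesis using C[OF k(1)[of z]] norm_triangle_ineq2[of "Complex x y" "c (k z)"] by linarith
    qed
    ultimately show "G (x, y, z) = (x, y, z)" using fix0 by blast
  qed
  moreover have "G ` ribbon {a..b} c v = ribbon {a..b} c' v'"
  proof -
    have E: "G (Re (c z + of_real s * v z), Im (c z + of_real s * v z), z) =
        (Re (c' z + of_real s * v' z), Im (c' z + of_real s * v' z), z)"
      if z: "z \<in> {a..b}" and s: "\<bar>s\<bar> \<le> 1" for s z
    proof -
      have "norm (of_real s * v z) \<le> R1"
        using mult_mono[OF s v(2)[OF z]] R by (simp add: norm_mult)
      then have "1 \<le> (R0 - norm (of_real s * v z)) / (R0 - R1)"
        using R by (simp add: le_divide_eq)
      then have g1: "g (norm (of_real s * v z)) = 1" unfolding g_def by linarith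
      have "c z + of_real s * v z + u z (c z + of_real s * v z) = c' z + of_real s * v' z"
        using v(1)[OF z] by (simp add: u_def g1 \<delta>_def \<kappa>_def k(2)[OF z] field_simps)
      then show ?thesis
        unfolding G_def prod.case complex_surj plus_complex.simps(1)[symmetric] plus_complex.simps(2)[symmetric]
        by simp
    qed
    show ?thesis
    proof (intro subset_antisym subsetI)
      fix p assume "p \<in> G ` ribbon {a..b} c v"
      then obtain s z where "\<bar>s\<bar> \<le> 1" "z \<in> {a..b}"
        "p = G (Re (c z + of_real s * v z), Im (c z + of_real s * v z), z)"
        unfolding ribbon_def by blast
      with E show "p \<in> ribbon {a..b} c' v'" unfolding ribbon_def by blast
    next
      fix p assume "p \<in> ribbon {a..b} c' v'"
      then obtain s z where sz: "\<bar>s\<bar> \<le> 1" "z \<in> {a..b}"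
        "p = (Re (c' z + of_real s * v' z), Im (c' z + of_real s * v' z), z)"
        unfolding ribbon_def by blast
      have "(Re (c z + of_real s * v z), Im (c z + of_real s * v z), z) \<in> ribbon {a..b} c v"
        using sz unfolding ribbon_def by blast
      then show "p \<in> G ` ribbon {a..b} c v" using E[OF sz(2,1)] sz(3) by (metis imageI)
    qed
  qed
  moreover have "G (x, y, z) = (x, y, z)" if "z \<notin> {a<..<b} \<or> R0 \<le> norm (Complex x y - c z)" for x y z
  proof (cases "z \<in> {a<..<b}")
    case True
    then have "k z = z" by (intro k(2)) auto
    then show ?thesis using that True fix0[of z x y] by simp
  qed (use fix0 in auto)
  ultimately show ?thesis by (rule that)
qed

text \<open>Compactness bounds the directions away from 0 and makes the data uniformly continuous,
  so finitely many steps \<open>ribbon_step\<close> suffice. Points that the disks of radius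
  \<open>R0\<close> about the moving centers never reach stay fixed; this clearance later protects
  the other pieces.\<close>

lemma ribbon_isotopy:
  fixes c v :: "real \<Rightarrow> real \<Rightarrow> complex"
  assumes ab: "a \<le> b" and R: "0 < R1" "R1 < R0"
    and cont: "continuous_on ({0..1} \<times> {a..b}) (\<lambda>p. c (fst p) (snd p))"
      "continuous_on ({0..1} \<times> {a..b}) (\<lambda>p. v (fst p) (snd p))"
    and v: "\<And>t z. t \<in> {0..1} \<Longrightarrow> z \<in> {a..b} \<Longrightarrow> v t z \<noteq> 0 \<and> norm (v t z) \<le> R1"
    and ends: "\<And>t z. t \<in> {0..1} \<Longrightarrow> z \<in> {a, b} \<Longrightarrow> c t z = c 0 z \<and> v t z = v 0 z"
  obtains G where "compactly_supported G" "G ` ribbon {a..b} (c 0) (v 0) = ribbon {a..b} (c 1) (v 1)"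
    "\<And>x y z. z \<notin> {a<..<b} \<or> (\<forall>t\<in>{0..1}. R0 \<le> norm (Complex x y - c t z)) \<Longrightarrow> G (x, y, z) = (x, y, z)"
proof -
  let ?K = "{0..1::real} \<times> {a..b}"
  have comp: "compact ?K" by (intro compact_Times) auto
  obtain m where m: "0 < m" "\<And>t z. t \<in> {0..1} \<Longrightarrow> z \<in> {a..b} \<Longrightarrow> m \<le> norm (v t z)"
  proof -
    have "continuous_on ?K (\<lambda>p. norm (v (fst p) (snd p)))" using cont(2) by (intro continuous_intros)
    moreover have "?K \<noteq> {}" using ab by auto
    ultimately obtain p where p: "p \<in> ?K"
      "\<And>q. q \<in> ?K \<Longrightarrow> norm (v (fst p) (snd p)) \<le> norm (v (fst q) (snd q))"
      using continuous_attains_inf[OF comp, of "\<lambda>p. norm (v (fst p) (snd p))"] by blast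
    show ?thesis
    proof (rule that[of "norm (v (fst p) (snd p))"])
      show "0 < norm (v (fst p) (snd p))"
      proof -
        have "fst p \<in> {0..1}" "snd p \<in> {a..b}" using p(1) unfolding mem_Times_iff by auto
        from v[OF this] show ?thesis by auto
      qed
      show "norm (v (fst p) (snd p)) \<le> norm (v t z)" if "t \<in> {0..1}" "z \<in> {a..b}" for t z
        using p(2)[OF SigmaI[OF that]] by (simp only: fst_conv snd_conv)
    qed
  qed
  \<comment> \<open>If centers and directions change by less than \<open>\<eta>\<close>, the left
    side of the smallness condition is at most \<open>\<eta> * X\<close>, that is, 1/2.\<close>
  define X where "X = (1 + R0 / m) / (R0 - R1) + 1 / m"
  define \<eta> where "\<eta> = 1 / (2 * X)"
  have X: "0 < X" unfolding X_def using m R by (intro add_pos_pos divide_pos_pos) auto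
  then have \<eta>: "0 < \<eta>" by (simp add: \<eta>_def)
  obtain d where d: "0 < d" "\<And>t t' z. t \<in> {0..1} \<Longrightarrow> t' \<in> {0..1} \<Longrightarrow> z \<in> {a..b} \<Longrightarrow> \<bar>t' - t\<bar> < d \<Longrightarrow>
      norm (c t' z - c t z) < \<eta> \<and> norm (v t' z - v t z) < \<eta>"
  proof -
    obtain d1 where d1: "0 < d1" "\<And>p q. p \<in> ?K \<Longrightarrow> q \<in> ?K \<Longrightarrow> dist q p < d1 \<Longrightarrow>
        dist (c (fst q) (snd q)) (c (fst p) (snd p)) < \<eta>"
      using compact_uniformly_continuous[OF cont(1) comp] \<eta> unfolding uniformly_continuous_on_def by metis
    obtain d2 where d2: "0 < d2" "\<And>p q. p \<in> ?K \<Longrightarrow> q \<in> ?K \<Longrightarrow> dist q p < d2 \<Longrightarrow>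
        dist (v (fst q) (snd q)) (v (fst p) (snd p)) < \<eta>"
      using compact_uniformly_continuous[OF cont(2) comp] \<eta> unfolding uniformly_continuous_on_def by metis
    show ?thesis
    proof (rule that[of "min d1 d2"])
      fix t t' :: real and z assume t: "t \<in> {0..1}" "t' \<in> {0..1}" "z \<in> {a..b}" "\<bar>t' - t\<bar> < min d1 d2"
      have "dist (t', z) (t, z) = \<bar>t' - t\<bar>" by (simp add: dist_Pair_Pair dist_real_def)
      then show "norm (c t' z - c t z) < \<eta> \<and> norm (v t' z - v t z) < \<eta>"
        using d1(2)[of "(t, z)" "(t', z)"] d2(2)[of "(t, z)" "(t', z)"] t by (simp add: dist_norm)
    qed (use d1 d2 in auto)
  qed
  obtain N where N: "0 < N" "1 / real N < d"
    using reals_Archimedean[OF d(1)] by (metis inverse_eq_divide of_nat_0_less_iff zero_less_Suc)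
  have cs: "continuous_on {a..b} (c t)" "continuous_on {a..b} (v t)" if "t \<in> {0..1}" for t
  proof -
    have i: "continuous_on {a..b} (\<lambda>z. (t, z))" by (intro continuous_intros)
    have "Pair t ` {a..b} \<subseteq> ?K" using that by blast
    then show "continuous_on {a..b} (c t)" "continuous_on {a..b} (v t)"
      using continuous_on_compose2[OF cont(1) i] continuous_on_compose2[OF cont(2) i] by auto
  qed
  have step: "\<exists>G. compactly_supported G \<and>
      G ` ribbon {a..b} (c t) (v t) = ribbon {a..b} (c t') (v t') \<and>
      (\<forall>x y z. z \<notin> {a<..<b} \<or> R0 \<le> norm (Complex x y - c t z) \<longrightarrow> G (x, y, z) = (x, y, z))"
    if t: "t \<in> {0..1}" "t' \<in> {0..1}" "\<bar>t' - t\<bar> < d" for t t'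
  proof -
    have small: "(norm (c t' z - c t z) + norm (v t' z / v t z - 1) * R0) / (R0 - R1) + norm (v t' z / v t z - 1) \<le> 1 / 2"
      if z: "z \<in> {a..b}" for z
    proof -
      have "v t' z / v t z - 1 = (v t' z - v t z) / v t z"
        using v[OF t(1) z] by (simp add: diff_divide_distrib)
      then have n: "norm (v t' z / v t z - 1) \<le> \<eta> / m"
        using d(2)[OF t(1,2) z t(3)] m(2)[OF t(1) z] m(1) \<eta>
        by (simp add: norm_divide frac_le less_imp_le)
      have "(norm (c t' z - c t z) + norm (v t' z / v t z - 1) * R0) / (R0 - R1) + norm (v t' z / v t z - 1)
          \<le> (\<eta> + (\<eta> / m) * R0) / (R0 - R1) + \<eta> / m"
        using d(2)[OF t(1,2) z t(3)] n R
        by (intro add_mono divide_right_mono mult_right_mono) auto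
      also have "\<dots> = \<eta> * X" by (simp add: X_def algebra_simps add_divide_distrib)
      also have "\<dots> = 1 / 2" using X by (simp add: \<eta>_def)
      finally show ?thesis .
    qed
    have e: "c t z = c t' z \<and> v t z = v t' z" if "z \<in> {a, b}" for z
      using ends[OF t(1) that] ends[OF t(2) that] by simp
    show ?thesis
      using ribbon_step[OF ab R cs(1)[OF t(1)] cs(1)[OF t(2)] cs(2)[OF t(1)] cs(2)[OF t(2)] _ _ _ _ _ _ small]
        v[OF t(1)] e[of a] e[of b] by (smt (verit) insertI1 insertI2)
  qed
  have "\<exists>G. compactly_supported G \<and>
      G ` ribbon {a..b} (c 0) (v 0) = ribbon {a..b} (c (real k / N)) (v (real k / N)) \<and>
      (\<forall>x y z. z \<notin> {a<..<b} \<or> (\<forall>t\<in>{0..1}. R0 \<le> norm (Complex x y - c t z)) \<longrightarrow> G (x, y, z) = (x, y, z))"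
    if "k \<le> N" for k using that
  proof (induction k)
    case 0
    show ?case by (intro exI[of _ id] conjI compactly_supported_id) simp_all
  next
    case (Suc k)
    then obtain G where G: "compactly_supported G"
      "G ` ribbon {a..b} (c 0) (v 0) = ribbon {a..b} (c (real k / N)) (v (real k / N))"
      "\<And>x y z. z \<notin> {a<..<b} \<or> (\<forall>t\<in>{0..1}. R0 \<le> norm (Complex x y - c t z)) \<Longrightarrow> G (x, y, z) = (x, y, z)"
      by auto
    have t: "real k / N \<in> {0..1}" "real (Suc k) / N \<in> {0..1}" using Suc.prems N by auto
    have "real (Suc k) / N - real k / N = 1 / N" by (simp add: diff_divide_distrib[symmetric])
    then have "\<bar>real (Suc k) / N - real k / N\<bar> < d" using N by simp
    from step[OF t this] obtain H where H: "compactly_supported H"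
      "H ` ribbon {a..b} (c (real k / N)) (v (real k / N)) =
        ribbon {a..b} (c (real (Suc k) / N)) (v (real (Suc k) / N))"
      "\<And>x y z. z \<notin> {a<..<b} \<or> R0 \<le> norm (Complex x y - c (real k / N) z) \<Longrightarrow> H (x, y, z) = (x, y, z)"
      by blast
    show ?case
    proof (intro exI[of _ "H \<circ> G"] conjI allI impI)
      show "compactly_supported (H \<circ> G)" by (rule compactly_supported_comp[OF G(1) H(1)])
      show "(H \<circ> G) ` ribbon {a..b} (c 0) (v 0) =
          ribbon {a..b} (c (real (Suc k) / N)) (v (real (Suc k) / N))"
        by (simp only: image_comp[symmetric] G(2) H(2))
      fix x y z assume *: "z \<notin> {a<..<b} \<or> (\<forall>t\<in>{0..1}. R0 \<le> norm (Complex x y - c t z))"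
      then have "z \<notin> {a<..<b} \<or> R0 \<le> norm (Complex x y - c (real k / N) z)" using t(1) by blast
      then show "(H \<circ> G) (x, y, z) = (x, y, z)" using G(3)[OF *] H(3) by simp
    qed
  qed
  from this[of N] N show ?thesis using that by auto
qed

section \<open>The twist along a torus\<close>

definition ramp :: "real \<Rightarrow> real" where
  "ramp z = 2 * pi * max 0 (min 1 ((- 11 / 4 - z) * 2))"

text \<open>The tube has radius \<open>19/10\<close> and follows the rays \<open>x = 1\<close> and \<open>x = 5\<close> down to the level \<open>-13/4\<close>,
  where a semicircle of radius 2 in the plane \<open>y = 0\<close> joins them; \<open>(a, y)\<close> are coordinates in its
  normal sections. They are rotated by the angle \<open>ramp z\<close>, which reaches a full turn at the level
  \<open>-13/4\<close>, so that in the interior of the tube everything below is fixed. The bound \<open>1/10\<close> in the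
  denominators only prevents a division by 0 outside the tube.\<close>

definition torus_twist :: "real \<Rightarrow> point \<Rightarrow> point" where
  "torus_twist \<sigma> = (\<lambda>(x, y, z).
     let u = x - 3; \<zeta> = min (z + 13 / 4) 0; \<rho> = sqrt (u\<^sup>2 + \<zeta>\<^sup>2); a = \<rho> - 2;
       \<phi> = \<sigma> * ramp z * max 0 (min 1 ((19 / 10 - sqrt (a\<^sup>2 + y\<^sup>2)) * 5));
       b = a * cos \<phi> - y * sin \<phi> - a
     in (x + u * b / max \<rho> (1 / 10), a * sin \<phi> + y * cos \<phi>, z + \<zeta> * b / max \<rho> (1 / 10)))"

lemma rotation_identities:
  fixes a y c s :: real
  assumes "s\<^sup>2 + c\<^sup>2 = 1"
  shows "(a * c - y * s)\<^sup>2 + (a * s + y * c)\<^sup>2 = a\<^sup>2 + y\<^sup>2"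
    and "(a * c - y * s) * c + (a * s + y * c) * s = a"
    and "(a * s + y * c) * c - (a * c - y * s) * s = y"
proof -
  have "(a * c - y * s)\<^sup>2 + (a * s + y * c)\<^sup>2 = (a\<^sup>2 + y\<^sup>2) * (s\<^sup>2 + c\<^sup>2)"
    "(a * c - y * s) * c + (a * s + y * c) * s = a * (s\<^sup>2 + c\<^sup>2)"
    "(a * s + y * c) * c - (a * c - y * s) * s = y * (s\<^sup>2 + c\<^sup>2)"
    by (simp_all add: power2_eq_square algebra_simps)
  then show "(a * c - y * s)\<^sup>2 + (a * s + y * c)\<^sup>2 = a\<^sup>2 + y\<^sup>2"
    "(a * c - y * s) * c + (a * s + y * c) * s = a"
    "(a * s + y * c) * c - (a * c - y * s) * s = y"
    using assms by simp_all
qed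

lemma torus_twist_outside:
  assumes "19 / 10 \<le> sqrt ((sqrt ((x - 3)\<^sup>2 + (min (z + 13 / 4) 0)\<^sup>2) - 2)\<^sup>2 + y\<^sup>2)"
  shows "torus_twist \<sigma> (x, y, z) = (x, y, z)"
proof -
  have "max 0 (min 1 ((19 / 10 - sqrt ((sqrt ((x - 3)\<^sup>2 + (min (z + 13 / 4) 0)\<^sup>2) - 2)\<^sup>2 + y\<^sup>2)) * 5)) = 0"
    using assms by (auto simp: max_def min_def)
  then show ?thesis unfolding torus_twist_def Let_def prod.case by simp
qed

text \<open>The rotation keeps the distance \<open>d < 19/10\<close> from the core, so the old and
  the new radius \<open>\<rho>\<close> and \<open>2 + a'\<close> both exceed 1/10 and the maximum in
  the denominators is inactive. What remains is a scaling of \<open>(u, \<zeta>)\<close> by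
  \<open>(2 + a') / \<rho>\<close>.\<close>

lemma torus_twist_inside:
  assumes u: "u = x - 3" and \<zeta>: "\<zeta> = min (z + 13 / 4) 0" and \<rho>: "\<rho> = sqrt (u\<^sup>2 + \<zeta>\<^sup>2)"
    and d: "d = sqrt ((\<rho> - 2)\<^sup>2 + y\<^sup>2)" "d < 19 / 10"
    and \<phi>: "\<phi> = \<sigma> * ramp z * max 0 (min 1 ((19 / 10 - d) * 5))"
    and a': "a' = (\<rho> - 2) * cos \<phi> - y * sin \<phi>"
  shows "1 / 10 < \<rho>" "1 / 10 < 2 + a'"
    "torus_twist \<sigma> (x, y, z) =
      (3 + u * ((2 + a') / \<rho>), (\<rho> - 2) * sin \<phi> + y * cos \<phi>, z + \<zeta> * ((2 + a') / \<rho> - 1))"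
proof -
  have "\<bar>\<rho> - 2\<bar> \<le> d" unfolding d(1) by (rule real_le_rsqrt) simp
  then show \<rho>10: "1 / 10 < \<rho>" using d(2) by linarith
  have sq: "a'\<^sup>2 + ((\<rho> - 2) * sin \<phi> + y * cos \<phi>)\<^sup>2 = (\<rho> - 2)\<^sup>2 + y\<^sup>2"
    unfolding a' by (rule rotation_identities) simp
  have "\<bar>a'\<bar> \<le> d"
    unfolding d(1) sq[symmetric] by (rule real_le_rsqrt) simp
  then show "1 / 10 < 2 + a'" using d(2) by linarith
  have m: "max \<rho> (1 / 10) = \<rho>" using \<rho>10 by simp
  have "torus_twist \<sigma> (x, y, z) =
      (x + u * (a' - (\<rho> - 2)) / \<rho>, (\<rho> - 2) * sin \<phi> + y * cos \<phi>, z + \<zeta> * (a' - (\<rho> - 2)) / \<rho>)"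
    unfolding torus_twist_def Let_def prod.case u[symmetric] \<zeta>[symmetric] \<rho>[symmetric] d(1)[symmetric]
      \<phi>[symmetric] a'[symmetric] m by simp
  also have "\<dots> = (3 + u * ((2 + a') / \<rho>), (\<rho> - 2) * sin \<phi> + y * cos \<phi>, z + \<zeta> * ((2 + a') / \<rho> - 1))"
  proof -
    have "x = 3 + u" using u by simp
    then show ?thesis using \<rho>10 by (simp add: field_simps)
  qed
  finally show "torus_twist \<sigma> (x, y, z) =
      (3 + u * ((2 + a') / \<rho>), (\<rho> - 2) * sin \<phi> + y * cos \<phi>, z + \<zeta> * ((2 + a') / \<rho> - 1))" .
qed

text \<open>The angle depends on the level and on the distance from the core, and the motion affects
  neither dependence: the rotation keeps the distance, and the level changes only below -13/4, where
  \<open>ramp\<close> is constant.\<close>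

lemma torus_twist_inverse: "torus_twist (- \<sigma>) (torus_twist \<sigma> p) = p"
proof -
  obtain x y z where p: "p = (x, y, z)" by (cases p)
  define u \<zeta> where "u = x - 3" and "\<zeta> = min (z + 13 / 4) 0"
  define \<rho> where "\<rho> = sqrt (u\<^sup>2 + \<zeta>\<^sup>2)"
  define d where "d = sqrt ((\<rho> - 2)\<^sup>2 + y\<^sup>2)"
  show ?thesis
  proof (cases "19 / 10 \<le> d")
    case True
    then show ?thesis
      using torus_twist_outside unfolding d_def \<rho>_def u_def \<zeta>_def p by simp
  next
    case False
    define \<phi> where "\<phi> = \<sigma> * ramp z * max 0 (min 1 ((19 / 10 - d) * 5))"
    define a' y' where "a' = (\<rho> - 2) * cos \<phi> - y * sin \<phi>" and "y' = (\<rho> - 2) * sin \<phi> + y * cos \<phi>"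
    define q where "q = (2 + a') / \<rho>"
    define x' z' where "x' = 3 + u * q" and "z' = z + \<zeta> * (q - 1)"
    have *: "1 / 10 < \<rho>" "1 / 10 < 2 + a'" "torus_twist \<sigma> p = (x', y', z')"
      using torus_twist_inside[OF u_def \<zeta>_def \<rho>_def d_def _ \<phi>_def a'_def] False
      unfolding p q_def y'_def x'_def z'_def by auto
    have q: "0 < q" using * by (simp add: q_def)
    have \<zeta>': "\<zeta> * q = min (z' + 13 / 4) 0"
    proof (cases "z + 13 / 4 \<le> 0")
      case True
      then have "\<zeta> = z + 13 / 4" by (simp add: \<zeta>_def)
      then have "z' + 13 / 4 = \<zeta> * q" by (simp add: z'_def field_simps)
      moreover have "\<zeta> * q \<le> 0" using q \<open>\<zeta> = z + 13 / 4\<close> True by (simp add: mult_nonpos_nonneg)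
      ultimately show ?thesis by simp
    next
      case False
      then have "\<zeta> = 0" by (simp add: \<zeta>_def)
      then show ?thesis using False by (simp add: z'_def)
    qed
    have r: "ramp z' = ramp z"
    proof (cases "z + 13 / 4 < 0")
      case True
      then have "\<zeta> * q < 0" using q by (simp add: \<zeta>_def mult_neg_pos)
      then have "z' + 13 / 4 < 0" unfolding \<zeta>' by linarith
      then show ?thesis using True by (simp add: ramp_def)
    next
      case False
      then have "\<zeta> = 0" by (simp add: \<zeta>_def)
      then show ?thesis by (simp add: z'_def)
    qed
    have "sqrt ((u * q)\<^sup>2 + (\<zeta> * q)\<^sup>2) = \<rho> * q"
      using q by (simp add: \<rho>_def power_mult_distrib flip: distrib_right real_sqrt_mult)
        (simp add: real_sqrt_mult)
    also have "\<rho> * q = 2 + a'" using * by (simp add: q_def)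
    finally have \<rho>': "2 + a' = sqrt ((x' - 3)\<^sup>2 + (min (z' + 13 / 4) 0)\<^sup>2)"
      unfolding \<zeta>' by (simp add: x'_def)
    have "a'\<^sup>2 + y'\<^sup>2 = (\<rho> - 2)\<^sup>2 + y\<^sup>2"
      unfolding a'_def y'_def by (rule rotation_identities) simp
    then have d': "d = sqrt ((2 + a' - 2)\<^sup>2 + y'\<^sup>2)" by (simp add: d_def)
    have \<phi>': "- \<phi> = - \<sigma> * ramp z' * max 0 (min 1 ((19 / 10 - d) * 5))"
      by (simp add: r \<phi>_def)
    have "a' * cos \<phi> + y' * sin \<phi> = \<rho> - 2" "y' * cos \<phi> - a' * sin \<phi> = y"
      unfolding a'_def y'_def by (rule rotation_identities; simp)+
    then have a'': "\<rho> - 2 = (2 + a' - 2) * cos (- \<phi>) - y' * sin (- \<phi>)"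
      and y'': "(2 + a' - 2) * sin (- \<phi>) + y' * cos (- \<phi>) = y" by simp_all
    have "torus_twist (- \<sigma>) (x', y', z') =
        (3 + (x' - 3) * ((2 + (\<rho> - 2)) / (2 + a')), (2 + a' - 2) * sin (- \<phi>) + y' * cos (- \<phi>),
          z' + min (z' + 13 / 4) 0 * ((2 + (\<rho> - 2)) / (2 + a') - 1))"
      using torus_twist_inside(3)[OF refl refl \<rho>' d' _ \<phi>' a''] False by simp
    also have "(2 + (\<rho> - 2)) / (2 + a') = 1 / q" by (simp add: q_def)
    also have "(3 + (x' - 3) * (1 / q), (2 + a' - 2) * sin (- \<phi>) + y' * cos (- \<phi>),
        z' + min (z' + 13 / 4) 0 * (1 / q - 1)) = (x, y, z)"
      unfolding y'' \<zeta>'[symmetric] using q by (simp add: x'_def z'_def u_def algebra_simps)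
    finally show ?thesis unfolding *(3) unfolding p .
  qed
qed

text \<open>The tube has no upper end, but above the level -11/4 the angle is 0, and the rest of the
  tube is bounded.\<close>

lemma compactly_supported_torus_twist: "compactly_supported (torus_twist \<sigma>)"
proof (rule compactly_supportedI[of _ 8])
  show "continuous_on UNIV (torus_twist \<sigma>)"
    unfolding torus_twist_def Let_def case_prod_unfold ramp_def
    by (intro continuous_intros) auto
  show "inj (torus_twist \<sigma>)"
    by (rule inj_on_inverseI[of _ "torus_twist (- \<sigma>)"]) (rule torus_twist_inverse)
  fix x y z :: real assume *: "8 < \<bar>x\<bar> \<or> 8 < \<bar>y\<bar> \<or> 8 < \<bar>z\<bar>"
  define \<zeta> where "\<zeta> = min (z + 13 / 4) 0"
  define \<rho> where "\<rho> = sqrt ((x - 3)\<^sup>2 + \<zeta>\<^sup>2)"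
  define d where "d = sqrt ((\<rho> - 2)\<^sup>2 + y\<^sup>2)"
  have b: "\<bar>x - 3\<bar> \<le> \<rho>" "\<bar>\<zeta>\<bar> \<le> \<rho>" "\<bar>\<rho> - 2\<bar> \<le> d" "\<bar>y\<bar> \<le> d"
    unfolding \<rho>_def d_def by (rule real_le_rsqrt, simp)+
  show "torus_twist \<sigma> (x, y, z) = (x, y, z)"
  proof (cases "z \<le> - 11 / 4")
    case True
    have "19 / 10 \<le> d"
    proof (rule ccontr)
      assume "\<not> 19 / 10 \<le> d"
      then have "\<rho> < 39 / 10" "\<bar>y\<bar> < 2" using b(3,4) by linarith+
      then have "\<bar>x\<bar> < 8" "\<bar>\<zeta>\<bar> < 39 / 10" using b(1,2) by linarith+
      moreover have "\<bar>z\<bar> \<le> 8"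
        using calculation(2) True unfolding \<zeta>_def by (simp add: min_def abs_if split: if_splits)
      ultimately show False using * \<open>\<bar>y\<bar> < 2\<close> by linarith
    qed
    then show ?thesis unfolding d_def \<rho>_def \<zeta>_def by (rule torus_twist_outside)
  next
    case False
    then have "ramp z = 0" by (simp add: ramp_def)
    then show ?thesis unfolding torus_twist_def Let_def prod.case by simp
  qed
qed

lemma torus_twist_above: "- 11 / 4 \<le> z \<Longrightarrow> torus_twist \<sigma> (x, y, z) = (x, y, z)"
proof -
  assume "- 11 / 4 \<le> z"
  then have "ramp z = 0" by (simp add: ramp_def)
  then show ?thesis unfolding torus_twist_def Let_def prod.case by simp
qed

text \<open>These points lie below the ramp and within 17/10 of the core, where the cut-off is still
  1, so they make exactly one full turn. Indeed \<open>3/4 \<le> \<rho> \<le> 13/4\<close>, and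
  \<open>(5/4)\<^sup>2 + 1 < (17/10)\<^sup>2\<close>. The alternative \<open>z = - 4\<close> admits
  the part of disk 4 near \<open>x = 3\<close>.\<close>

lemma torus_twist_core:
  assumes "z \<le> - 13 / 4" "\<bar>x - 3\<bar> \<le> 3" "- 4 \<le> z" "3 / 4 \<le> \<bar>x - 3\<bar> \<or> z = - 4" "\<bar>y\<bar> \<le> 1"
  shows "torus_twist 1 (x, y, z) = (x, y, z)"
proof -
  define \<zeta> where "\<zeta> = min (z + 13 / 4) 0"
  define \<rho> where "\<rho> = sqrt ((x - 3)\<^sup>2 + \<zeta>\<^sup>2)"
  define d where "d = sqrt ((\<rho> - 2)\<^sup>2 + y\<^sup>2)"
  have \<zeta>: "\<bar>\<zeta>\<bar> \<le> 3 / 4" "z = - 4 \<longrightarrow> \<bar>\<zeta>\<bar> = 3 / 4" using assms by (auto simp: \<zeta>_def)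
  have "\<bar>x - 3\<bar> \<le> \<rho>" "\<bar>\<zeta>\<bar> \<le> \<rho>" unfolding \<rho>_def by (rule real_le_rsqrt, simp)+
  then have l: "3 / 4 \<le> \<rho>" using assms(4) \<zeta> by auto
  have "(x - 3)\<^sup>2 \<le> 3\<^sup>2" "\<zeta>\<^sup>2 \<le> (3 / 4)\<^sup>2"
    using assms(2) \<zeta>(1) by (intro power2_le_iff_abs_le[THEN iffD2]; simp)+
  then have "\<rho> \<le> 13 / 4" unfolding \<rho>_def by (intro real_le_lsqrt) (auto simp: power2_eq_square)
  then have "\<bar>\<rho> - 2\<bar> \<le> 5 / 4" using l by linarith
  then have "(\<rho> - 2)\<^sup>2 \<le> (5 / 4)\<^sup>2" by (intro power2_le_iff_abs_le[THEN iffD2]) auto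
  moreover have "y\<^sup>2 \<le> 1\<^sup>2" using assms(5) by (intro power2_le_iff_abs_le[THEN iffD2]) auto
  ultimately have d: "d \<le> 17 / 10" unfolding d_def by (intro real_le_lsqrt) (auto simp: power2_eq_square)
  have \<phi>: "2 * pi = 1 * ramp z * max 0 (min 1 ((19 / 10 - d) * 5))"
    using d assms(1) by (simp add: ramp_def)
  show ?thesis
    using torus_twist_inside(1,3)[OF refl \<zeta>_def \<rho>_def d_def _ \<phi> refl] d by simp
qed

text \<open>The decisive sign: the outward radial coordinate is \<open>- Re w\<close> on the left
  ray but \<open>Re w\<close> on the right one, so the same rotation of the tube takes a turn from
  one ribbon and gives it to the other. As \<open>\<zeta> = 0\<close> here, levels are kept.\<close>

lemma torus_twist_left:
  assumes "- 13 / 4 \<le> z" "z \<le> - 11 / 4" "norm w \<le> 1 / 4"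
  shows "torus_twist 1 (1 + Re w, Im w, z) =
    (1 + Re (cis (- ramp z) * w), Im (cis (- ramp z) * w), z)"
proof -
  have "\<bar>Re w\<bar> \<le> 1 / 4" using abs_Re_le_cmod[of w] assms(3) by linarith
  then have "\<bar>1 + Re w - 3\<bar> = 2 - Re w" by linarith
  then have \<rho>: "2 - Re w = sqrt ((1 + Re w - 3)\<^sup>2 + (min (z + 13 / 4) 0)\<^sup>2)"
    using assms(1) by simp
  define d where "d = sqrt ((2 - Re w - 2)\<^sup>2 + (Im w)\<^sup>2)"
  have d: "d \<le> 1 / 4" using assms(3) by (simp add: d_def cmod_def)
  then have \<phi>: "ramp z = 1 * ramp z * max 0 (min 1 ((19 / 10 - d) * 5))" by simp
  show ?thesis
    using torus_twist_inside(1,3)[OF refl refl \<rho> d_def _ \<phi> refl] d assms(1)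
    by (simp add: field_simps)
qed

lemma torus_twist_right:
  assumes "- 13 / 4 \<le> z" "z \<le> - 11 / 4" "norm w \<le> 1 / 4"
  shows "torus_twist 1 (5 + Re w, Im w, z) =
    (5 + Re (cis (ramp z) * w), Im (cis (ramp z) * w), z)"
proof -
  have "\<bar>Re w\<bar> \<le> 1 / 4" using abs_Re_le_cmod[of w] assms(3) by linarith
  then have "\<bar>5 + Re w - 3\<bar> = 2 + Re w" by linarith
  then have \<rho>: "2 + Re w = sqrt ((5 + Re w - 3)\<^sup>2 + (min (z + 13 / 4) 0)\<^sup>2)"
    using assms(1) by simp
  define d where "d = sqrt ((2 + Re w - 2)\<^sup>2 + (Im w)\<^sup>2)"
  have d: "d \<le> 1 / 4" using assms(3) by (simp add: d_def cmod_def)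
  then have \<phi>: "ramp z = 1 * ramp z * max 0 (min 1 ((19 / 10 - d) * 5))" by simp
  show ?thesis
    using torus_twist_inside(1,3)[OF refl refl \<rho> d_def _ \<phi> refl] d assms(1)
    by (simp add: field_simps)
qed

section \<open>The model ribbons and the effect of the twist on them\<close>

text \<open>Distance of the cores of the two long ribbons from the plane \<open>x = 0\<close>, respectively \<open>x = 6\<close>.\<close>

definition core :: "real \<Rightarrow> real" where
  "core z = 1 + max 0 (min 1 ((\<bar>z + 3\<bar> - 1 / 4) * 4 / 3))"

definition left_ribbon :: "(real \<Rightarrow> real) \<Rightarrow> point set" where
  "left_ribbon \<alpha> = ribbon {-4..-2} (\<lambda>z. of_real (core z)) (\<lambda>z. cis (\<alpha> z) / 4)"

definition right_ribbon :: "(real \<Rightarrow> real) \<Rightarrow> point set" where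
  "right_ribbon \<alpha> = ribbon {-4..-2} (\<lambda>z. of_real (6 - core z)) (\<lambda>z. cis (\<alpha> z) / 4)"

lemma image_ribbon:
  assumes "\<And>s z. \<bar>s\<bar> \<le> 1 \<Longrightarrow> z \<in> I \<Longrightarrow>
    h (Re (c z + of_real s * v z), Im (c z + of_real s * v z), z) =
      (Re (c' z + of_real s * v' z), Im (c' z + of_real s * v' z), z)"
  shows "h ` ribbon I c v = ribbon I c' v'"
proof (intro subset_antisym subsetI)
  fix p assume "p \<in> h ` ribbon I c v"
  then show "p \<in> ribbon I c' v'" unfolding ribbon_def using assms by blast
next
  fix p assume "p \<in> ribbon I c' v'"
  then obtain s z where sz: "\<bar>s\<bar> \<le> 1" "z \<in> I"
    "p = (Re (c' z + of_real s * v' z), Im (c' z + of_real s * v' z), z)"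
    unfolding ribbon_def by blast
  have "(Re (c z + of_real s * v z), Im (c z + of_real s * v z), z) \<in> ribbon I c v"
    using sz unfolding ribbon_def by blast
  then show "p \<in> h ` ribbon I c v" using assms[OF sz(1,2)] sz(3) by (metis imageI)
qed

lemma core_bounds: "1 \<le> core z" "core z \<le> 2"
  by (auto simp: core_def)

lemma core_middle: "- 13 / 4 \<le> z \<Longrightarrow> z \<le> - 11 / 4 \<Longrightarrow> core z = 1"
proof -
  assume "- 13 / 4 \<le> z" "z \<le> - 11 / 4"
  then have "\<bar>z + 3\<bar> - 1 / 4 \<le> 0" by linarith
  then show ?thesis by (simp add: core_def)
qed

lemma torus_twist_left_ribbon:
  "torus_twist 1 ` left_ribbon \<alpha> = left_ribbon (\<lambda>z. \<alpha> z - ramp z)"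
  unfolding left_ribbon_def
proof (rule image_ribbon)
  fix s z :: real assume s: "\<bar>s\<bar> \<le> 1" and z: "z \<in> {-4..-2}"
  define w where "w = of_real s * (cis (\<alpha> z) / 4)"
  have w: "norm w \<le> 1 / 4" using s by (simp add: w_def norm_mult norm_divide)
  then have wb: "\<bar>Re w\<bar> \<le> 1 / 4" "\<bar>Im w\<bar> \<le> 1 / 4"
    using abs_Re_le_cmod[of w] abs_Im_le_cmod[of w] by linarith+
  have e: "cis (- ramp z) * w = of_real s * (cis (\<alpha> z - ramp z) / 4)"
    by (simp add: w_def cis_mult algebra_simps)
  have "torus_twist 1 (core z + Re w, Im w, z) =
      (core z + Re (cis (- ramp z) * w), Im (cis (- ramp z) * w), z)"
  proof -
    consider "- 11 / 4 \<le> z" | "- 13 / 4 \<le> z" "z \<le> - 11 / 4" | "z \<le> - 13 / 4" by linarith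
    then show ?thesis
    proof cases
      case 1
      then have "ramp z = 0" by (simp add: ramp_def)
      then show ?thesis using torus_twist_above[OF 1] by simp
    next
      case 2
      then show ?thesis using torus_twist_left[OF 2 w] by (simp add: core_middle)
    next
      \<comment> \<open>Below the ramp the twist fixes the ribbon pointwise, in accordance with an
        angle that differs by \<open>2 * pi\<close>.\<close>
      case 3
      then have "ramp z = 2 * pi" by (simp add: ramp_def)
      then have "cis (- ramp z) = 1" by (simp add: complex_eq_iff)
      moreover have "\<bar>core z + Re w - 3\<bar> \<le> 3" "3 / 4 \<le> \<bar>core z + Re w - 3\<bar>"
        using wb core_bounds[of z] by linarith+
      ultimately show ?thesis using torus_twist_core[OF 3, of "core z + Re w" "Im w"] wb z by simp
    qed
  qed
  then show "torus_twist 1 (Re (of_real (core z) + of_real s * (cis (\<alpha> z) / 4)),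
      Im (of_real (core z) + of_real s * (cis (\<alpha> z) / 4)), z) =
    (Re (of_real (core z) + of_real s * (cis (\<alpha> z - ramp z) / 4)),
      Im (of_real (core z) + of_real s * (cis (\<alpha> z - ramp z) / 4)), z)"
    unfolding e unfolding w_def by simp
qed

lemma torus_twist_right_ribbon:
  "torus_twist 1 ` right_ribbon \<alpha> = right_ribbon (\<lambda>z. \<alpha> z + ramp z)"
  unfolding right_ribbon_def
proof (rule image_ribbon)
  fix s z :: real assume s: "\<bar>s\<bar> \<le> 1" and z: "z \<in> {-4..-2}"
  define w where "w = of_real s * (cis (\<alpha> z) / 4)"
  have w: "norm w \<le> 1 / 4" using s by (simp add: w_def norm_mult norm_divide)
  then have wb: "\<bar>Re w\<bar> \<le> 1 / 4" "\<bar>Im w\<bar> \<le> 1 / 4"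
    using abs_Re_le_cmod[of w] abs_Im_le_cmod[of w] by linarith+
  have e: "cis (ramp z) * w = of_real s * (cis (\<alpha> z + ramp z) / 4)"
    by (simp add: w_def cis_mult algebra_simps)
  have "torus_twist 1 (6 - core z + Re w, Im w, z) =
      (6 - core z + Re (cis (ramp z) * w), Im (cis (ramp z) * w), z)"
  proof -
    consider "- 11 / 4 \<le> z" | "- 13 / 4 \<le> z" "z \<le> - 11 / 4" | "z \<le> - 13 / 4" by linarith
    then show ?thesis
    proof cases
      case 1
      then have "ramp z = 0" by (simp add: ramp_def)
      then show ?thesis using torus_twist_above[OF 1] by simp
    next
      case 2
      then show ?thesis using torus_twist_right[OF 2 w] by (simp add: core_middle)
    next
      case 3
      then have "ramp z = 2 * pi" by (simp add: ramp_def)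
      then have "cis (ramp z) = 1" by (simp add: complex_eq_iff)
      moreover have "\<bar>6 - core z + Re w - 3\<bar> \<le> 3" "3 / 4 \<le> \<bar>6 - core z + Re w - 3\<bar>"
        using wb core_bounds[of z] by linarith+
      ultimately show ?thesis using torus_twist_core[OF 3, of "6 - core z + Re w" "Im w"] wb z by simp
    qed
  qed
  then show "torus_twist 1 (Re (of_real (6 - core z) + of_real s * (cis (\<alpha> z) / 4)),
      Im (of_real (6 - core z) + of_real s * (cis (\<alpha> z) / 4)), z) =
    (Re (of_real (6 - core z) + of_real s * (cis (\<alpha> z + ramp z) / 4)),
      Im (of_real (6 - core z) + of_real s * (cis (\<alpha> z + ramp z) / 4)), z)"
    unfolding e unfolding w_def by simp
qed

lemma torus_twist_bottom: "p \<in> fence_disk 5 4 \<Longrightarrow> torus_twist 1 p = p"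
  by (auto simp: fence_disk_def intro!: torus_twist_core)

section \<open>Straightening a zigzag of bands\<close>

text \<open>The union of disk 3 with the bands at the positions 3 and 2 is a ribbon up to the fact that the disk
  lies in a single level. The disk is narrowed by \<open>squeeze_map\<close> and cut back by \<open>push_map\<close> to the part
  above the graph of \<open>notch\<close>, which meets every ray from \<open>(5/2, 0)\<close> in a segment; \<open>shear_map\<close> then
  tilts it so that each level near \<open>-3\<close> contains exactly one of these segments.\<close>

definition clip :: "real \<Rightarrow> real" where
  "clip t = max 0 (min 1 t)"

lemma clip_bounds: "0 \<le> clip t" "clip t \<le> 1"
  by (auto simp: clip_def)

lemma clip_eq: "1 \<le> t \<Longrightarrow> clip t = 1" "t \<le> 0 \<Longrightarrow> clip t = 0"
  by (auto simp: clip_def)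

lemma continuous_on_clip [continuous_intros]:
  "continuous_on S f \<Longrightarrow> continuous_on S (\<lambda>x. clip (f x))"
  unfolding clip_def by (intro continuous_intros)

text \<open>Source of injectivity for maps that move one coordinate by an increasing function, with
  a weight depending on the other coordinates.\<close>

lemma blend_less:
  fixes l :: real
  assumes "x < y" "fx < fy" "0 \<le> l" "l \<le> 1"
  shows "x + l * (fx - x) < y + l * (fy - y)"
proof -
  have "0 < (1 - l) * (y - x) + l * (fy - fx)"
  proof (cases "l = 0")
    case False
    then show ?thesis using assms by (intro add_nonneg_pos) auto
  qed (use assms in auto)
  then show ?thesis by (simp add: algebra_simps)
qed

text \<open>The support is thin enough to separate the bands: within 1/20 of the level -3, the two
  short bands have \<open>y \<ge> - 3/20\<close> and the band \<open>(2,4)\<close> has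
  \<open>y \<le> - 1/5\<close>. The factor \<open>clip (4 + 20 * y)\<close> below is 1 on the first
  range and 0 on the second.\<close>

definition tent :: "real \<Rightarrow> real" where
  "tent z = max 0 (1 - 20 * \<bar>z + 3\<bar>)"

lemma tent_bounds: "0 \<le> tent z" "tent z \<le> 1"
  by (auto simp: tent_def)

lemma tent_eq: "1 / 20 \<le> \<bar>z + 3\<bar> \<Longrightarrow> tent z = 0" "tent (- 3) = 1"
  by (auto simp: tent_def)

text \<open>Piecewise linear interpolation: the identity on \<open>[7/4, 13/4]\<close>, which
  contains the attaching intervals of the bands at positions 2 and 3, while \<open>[0, 6]\<close>
  shrinks to \<open>[3/2, 7/2]\<close>; from -1 downwards and from 7 upwards it is the identity
  again.\<close>

definition squeeze :: "real \<Rightarrow> real" where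
  "squeeze x = (let l = max x (min (3 / 2 + x / 7) (3 / 2 + 5 / 2 * x))
     in min l (max (65 / 22 + l / 11) (7 / 2 * l - 35 / 2)))"

lemma squeeze_less: "x < y \<Longrightarrow> squeeze x < squeeze y"
proof -
  have l: "x < y \<Longrightarrow> max x (min (3 / 2 + x / 7) (3 / 2 + 5 / 2 * x)) <
      max y (min (3 / 2 + y / 7) (3 / 2 + 5 / 2 * y))" for x y :: real
    by linarith
  have r: "x < y \<Longrightarrow> min x (max (65 / 22 + x / 11) (7 / 2 * x - 35 / 2)) <
      min y (max (65 / 22 + y / 11) (7 / 2 * y - 35 / 2))" for x y :: real
    by linarith
  assume "x < y"
  then show ?thesis unfolding squeeze_def Let_def by (intro r l)
qed

lemma squeeze_fixed: "7 / 4 \<le> x \<Longrightarrow> x \<le> 13 / 4 \<Longrightarrow> squeeze x = x" "7 \<le> \<bar>x\<bar> \<Longrightarrow> squeeze x = x"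
proof -
  assume "7 / 4 \<le> x" "x \<le> 13 / 4"
  then have "max x (min (3 / 2 + x / 7) (3 / 2 + 5 / 2 * x)) = x"
    "min x (max (65 / 22 + x / 11) (7 / 2 * x - 35 / 2)) = x" by linarith+
  then show "squeeze x = x" unfolding squeeze_def Let_def by simp
next
  assume "7 \<le> \<bar>x\<bar>"
  then have "max x (min (3 / 2 + x / 7) (3 / 2 + 5 / 2 * x)) = x"
    "min x (max (65 / 22 + x / 11) (7 / 2 * x - 35 / 2)) = x" by linarith+
  then show "squeeze x = x" unfolding squeeze_def Let_def by simp
qed

lemma squeeze_ends: "squeeze 0 = 3 / 2" "squeeze 6 = 7 / 2"
  by (auto simp: squeeze_def Let_def max_def min_def)

lemma continuous_on_squeeze [continuous_intros]:
  "continuous_on S f \<Longrightarrow> continuous_on S (\<lambda>x. squeeze (f x))"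
  unfolding squeeze_def Let_def by (intro continuous_intros) auto

definition squeeze_map :: "point \<Rightarrow> point" where
  "squeeze_map = (\<lambda>(x, y, z).
     (x + tent z * clip (4 + 20 * y) * clip (2 - y) * (squeeze x - x), y, z))"

lemma compactly_supported_squeeze_map: "compactly_supported squeeze_map"
proof (rule compactly_supportedI[of _ 7])
  show "continuous_on UNIV squeeze_map"
    unfolding squeeze_map_def case_prod_unfold tent_def by (intro continuous_intros)
  show "inj squeeze_map"
  proof (rule injI)
    fix p q assume e: "squeeze_map p = squeeze_map q"
    obtain x y z x' y' z' where p: "p = (x, y, z)" "q = (x', y', z')" by (cases p, cases q)
    define l where "l = tent z * clip (4 + 20 * y) * clip (2 - y)"
    have l: "0 \<le> l" "l \<le> 1"
      unfolding l_def using tent_bounds[of z] clip_bounds by (auto intro!: mult_le_one)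
    have yz: "y' = y" "z' = z" and x: "x + l * (squeeze x - x) = x' + l * (squeeze x' - x')"
      using e by (auto simp: squeeze_map_def p l_def)
    then have "x = x'"
      using blend_less[OF _ squeeze_less l, of x x'] blend_less[OF _ squeeze_less l, of x' x]
      by (metis less_irrefl linorder_neqE_linordered_idom)
    then show "p = q" by (simp add: p yz)
  qed
  fix x y z :: real assume "7 < \<bar>x\<bar> \<or> 7 < \<bar>y\<bar> \<or> 7 < \<bar>z\<bar>"
  then consider "7 \<le> \<bar>x\<bar>" | "y < - 7" | "7 < y" | "1 / 20 \<le> \<bar>z + 3\<bar>" by linarith
  then show "squeeze_map (x, y, z) = (x, y, z)"
    by cases (simp_all add: squeeze_map_def squeeze_fixed clip_eq tent_eq)
qed

text \<open>It vanishes for \<open>\<bar>x - 5/2\<bar>\<close> between 1/4 and 3/4, where the bands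
  are attached. The middle tooth cuts out the points at l1-distance below 1/4 from
  \<open>(5/2, 0)\<close>; the outer slopes let the rays along the front edge end with the attaching
  intervals. The term with 2 just brings the graph back to 0.\<close>

definition notch :: "real \<Rightarrow> real" where
  "notch x = max 0 (max (1 / 4 - \<bar>x - 5 / 2\<bar>) (min (\<bar>x - 5 / 2\<bar> - 3 / 4) (2 - \<bar>x - 5 / 2\<bar>)))"

lemma notch_bounds: "0 \<le> notch x" "notch x \<le> 5 / 8"
  by (auto simp: notch_def max_def min_def abs_if)

lemma continuous_on_notch [continuous_intros]:
  "continuous_on S f \<Longrightarrow> continuous_on S (\<lambda>x. notch (f x))"
  unfolding notch_def by (intro continuous_intros)

text \<open>For \<open>0 \<le> h < 1\<close> it is increasing, maps \<open>[0, 1]\<close> affinely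
  onto \<open>[h, 1]\<close> and is the identity outside \<open>[-1/5, 1]\<close>, hence on the band
  \<open>(2,4)\<close> near disk 3.\<close>

definition push :: "real \<Rightarrow> real \<Rightarrow> real" where
  "push h y = max y (min (h + (1 + 5 * h) * y) (h + (1 - h) * y))"

lemma push_less:
  assumes "0 \<le> h" "h < 1" "y < y'"
  shows "push h y < push h y'"
proof -
  have "h + (1 + 5 * h) * y < h + (1 + 5 * h) * y'" "h + (1 - h) * y < h + (1 - h) * y'"
    using assms by (auto intro!: mult_strict_left_mono)
  then show ?thesis using assms(3) unfolding push_def by linarith
qed

lemma push_fixed:
  assumes "0 \<le> h" "y \<le> - 1 / 5 \<or> 1 \<le> y"
  shows "push h y = y"
proof -
  have "h + (1 + 5 * h) * y = y + h * (1 + 5 * y)" "h + (1 - h) * y = y + h * (1 - y)"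
    by (simp_all add: algebra_simps)
  moreover have "h * (1 + 5 * y) \<le> 0 \<or> h * (1 - y) \<le> 0"
    using assms by (auto simp: mult_le_0_iff)
  ultimately show ?thesis by (auto simp: push_def)
qed

lemma push_unit:
  assumes "0 \<le> h" "0 \<le> y" "y \<le> 1"
  shows "push h y = h + (1 - h) * y"
proof -
  have "0 \<le> h * y" "0 \<le> h * (1 - y)" using assms by auto
  then have "h + (1 - h) * y \<le> h + (1 + 5 * h) * y" "y \<le> h + (1 - h) * y"
    by (simp_all add: algebra_simps)
  then show ?thesis unfolding push_def by (simp add: min_absorb2 max_absorb2)
qed

definition push_map :: "point \<Rightarrow> point" where
  "push_map = (\<lambda>(x, y, z). (x, y + tent z * (push (notch x) y - y), z))"

lemma compactly_supported_push_map: "compactly_supported push_map"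
proof (rule compactly_supportedI[of _ 7])
  show "continuous_on UNIV push_map"
    unfolding push_map_def case_prod_unfold tent_def push_def by (intro continuous_intros)
  show "inj push_map"
  proof (rule injI)
    fix p q assume e: "push_map p = push_map q"
    obtain x y z x' y' z' where p: "p = (x, y, z)" "q = (x', y', z')" by (cases p, cases q)
    have xz: "x' = x" "z' = z"
      and y: "y + tent z * (push (notch x) y - y) = y' + tent z * (push (notch x) y' - y')"
      using e by (auto simp: push_map_def p)
    have "notch x < 1" using notch_bounds[of x] by linarith
    note pl = push_less[OF notch_bounds(1) this]
    have "y = y'"
      using blend_less[OF _ pl tent_bounds[of z], of y y'] blend_less[OF _ pl tent_bounds[of z], of y' y] y
      by (metis less_irrefl linorder_neqE_linordered_idom)
    then show "p = q" by (simp add: p xz)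
  qed
  fix x y z :: real assume "7 < \<bar>x\<bar> \<or> 7 < \<bar>y\<bar> \<or> 7 < \<bar>z\<bar>"
  then consider "7 < \<bar>x\<bar>" | "y \<le> - 1 / 5 \<or> 1 \<le> y" | "1 / 20 \<le> \<bar>z + 3\<bar>" by linarith
  then show "push_map (x, y, z) = (x, y, z)"
  proof cases
    case 1
    then have "4 < \<bar>x - 5 / 2\<bar>" by linarith
    then have "notch x = 0" unfolding notch_def by linarith
    then show ?thesis by (simp add: push_map_def push_def)
  qed (simp_all add: push_map_def push_fixed notch_bounds tent_eq)
qed

text \<open>For \<open>y \<ge> 0\<close> and beyond the middle tooth this is the parameter of the
  ray from \<open>(5/2, 0)\<close> through the point, so it is constant on rays. Under the disk it
  is constantly 1 or -1 along the two bands. The bound 1/4 keeps the denominator positive.\<close>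

definition slope :: "real \<Rightarrow> real \<Rightarrow> real" where
  "slope x y = (5 / 2 - x) / max (1 / 4) (\<bar>x - 5 / 2\<bar> + max y 0)"

lemma slope_bound: "\<bar>slope x y\<bar> \<le> 1"
proof -
  have "\<bar>5 / 2 - x\<bar> \<le> max (1 / 4) (\<bar>x - 5 / 2\<bar> + max y 0)" by linarith
  moreover have "0 < max (1 / 4) (\<bar>x - 5 / 2\<bar> + max y 0)" by (simp add: less_max_iff_disj)
  ultimately show ?thesis by (simp add: slope_def abs_divide divide_le_eq_1 abs_of_pos)
qed

lemma slope_side: "y \<le> 0 \<Longrightarrow> 1 / 4 \<le> x - 5 / 2 \<Longrightarrow> slope x y = - 1"
  "y \<le> 0 \<Longrightarrow> 1 / 4 \<le> 5 / 2 - x \<Longrightarrow> slope x y = 1"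
  by (simp_all add: slope_def max_def field_simps)

definition shear_map :: "point \<Rightarrow> point" where
  "shear_map = (\<lambda>(x, y, z). (x, y, z - slope x y * clip (4 + 20 * y) * clip (2 - y) *
     clip (2 - \<bar>x - 5 / 2\<bar>) / 40 * tent z))"

lemma compactly_supported_shear_map: "compactly_supported shear_map"
proof (rule compactly_supportedI[of _ 7])
  show "continuous_on UNIV shear_map"
    unfolding shear_map_def case_prod_unfold tent_def slope_def
    by (intro continuous_intros) (auto simp: max_def)
  show "inj shear_map"
  proof (rule injI)
    fix p q assume e: "shear_map p = shear_map q"
    obtain x y z x' y' z' where p: "p = (x, y, z)" "q = (x', y', z')" by (cases p, cases q)
    \<comment> \<open>The factor 1/40 against the Lipschitz constant 20 of \<open>tent\<close> makes
      the vertical displacement a contraction by 1/2 in \<open>z\<close>, hence injectivity.\<close>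
    define l where "l = slope x y * clip (4 + 20 * y) * clip (2 - y) * clip (2 - \<bar>x - 5 / 2\<bar>) / 40"
    have "\<bar>l\<bar> \<le> 1 / 40"
      unfolding l_def using slope_bound[of x y] clip_bounds
      by (simp add: abs_mult) (intro mult_le_one mult_nonneg_nonneg; simp)
    have xy: "x' = x" "y' = y" and z: "z - l * tent z = z' - l * tent z'"
      using e by (auto simp: shear_map_def p l_def)
    have "\<bar>max 0 r - max 0 r'\<bar> \<le> \<bar>r - r'\<bar>" for r r' :: real by linarith
    from this[of "1 - 20 * \<bar>z + 3\<bar>" "1 - 20 * \<bar>z' + 3\<bar>"]
    have "\<bar>tent z - tent z'\<bar> \<le> \<bar>20 * (\<bar>z + 3\<bar> - \<bar>z' + 3\<bar>)\<bar>"
      unfolding tent_def by (simp add: algebra_simps abs_minus_commute)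
    also have "\<dots> = 20 * \<bar>\<bar>z + 3\<bar> - \<bar>z' + 3\<bar>\<bar>" by (simp only: abs_mult abs_numeral)
    also have "\<dots> \<le> 20 * \<bar>z - z'\<bar>" using abs_triangle_ineq3[of "z + 3" "z' + 3"] by simp
    finally have "\<bar>tent z - tent z'\<bar> \<le> 20 * \<bar>z - z'\<bar>" .
    then have "\<bar>l\<bar> * \<bar>tent z - tent z'\<bar> \<le> 1 / 40 * (20 * \<bar>z - z'\<bar>)"
      using \<open>\<bar>l\<bar> \<le> 1 / 40\<close> by (intro mult_mono) auto
    moreover have "z - z' = l * (tent z - tent z')" using z by (simp add: algebra_simps)
    then have "\<bar>z - z'\<bar> = \<bar>l\<bar> * \<bar>tent z - tent z'\<bar>" by (simp add: abs_mult)
    ultimately have "\<bar>z - z'\<bar> \<le> 1 / 2 * \<bar>z - z'\<bar>" by simp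
    then have "z = z'" by simp
    then show "p = q" by (simp add: p xy)
  qed
  fix x y z :: real assume "7 < \<bar>x\<bar> \<or> 7 < \<bar>y\<bar> \<or> 7 < \<bar>z\<bar>"
  then consider "2 - \<bar>x - 5 / 2\<bar> \<le> 0" | "4 + 20 * y \<le> 0" | "2 - y \<le> 0" | "1 / 20 \<le> \<bar>z + 3\<bar>" by linarith
  then show "shear_map (x, y, z) = (x, y, z)"
    by cases (simp_all add: shear_map_def clip_eq tent_eq)
qed

definition straighten :: "point \<Rightarrow> point" where
  "straighten = shear_map \<circ> (push_map \<circ> squeeze_map)"

lemma compactly_supported_straighten: "compactly_supported straighten"
  unfolding straighten_def
  by (intro compactly_supported_comp compactly_supported_squeeze_map compactly_supported_push_map
      compactly_supported_shear_map)

lemma straighten_fixed: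
  assumes "1 / 20 \<le> \<bar>z + 3\<bar> \<or> y \<le> - 1 / 5"
  shows "straighten (x, y, z) = (x, y, z)"
  using assms
proof
  assume "1 / 20 \<le> \<bar>z + 3\<bar>"
  then show ?thesis by (simp add: straighten_def squeeze_map_def push_map_def shear_map_def tent_eq)
next
  assume y: "y \<le> - 1 / 5"
  then have "clip (4 + 20 * y) = 0" by (intro clip_eq) simp
  then show ?thesis using y
    by (simp add: straighten_def squeeze_map_def push_map_def shear_map_def push_fixed notch_bounds)
qed

section \<open>Disk 3 and its two bands as a single ribbon\<close>

definition band_center :: "real \<Rightarrow> complex" where
  "band_center t = Complex 0 (- (2 * t * (1 - t)))"

definition band_dir :: "real \<Rightarrow> complex" where
  "band_dir t = Complex ((1 - 2 * t) / 4) (t * (1 - t))"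

lemma band_ends: "band_center 0 = 0" "band_center 1 = 0" "band_dir 0 = 1 / 4" "band_dir 1 = - 1 / 4"
  by (simp_all add: band_center_def band_dir_def complex_eq_iff)

lemma fence_band_ribbon:
  assumes "i < j"
  shows "fence_band P i j = ribbon {- real j..- real i}
    (\<lambda>z. of_real P + band_center ((- real i - z) / (real j - real i)))
    (\<lambda>z. band_dir ((- real i - z) / (real j - real i)))"
proof (intro subset_antisym subsetI)
  have d: "0 < real j - real i" using assms by simp
  {
    fix p assume "p \<in> fence_band P i j"
    then obtain s t where st: "- 1 \<le> s" "s \<le> 1" "0 \<le> t" "t \<le> 1"
      and p: "p = (P + s * (1 - 2 * t) / 4, - ((2 - s) * t * (1 - t)),
        - (real i + t * (real j - real i)))"
      unfolding fence_band_def by blast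
    define z where "z = - (real i + t * (real j - real i))"
    have t: "(- real i - z) / (real j - real i) = t" using d by (simp add: z_def)
    have "t * (real j - real i) \<le> 1 * (real j - real i)" using st d by (intro mult_right_mono) auto
    moreover have "0 \<le> t * (real j - real i)" using st d by simp
    ultimately have "z \<in> {- real j..- real i}" by (auto simp: z_def)
    then show "p \<in> ribbon {- real j..- real i}
      (\<lambda>z. of_real P + band_center ((- real i - z) / (real j - real i)))
      (\<lambda>z. band_dir ((- real i - z) / (real j - real i)))"
      using st unfolding ribbon_def p z_def[symmetric]
      by (intro CollectI exI[of _ s] exI[of _ z])
        (simp add: t abs_le_iff band_center_def band_dir_def algebra_simps)
  next
    fix p assume "p \<in> ribbon {- real j..- real i}
      (\<lambda>z. of_real P + band_center ((- real i - z) / (real j - real i)))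
      (\<lambda>z. band_dir ((- real i - z) / (real j - real i)))"
    then obtain s z where sz: "\<bar>s\<bar> \<le> 1" "z \<in> {- real j..- real i}"
      and p: "p = (Re (of_real P + band_center ((- real i - z) / (real j - real i)) +
          of_real s * band_dir ((- real i - z) / (real j - real i))),
        Im (of_real P + band_center ((- real i - z) / (real j - real i)) +
          of_real s * band_dir ((- real i - z) / (real j - real i))), z)"
      unfolding ribbon_def by blast
    define t where "t = (- real i - z) / (real j - real i)"
    have "z = - (real i + t * (real j - real i))" "0 \<le> t" "t \<le> 1"
      using d sz by (simp_all add: t_def field_simps)
    then show "p \<in> fence_band P i j"
      using sz unfolding fence_band_def p t_def[symmetric]
      by (intro CollectI exI[of _ s] exI[of _ t])
        (simp add: abs_le_iff band_center_def band_dir_def algebra_simps)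
  }
qed

text \<open>The ray in direction \<open>(-w, 1 - \<bar>w\<bar>)\<close> leaves the disk narrowed by \<open>squeeze_map\<close> and cut back by
  \<open>push_map\<close> at the parameter \<open>1 / ray_gauge w\<close>; it enters it at the parameter \<open>1/4\<close>.\<close>

definition ray_gauge :: "real \<Rightarrow> real" where
  "ray_gauge w = max \<bar>w\<bar> (max (1 - \<bar>w\<bar>) ((2 * \<bar>w\<bar> - 1) * (4 / 3)))"

lemma ray_gauge_bounds: "1 / 2 \<le> ray_gauge w" "\<bar>w\<bar> \<le> 1 \<Longrightarrow> ray_gauge w \<le> 4 / 3"
proof -
  show "1 / 2 \<le> ray_gauge w" unfolding ray_gauge_def le_max_iff_disj by linarith
  show "\<bar>w\<bar> \<le> 1 \<Longrightarrow> ray_gauge w \<le> 4 / 3" unfolding ray_gauge_def by (intro max.boundedI) simp_all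
qed

text \<open>Inverse of the height that \<open>straighten\<close> gives to the upper band,
  \<open>- (2 + t) + tent (- (2 + t)) / 40\<close>, clamped below; \<open>lower_par\<close> and
  \<open>turn_par\<close> play this part for the other band and the disk. At each level at most one
  of the three is away from its end values, so the sums in \<open>zigzag_center\<close> and
  \<open>zigzag_dir\<close> act as case distinctions and are visibly continuous.\<close>

definition upper_par :: "real \<Rightarrow> real" where
  "upper_par z = - 2 - max (- 3) (min z (2 * z + 59 / 20))"

definition lower_par :: "real \<Rightarrow> real" where
  "lower_par z = - 3 - min (- 3) (max z (2 * z + 61 / 20))"

definition turn_par :: "real \<Rightarrow> real" where
  "turn_par z = max (- 1) (min 1 (- 40 * (z + 3)))"

definition ray :: "real \<Rightarrow> complex" where
  "ray w = Complex (- w) (1 - \<bar>w\<bar>)"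

definition zigzag_center :: "real \<Rightarrow> complex" where
  "zigzag_center z = 5 / 2 + band_center (upper_par z) + band_center (lower_par z) +
     of_real ((1 / 4 + 1 / ray_gauge (turn_par z)) / 2) * ray (turn_par z)"

definition zigzag_dir :: "real \<Rightarrow> complex" where
  "zigzag_dir z = (band_dir (upper_par z) + 1 / 4) + (band_dir (lower_par z) - 1 / 4) -
     of_real ((1 / ray_gauge (turn_par z) - 1 / 4) / 2) * ray (turn_par z)"

lemma zigzag_upper:
  assumes "- 119 / 40 \<le> z"
  shows "zigzag_center z = 3 + band_center (upper_par z)" "zigzag_dir z = band_dir (upper_par z)"
proof -
  have "turn_par z = - 1" "lower_par z = 0"
    using assms by (auto simp: turn_par_def lower_par_def max_def min_def)
  then show "zigzag_center z = 3 + band_center (upper_par z)" "zigzag_dir z = band_dir (upper_par z)"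
    by (simp_all add: zigzag_center_def zigzag_dir_def band_ends ray_gauge_def ray_def complex_eq_iff)
qed

lemma zigzag_lower:
  assumes "z \<le> - 121 / 40"
  shows "zigzag_center z = 2 + band_center (lower_par z)" "zigzag_dir z = band_dir (lower_par z)"
proof -
  have "turn_par z = 1" "upper_par z = 1"
    using assms by (auto simp: turn_par_def upper_par_def max_def min_def)
  then show "zigzag_center z = 2 + band_center (lower_par z)" "zigzag_dir z = band_dir (lower_par z)"
    by (simp_all add: zigzag_center_def zigzag_dir_def band_ends ray_gauge_def ray_def complex_eq_iff)
qed

lemma zigzag_middle:
  assumes "- 121 / 40 \<le> z" "z \<le> - 119 / 40"
  defines "w \<equiv> - 40 * (z + 3)"
  shows "zigzag_center z = 5 / 2 + of_real ((1 / 4 + 1 / ray_gauge w) / 2) * ray w"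
    "zigzag_dir z = - of_real ((1 / ray_gauge w - 1 / 4) / 2) * ray w"
proof -
  have "turn_par z = w" "upper_par z = 1" "lower_par z = 0"
    using assms(1,2) by (auto simp: w_def turn_par_def upper_par_def lower_par_def max_def min_def)
  then show "zigzag_center z = 5 / 2 + of_real ((1 / 4 + 1 / ray_gauge w) / 2) * ray w"
    "zigzag_dir z = - of_real ((1 / ray_gauge w - 1 / 4) / 2) * ray w"
    by (simp_all add: zigzag_center_def zigzag_dir_def band_ends)
qed

text \<open>In front of the two attaching intervals, squeezing and pushing act trivially and
  \<open>slope\<close> is constant, so the bands are merely shifted vertically and remain ribbons.
  The assumption \<open>near\<close> makes the clipping factors 1.\<close>

lemma straighten_column:
  assumes x: "3 / 4 \<ge> \<bar>x - 5 / 2\<bar>" "1 / 4 \<le> \<bar>x - 5 / 2\<bar>" and y: "y \<le> 0"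
    and near: "\<bar>z + 3\<bar> < 1 / 20 \<Longrightarrow> - 3 / 20 \<le> y"
  shows "straighten (x, y, z) = (x, y, z + sgn (x - 5 / 2) * tent z / 40)"
proof -
  have "squeeze x = x" using x(1) by (intro squeeze_fixed) linarith+
  moreover have "notch x = 0" using x unfolding notch_def by linarith
  then have "push (notch x) y = y" by (simp add: push_def)
  moreover have "slope x y = - sgn (x - 5 / 2)"
  proof (cases "5 / 2 < x")
    case True
    then have "1 / 4 \<le> x - 5 / 2" using x(2) by linarith
    from slope_side(1)[OF y this] True show ?thesis by simp
  next
    case False
    then have "1 / 4 \<le> 5 / 2 - x" using x(2) by linarith
    from slope_side(2)[OF y this] this show ?thesis by (simp add: sgn_if)
  qed
  moreover have "clip (4 + 20 * y) * clip (2 - y) * clip (2 - \<bar>x - 5 / 2\<bar>) * tent z = tent z"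
  proof (cases "\<bar>z + 3\<bar> < 1 / 20")
    case True
    from near[OF True] show ?thesis using x(1) y by (simp add: clip_eq)
  next
    case False
    then show ?thesis by (simp add: tent_eq)
  qed
  ultimately show ?thesis
    by (simp add: straighten_def squeeze_map_def push_map_def shear_map_def mult.assoc)
qed

lemma straighten_upper_band: "straighten ` fence_band 3 2 3 = ribbon {- 119 / 40..- 2} zigzag_center zigzag_dir"
proof -
  have pt: "straighten (3 + s * (1 - 2 * t) / 4, - ((2 - s) * t * (1 - t)), - (2 + t)) =
      (Re (zigzag_center z + of_real s * zigzag_dir z), Im (zigzag_center z + of_real s * zigzag_dir z), z)"
    if s: "\<bar>s\<bar> \<le> 1" and t: "0 \<le> t" "t \<le> 1" and z: "z = - (2 + t) + tent (- (2 + t)) / 40"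
    for s t z
  proof -
    have tent: "tent (- (2 + t)) = max 0 (1 - 20 * (1 - t))" using t by (simp add: tent_def)
    have zb: "- 119 / 40 \<le> z" and u: "upper_par z = t"
      using t unfolding z tent upper_par_def by (auto simp: max_def min_def field_simps)
    have "\<bar>s * (1 - 2 * t)\<bar> \<le> 1 * 1" unfolding abs_mult using s t by (intro mult_mono) auto
    define q where "q = s * (1 - 2 * t) / 4"
    have x: "\<bar>q\<bar> \<le> 1 / 4" using \<open>\<bar>s * (1 - 2 * t)\<bar> \<le> 1 * 1\<close> by (simp add: q_def)
    then have q: "- 1 / 4 \<le> q" "q \<le> 1 / 4" by linarith+
    define y where "y = (2 - s) * t * (1 - t)"
    have "0 \<le> y" using s t by (simp add: y_def)
    moreover have "y \<le> 3 * 1 * (1 - t)"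
      unfolding y_def using s t by (intro mult_mono) auto
    ultimately have "straighten (3 + s * (1 - 2 * t) / 4, - ((2 - s) * t * (1 - t)), - (2 + t)) =
        (3 + s * (1 - 2 * t) / 4, - ((2 - s) * t * (1 - t)),
          - (2 + t) + sgn (3 + s * (1 - 2 * t) / 4 - 5 / 2) * tent (- (2 + t)) / 40)"
      unfolding y_def[symmetric] q_def[symmetric] using q by (intro straighten_column) (auto simp: abs_if split: if_splits)
    also have "sgn (3 + s * (1 - 2 * t) / 4 - 5 / 2) = 1"
      unfolding q_def[symmetric] using q by (simp add: sgn_if)
    also have "- (2 + t) + 1 * tent (- (2 + t)) / 40 = z" by (simp add: z)
    finally show ?thesis
      by (simp add: zigzag_upper[OF zb] u band_center_def band_dir_def algebra_simps)
  qed
  show ?thesis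
  proof (intro subset_antisym subsetI)
    fix p assume "p \<in> straighten ` fence_band 3 2 3"
    then obtain s t where st: "\<bar>s\<bar> \<le> 1" "0 \<le> t" "t \<le> 1"
      and p: "p = straighten (3 + s * (1 - 2 * t) / 4, - ((2 - s) * t * (1 - t)), - (2 + t))"
      unfolding fence_band_def by (auto simp: abs_le_iff)
    define z where "z = - (2 + t) + tent (- (2 + t)) / 40"
    have "tent (- (2 + t)) = max 0 (1 - 20 * (1 - t))" using st by (simp add: tent_def)
    then have "z \<in> {- 119 / 40..- 2}" using st unfolding z_def by (auto simp: max_def field_simps)
    then show "p \<in> ribbon {- 119 / 40..- 2} zigzag_center zigzag_dir"
      unfolding p pt[OF st z_def] ribbon_def using st by blast
  next
    fix p assume "p \<in> ribbon {- 119 / 40..- 2} zigzag_center zigzag_dir"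
    then obtain s z where sz: "\<bar>s\<bar> \<le> 1" "z \<in> {- 119 / 40..- 2}"
      and p: "p = (Re (zigzag_center z + of_real s * zigzag_dir z), Im (zigzag_center z + of_real s * zigzag_dir z), z)"
      unfolding ribbon_def by blast
    define t where "t = upper_par z"
    have t: "0 \<le> t" "t \<le> 1" using sz(2) unfolding t_def upper_par_def by auto
    then have "tent (- (2 + t)) = max 0 (1 - 20 * (1 - t))" by (simp add: tent_def)
    then have "z = - (2 + t) + tent (- (2 + t)) / 40"
      using sz(2) unfolding t_def upper_par_def by (auto simp: max_def min_def field_simps)
    from pt[OF sz(1) t this] have "p = straighten (3 + s * (1 - 2 * t) / 4, - ((2 - s) * t * (1 - t)), - (2 + t))"
      by (simp add: p)
    moreover have "(3 + s * (1 - 2 * t) / 4, - ((2 - s) * t * (1 - t)), - (2 + t)) \<in> fence_band 3 2 3"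
      unfolding fence_band_def using sz(1) t by (intro CollectI exI[of _ s] exI[of _ t]) auto
    ultimately show "p \<in> straighten ` fence_band 3 2 3" by blast
  qed
qed

lemma straighten_lower_band: "straighten ` fence_band 2 3 4 = ribbon {- 4..- 121 / 40} zigzag_center zigzag_dir"
proof -
  have pt: "straighten (2 + s * (1 - 2 * t) / 4, - ((2 - s) * t * (1 - t)), - (3 + t)) =
      (Re (zigzag_center z + of_real s * zigzag_dir z), Im (zigzag_center z + of_real s * zigzag_dir z), z)"
    if s: "\<bar>s\<bar> \<le> 1" and t: "0 \<le> t" "t \<le> 1" and z: "z = - (3 + t) - tent (- (3 + t)) / 40"
    for s t z
  proof -
    have tent: "tent (- (3 + t)) = max 0 (1 - 20 * t)" using t by (simp add: tent_def)
    have zb: "z \<le> - 121 / 40" and u: "lower_par z = t"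
      using t unfolding z tent lower_par_def by (auto simp: max_def min_def field_simps)
    have "\<bar>s * (1 - 2 * t)\<bar> \<le> 1 * 1" unfolding abs_mult using s t by (intro mult_mono) auto
    define q where "q = s * (1 - 2 * t) / 4"
    have x: "\<bar>q\<bar> \<le> 1 / 4" using \<open>\<bar>s * (1 - 2 * t)\<bar> \<le> 1 * 1\<close> by (simp add: q_def)
    then have q: "- 1 / 4 \<le> q" "q \<le> 1 / 4" by linarith+
    define y where "y = (2 - s) * t * (1 - t)"
    have "0 \<le> y" using s t by (simp add: y_def)
    moreover have "y \<le> 3 * t * 1"
      unfolding y_def using s t by (intro mult_mono) auto
    ultimately have "straighten (2 + s * (1 - 2 * t) / 4, - ((2 - s) * t * (1 - t)), - (3 + t)) =
        (2 + s * (1 - 2 * t) / 4, - ((2 - s) * t * (1 - t)),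
          - (3 + t) + sgn (2 + s * (1 - 2 * t) / 4 - 5 / 2) * tent (- (3 + t)) / 40)"
      unfolding y_def[symmetric] q_def[symmetric] using q by (intro straighten_column) (auto simp: abs_if split: if_splits)
    also have "sgn (2 + s * (1 - 2 * t) / 4 - 5 / 2) = - 1"
      unfolding q_def[symmetric] using q by (simp add: sgn_if)
    also have "- (3 + t) + - 1 * tent (- (3 + t)) / 40 = z" by (simp add: z)
    finally show ?thesis
      by (simp add: zigzag_lower[OF zb] u band_center_def band_dir_def algebra_simps)
  qed
  show ?thesis
  proof (intro subset_antisym subsetI)
    fix p assume "p \<in> straighten ` fence_band 2 3 4"
    then obtain s t where st: "\<bar>s\<bar> \<le> 1" "0 \<le> t" "t \<le> 1"
      and p: "p = straighten (2 + s * (1 - 2 * t) / 4, - ((2 - s) * t * (1 - t)), - (3 + t))"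
      unfolding fence_band_def by (auto simp: abs_le_iff)
    define z where "z = - (3 + t) - tent (- (3 + t)) / 40"
    have "tent (- (3 + t)) = max 0 (1 - 20 * t)" using st by (simp add: tent_def)
    then have "z \<in> {- 4..- 121 / 40}" using st unfolding z_def by (auto simp: max_def field_simps)
    then show "p \<in> ribbon {- 4..- 121 / 40} zigzag_center zigzag_dir"
      unfolding p pt[OF st z_def] ribbon_def using st by blast
  next
    fix p assume "p \<in> ribbon {- 4..- 121 / 40} zigzag_center zigzag_dir"
    then obtain s z where sz: "\<bar>s\<bar> \<le> 1" "z \<in> {- 4..- 121 / 40}"
      and p: "p = (Re (zigzag_center z + of_real s * zigzag_dir z), Im (zigzag_center z + of_real s * zigzag_dir z), z)"
      unfolding ribbon_def by blast
    define t where "t = lower_par z"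
    have t: "0 \<le> t" "t \<le> 1" using sz(2) unfolding t_def lower_par_def by auto
    then have "tent (- (3 + t)) = max 0 (1 - 20 * t)" by (simp add: tent_def)
    then have "z = - (3 + t) - tent (- (3 + t)) / 40"
      using sz(2) unfolding t_def lower_par_def by (auto simp: max_def min_def field_simps)
    from pt[OF sz(1) t this] have "p = straighten (2 + s * (1 - 2 * t) / 4, - ((2 - s) * t * (1 - t)), - (3 + t))"
      by (simp add: p)
    moreover have "(2 + s * (1 - 2 * t) / 4, - ((2 - s) * t * (1 - t)), - (3 + t)) \<in> fence_band 2 3 4"
      unfolding fence_band_def using sz(1) t by (intro CollectI exI[of _ s] exI[of _ t]) auto
    ultimately show "p \<in> straighten ` fence_band 2 3 4" by blast
  qed
qed

lemma straighten_disk: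
  "straighten ` fence_disk 5 3 =
    {(x, y, - 3 - slope x y / 40) | x y. \<bar>x - 5 / 2\<bar> \<le> 1 \<and> notch x \<le> y \<and> y \<le> 1}"
proof (intro subset_antisym subsetI)
  have pt: "straighten (x, y, - 3) = (x', y', - 3 - slope x' y' / 40)"
    if "x' = squeeze x" "y' = notch x' + (1 - notch x') * y" "0 \<le> y" "y \<le> 1"
      "\<bar>x' - 5 / 2\<bar> \<le> 1" "0 \<le> y'" "y' \<le> 1" for x x' y y'
    using that notch_bounds[of x']
    by (simp add: straighten_def squeeze_map_def push_map_def shear_map_def tent_eq clip_eq push_unit)
  {
    fix p assume "p \<in> straighten ` fence_disk 5 3"
    then obtain x y where xy: "0 \<le> x" "x \<le> 6" "0 \<le> y" "y \<le> 1" and p: "p = straighten (x, y, - 3)"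
      by (auto simp: fence_disk_def)
    define x' y' where "x' = squeeze x" and "y' = notch x' + (1 - notch x') * y"
    have "squeeze 0 \<le> x'" "x' \<le> squeeze 6"
      unfolding x'_def using squeeze_less[of 0 x] squeeze_less[of x 6] xy
      by (cases "x = 0"; cases "x = 6"; simp)+
    then have x': "\<bar>x' - 5 / 2\<bar> \<le> 1" by (simp add: squeeze_ends abs_le_iff)
    have "0 \<le> (1 - notch x') * y" "(1 - notch x') * y \<le> (1 - notch x') * 1"
      using notch_bounds[of x'] xy by (auto intro: mult_left_mono)
    then have "notch x' \<le> y'" "y' \<le> 1" by (simp_all add: y'_def)
    then show "p \<in> {(x, y, - 3 - slope x y / 40) | x y. \<bar>x - 5 / 2\<bar> \<le> 1 \<and> notch x \<le> y \<and> y \<le> 1}"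
      using pt[OF x'_def y'_def xy(3,4) x'] x' notch_bounds[of x'] unfolding p by auto
  next
    fix p assume "p \<in> {(x, y, - 3 - slope x y / 40) | x y. \<bar>x - 5 / 2\<bar> \<le> 1 \<and> notch x \<le> y \<and> y \<le> 1}"
    then obtain x' y' where x': "\<bar>x' - 5 / 2\<bar> \<le> 1" and y': "notch x' \<le> y'" "y' \<le> 1"
      and p: "p = (x', y', - 3 - slope x' y' / 40)" by blast
    have "\<exists>x. 0 \<le> x \<and> x \<le> 6 \<and> squeeze x = x'"
      by (rule IVT') (use x' in \<open>auto simp: squeeze_ends abs_le_iff intro!: continuous_intros\<close>)
    then obtain x where x: "0 \<le> x" "x \<le> 6" "x' = squeeze x" by auto
    define y where "y = (y' - notch x') / (1 - notch x')"
    have n: "0 < 1 - notch x'" using notch_bounds[of x'] by linarith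
    have y: "0 \<le> y" "y \<le> 1" "y' = notch x' + (1 - notch x') * y"
      using n y' by (simp_all add: y_def divide_le_eq)
    have "p = straighten (x, y, - 3)"
      using pt[OF x(3) y(3,1,2) x'] y' notch_bounds[of x'] p by simp
    moreover have "(x, y, - 3) \<in> fence_disk 5 3" using x y by (simp add: fence_disk_def)
    ultimately show "p \<in> straighten ` fence_disk 5 3" by blast
  }
qed

text \<open>As \<open>slope\<close> is constant on rays, each level contains one ray segment,
  parametrized by the l1-distance \<open>r\<close> from \<open>(5/2, 0)\<close>. The terms of
  \<open>ray_gauge\<close> express the outer constraints \<open>\<bar>x - 5/2\<bar> \<le> 1\<close>,
  \<open>y \<le> 1\<close> and \<open>\<bar>x - 5/2\<bar> - y \<le> 3/4\<close>.\<close>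

lemma straighten_disk_ribbon:
  "straighten ` fence_disk 5 3 = ribbon {- 121 / 40..- 119 / 40} zigzag_center zigzag_dir"
  unfolding straighten_disk
proof (intro subset_antisym subsetI)
  fix p assume "p \<in> {(x, y, - 3 - slope x y / 40) | x y. \<bar>x - 5 / 2\<bar> \<le> 1 \<and> notch x \<le> y \<and> y \<le> 1}"
  then obtain x y where x: "\<bar>x - 5 / 2\<bar> \<le> 1" and y: "notch x \<le> y" "y \<le> 1"
    and p: "p = (x, y, - 3 - slope x y / 40)" by blast
  define r w where "r = \<bar>x - 5 / 2\<bar> + y" and "w = slope x y"
  have y0: "0 \<le> y" and r: "1 / 4 \<le> r" and fin: "\<bar>x - 5 / 2\<bar> - 3 / 4 \<le> y"
    using x y unfolding notch_def r_def by linarith+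
  have w: "w = (5 / 2 - x) / r" using y0 r by (simp add: w_def slope_def r_def max_absorb2)
  have wr: "- w * r = x - 5 / 2" using r by (simp add: w)
  have "\<bar>w\<bar> * r = \<bar>x - 5 / 2\<bar>" using r by (simp add: w abs_divide abs_minus_commute)
  then have wr': "(1 - \<bar>w\<bar>) * r = y" "\<bar>w\<bar> * r = \<bar>x - 5 / 2\<bar>" by (simp_all add: algebra_simps r_def)
  have "\<bar>w\<bar> \<le> 1" unfolding w_def by (rule slope_bound)
  define z where "z = - 3 - w / 40"
  have z: "z \<in> {- 121 / 40..- 119 / 40}" "- 40 * (z + 3) = w"
    using \<open>\<bar>w\<bar> \<le> 1\<close> by (auto simp: z_def abs_le_iff field_simps)
  define g where "g = 1 / ray_gauge w"
  have "ray_gauge w * r \<le> 1"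
  proof -
    have "ray_gauge w * r = max (\<bar>w\<bar> * r) (max ((1 - \<bar>w\<bar>) * r) ((2 * \<bar>w\<bar> - 1) * (4 / 3) * r))"
      using r by (simp add: ray_gauge_def max_mult_distrib_right)
    moreover have "(2 * \<bar>w\<bar> - 1) * r = \<bar>w\<bar> * r - (1 - \<bar>w\<bar>) * r"
      by (simp add: algebra_simps)
    then have "(2 * \<bar>w\<bar> - 1) * (4 / 3) * r = (\<bar>w\<bar> * r - (1 - \<bar>w\<bar>) * r) * (4 / 3)"
      by (metis mult.assoc mult.commute)
    ultimately show ?thesis using x y fin unfolding wr' by simp
  qed
  then have rg: "r \<le> g" using ray_gauge_bounds(1)[of w] by (simp add: g_def field_simps)
  have g: "3 / 4 \<le> g" using ray_gauge_bounds[of w] \<open>\<bar>w\<bar> \<le> 1\<close> by (simp add: g_def field_simps)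
  \<comment> \<open>Affine change from \<open>[1/4, g]\<close> to \<open>[-1, 1]\<close>, decreasing
    because \<open>zigzag_dir\<close> points back towards \<open>(5/2, 0)\<close>.\<close>
  define s where "s = ((1 / 4 + g) / 2 - r) / ((g - 1 / 4) / 2)"
  have s: "\<bar>s\<bar> \<le> 1" "s * ((g - 1 / 4) / 2) = (1 / 4 + g) / 2 - r"
    using g r rg by (simp_all add: s_def abs_le_iff field_simps)
  have "zigzag_center z + of_real s * zigzag_dir z =
      5 / 2 + of_real ((1 / 4 + g) / 2 - s * ((g - 1 / 4) / 2)) * ray w"
    using zigzag_middle[of z] z unfolding z(2) by (simp add: g_def algebra_simps)
  also have "\<dots> = 5 / 2 + of_real r * ray w" unfolding s(2) by simp
  also have "\<dots> = Complex x y" using wr wr' by (simp add: ray_def complex_eq_iff algebra_simps)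
  finally have "p = (Re (zigzag_center z + of_real s * zigzag_dir z),
      Im (zigzag_center z + of_real s * zigzag_dir z), z)"
    unfolding p w_def[symmetric] z_def[symmetric] by simp
  then show "p \<in> ribbon {- 121 / 40..- 119 / 40} zigzag_center zigzag_dir"
    unfolding ribbon_def using s(1) z(1) by blast
next
  fix p assume "p \<in> ribbon {- 121 / 40..- 119 / 40} zigzag_center zigzag_dir"
  then obtain s z where s: "\<bar>s\<bar> \<le> 1" and z: "z \<in> {- 121 / 40..- 119 / 40}"
    and p: "p = (Re (zigzag_center z + of_real s * zigzag_dir z),
      Im (zigzag_center z + of_real s * zigzag_dir z), z)"
    unfolding ribbon_def by blast
  define w g where "w = - 40 * (z + 3)" and "g = 1 / ray_gauge w"
  define q where "q = s * ((g - 1 / 4) / 2)"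
  define r where "r = (1 / 4 + g) / 2 - q"
  have w: "\<bar>w\<bar> \<le> 1" "- 3 - w / 40 = z" using z by (auto simp: w_def abs_le_iff field_simps)
  have g: "3 / 4 \<le> g" using ray_gauge_bounds[of w] w by (simp add: g_def field_simps)
  have "\<bar>q\<bar> \<le> 1 * ((g - 1 / 4) / 2)"
    unfolding q_def abs_mult using s g by (intro mult_mono) auto
  then have r: "1 / 4 \<le> r" "r \<le> g" unfolding r_def by (simp_all add: abs_le_iff field_simps)
  have "zigzag_center z + of_real s * zigzag_dir z = 5 / 2 + of_real r * ray w"
    using zigzag_middle[of z] z unfolding w_def[symmetric] by (simp add: g_def r_def q_def algebra_simps)
  then have p: "p = (5 / 2 - w * r, (1 - \<bar>w\<bar>) * r, z)" by (simp add: p ray_def algebra_simps)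
  define x y where "x = 5 / 2 - w * r" and "y = (1 - \<bar>w\<bar>) * r"
  have ax: "\<bar>x - 5 / 2\<bar> = \<bar>w\<bar> * r" using r by (simp add: x_def abs_mult)
  have y0: "0 \<le> y" using w r by (simp add: y_def)
  have sum: "\<bar>x - 5 / 2\<bar> + y = r" unfolding ax by (simp add: y_def algebra_simps)
  have "slope x y = w" using r y0 unfolding slope_def
    by (simp add: max_absorb2 sum) (simp add: x_def)
  moreover have "ray_gauge w * r \<le> 1" using r ray_gauge_bounds(1)[of w] by (simp add: g_def field_simps)
  then have "max (\<bar>w\<bar> * r) (max ((1 - \<bar>w\<bar>) * r) ((2 * \<bar>w\<bar> - 1) * (4 / 3) * r)) \<le> 1"
    using r by (simp add: ray_gauge_def max_mult_distrib_right)
  then have "\<bar>x - 5 / 2\<bar> \<le> 1" "y \<le> 1" and fin: "(2 * \<bar>w\<bar> - 1) * (4 / 3) * r \<le> 1"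
    unfolding ax y_def by auto
  moreover have "notch x \<le> y"
  proof -
    have "(2 * \<bar>w\<bar> - 1) * r = \<bar>x - 5 / 2\<bar> - y"
      unfolding ax y_def by (simp add: algebra_simps)
    moreover have "(2 * \<bar>w\<bar> - 1) * (4 / 3) * r = (2 * \<bar>w\<bar> - 1) * r * (4 / 3)"
      by (simp only: ac_simps)
    ultimately have "(2 * \<bar>w\<bar> - 1) * (4 / 3) * r = (\<bar>x - 5 / 2\<bar> - y) * (4 / 3)"
      by (simp only:)
    with fin have "(\<bar>x - 5 / 2\<bar> - y) * (4 / 3) \<le> 1" by (simp only:)
    then have "\<bar>x - 5 / 2\<bar> - y \<le> 3 / 4" by (simp add: field_simps)
    then show ?thesis using sum r(1) y0 unfolding notch_def by linarith
  qed
  ultimately show "p \<in> {(x, y, - 3 - slope x y / 40) | x y. \<bar>x - 5 / 2\<bar> \<le> 1 \<and> notch x \<le> y \<and> y \<le> 1}"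
    unfolding p x_def[symmetric] y_def[symmetric] using w(2) by (intro CollectI exI[of _ x] exI[of _ y]) auto
qed

lemma ribbon_Un: "ribbon (I \<union> J) c v = ribbon I c v \<union> ribbon J c v"
  by (auto simp: ribbon_def)

lemma straighten_zigzag:
  "straighten ` (fence_band 3 2 3 \<union> fence_disk 5 3 \<union> fence_band 2 3 4) =
    ribbon {- 4..- 2} zigzag_center zigzag_dir"
proof -
  have "{- 4..- 2} = {- 119 / 40..- 2} \<union> {- 121 / 40..- 119 / 40} \<union> {- 4..- 121 / 40 :: real}" by auto
  then show ?thesis
    by (simp only: image_Un straighten_upper_band straighten_disk_ribbon straighten_lower_band ribbon_Un)
qed

section \<open>Deforming the ribbons to the model ribbons\<close>

definition height :: "real \<Rightarrow> real" where
  "height z = (- 2 - z) / 2"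

lemma ribbon_cong:
  "(\<And>z. z \<in> I \<Longrightarrow> c z = c' z \<and> v z = v' z) \<Longrightarrow> ribbon I c v = ribbon I c' v'"
  unfolding ribbon_def by (metis (no_types, lifting))

lemma norm_band_dir: "0 \<le> t \<Longrightarrow> t \<le> 1 \<Longrightarrow> norm (band_dir t) \<le> 1 / 4"
proof -
  assume t: "0 \<le> t" "t \<le> 1"
  define r where "r = t * (1 - t)"
  have r: "0 \<le> r" using t by (simp add: r_def)
  have "0 \<le> (t - 1 / 2)\<^sup>2" by simp
  then have "r \<le> 1 / 4" by (simp add: r_def power2_eq_square algebra_simps)
  then have "r * r \<le> 1 / 4 * r" using r by (intro mult_right_mono) auto
  moreover have "((1 - 2 * t) / 4)\<^sup>2 + r\<^sup>2 = (1 / 4)\<^sup>2 - 1 / 4 * r + r * r"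
    by (simp add: r_def power2_eq_square field_simps)
  ultimately have "((1 - 2 * t) / 4)\<^sup>2 + r\<^sup>2 \<le> (1 / 4)\<^sup>2" by linarith
  then show ?thesis unfolding band_dir_def cmod_def r_def by (intro real_le_lsqrt) auto
qed

text \<open>The direction of a fence band makes a half turn through the upper half plane, just as a
  uniform rotation does, so the two can be blended.\<close>

lemma band_dir_blend:
  assumes t: "0 \<le> t" "t \<le> 1" and l: "0 \<le> l" "l \<le> 1"
  shows "of_real (1 - l) * band_dir t + of_real l * (cis (pi * t) / 4) \<noteq> 0"
proof (cases "t = 0 \<or> t = 1")
  case True
  have "of_real (1 - l) * (1 / 4) + of_real l * (1 / 4) = (1 / 4 :: complex)"
    by (simp add: field_simps)
  moreover have "of_real (1 - l) * (- 1 / 4) + of_real l * (- 1 / 4) = (- 1 / 4 :: complex)"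
    by (simp add: field_simps)
  ultimately show ?thesis
    using True by (elim disjE) (simp_all only: band_ends mult_zero_right mult_1_right cis_zero cis_pi, simp_all)
next
  case False
  then have "0 < t * (1 - t)" "0 < sin (pi * t)" using t by (auto intro!: sin_gt_zero)
  then have "0 < (1 - l) * (t * (1 - t)) + l * (sin (pi * t) / 4)"
    using l by (cases "l = 0") (auto intro!: add_nonneg_pos)
  then have "0 < Im (of_real (1 - l) * band_dir t + of_real l * (cis (pi * t) / 4))"
    by (simp add: band_dir_def)
  then show ?thesis by (metis less_irrefl zero_complex.simps(2))
qed

lemma norm_blend:
  fixes a b :: complex
  assumes "norm a \<le> r" "norm b \<le> r" "0 \<le> l" "l \<le> 1"
  shows "norm (of_real (1 - l) * a + of_real l * b) \<le> r"
proof -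
  have "norm (of_real (1 - l) * a + of_real l * b) \<le> (1 - l) * norm a + l * norm b"
    using norm_triangle_ineq[of "of_real (1 - l) * a" "of_real l * b"] assms(3,4)
    by (simp only: norm_mult norm_of_real abs_of_nonneg diff_ge_0_iff_ge)
  also have "\<dots> \<le> (1 - l) * r + l * r" using assms by (intro add_mono mult_left_mono) auto
  finally show ?thesis by (simp add: algebra_simps)
qed

lemma continuous_on_core [continuous_intros]:
  "continuous_on S f \<Longrightarrow> continuous_on S (\<lambda>x. core (f x))"
  unfolding core_def by (intro continuous_intros) auto

lemma core_ends: "core (- 2) = 2" "core (- 4) = 2"
  by (simp_all add: core_def)

lemma continuous_on_ramp [continuous_intros]:
  "continuous_on S f \<Longrightarrow> continuous_on S (\<lambda>x. ramp (f x))"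
  unfolding ramp_def by (intro continuous_intros)

lemma continuous_on_band_center [continuous_intros]:
  "continuous_on S f \<Longrightarrow> continuous_on S (\<lambda>x. band_center (f x))"
  unfolding band_center_def Complex_eq by (intro continuous_intros)

lemma continuous_on_band_dir [continuous_intros]:
  "continuous_on S f \<Longrightarrow> continuous_on S (\<lambda>x. band_dir (f x))"
  unfolding band_dir_def Complex_eq by (intro continuous_intros) auto

lemma continuous_on_cis' [continuous_intros]:
  "continuous_on S f \<Longrightarrow> continuous_on S (\<lambda>x. cis (f x))"
  unfolding cis_conv_exp by (intro continuous_intros)

text \<open>The centers move straight and stay at \<open>x \<ge> 4\<close>, so with radius 2/5
  nothing left of 18/5 is touched, in particular not the straightened zigzag.\<close>

lemma long_band_isotopy:
  obtains G where "compactly_supported G"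
    "G ` fence_band 4 2 4 = right_ribbon (\<lambda>z. pi * height z)"
    "\<And>x y z. z \<le> - 4 \<or> - 2 \<le> z \<or> x \<le> 18 / 5 \<Longrightarrow> G (x, y, z) = (x, y, z)"
proof -
  define c where "c t z = of_real (1 - t) * (4 + band_center (height z)) + of_real (t * (6 - core z))"
    for t z :: real
  define v where "v t z = of_real (1 - t) * band_dir (height z) + of_real t * (cis (pi * height z) / 4)"
    for t z :: real
  have h: "0 \<le> height z" "height z \<le> 1" if "z \<in> {-4..-2}" for z
    using that by (auto simp: height_def)
  have he: "height (- 4) = 1" "height (- 2) = 0" by (simp_all add: height_def)
  obtain G where G: "compactly_supported G"
    "G ` ribbon {-4..-2} (c 0) (v 0) = ribbon {-4..-2} (c 1) (v 1)"
    "\<And>x y z. z \<notin> {-4<..<-2} \<or> (\<forall>t\<in>{0..1}. 2 / 5 \<le> norm (Complex x y - c t z)) \<Longrightarrow>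
      G (x, y, z) = (x, y, z)"
  proof (rule ribbon_isotopy[of "- 4" "- 2" "3 / 10" "2 / 5" c v])
    show "continuous_on ({0..1} \<times> {-4..-2}) (\<lambda>p. c (fst p) (snd p))"
      unfolding c_def height_def by (intro continuous_intros) auto
    show "continuous_on ({0..1} \<times> {-4..-2}) (\<lambda>p. v (fst p) (snd p))"
      unfolding v_def height_def by (intro continuous_intros) auto
    fix t z :: real assume t: "t \<in> {0..1}"
    show "v t z \<noteq> 0 \<and> norm (v t z) \<le> 3 / 10" if z: "z \<in> {-4..-2}"
    proof
      show "v t z \<noteq> 0" unfolding v_def using h[OF z] t by (intro band_dir_blend) auto
      have "norm (v t z) \<le> 1 / 4"
        unfolding v_def using norm_band_dir[OF h[OF z]] t by (intro norm_blend) (auto simp: norm_divide)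
      then show "norm (v t z) \<le> 3 / 10" by simp
    qed
    show "c t z = c 0 z \<and> v t z = v 0 z" if "z \<in> {-4, -2}"
      using that by (auto simp: c_def v_def he band_ends core_ends algebra_simps simp flip: cis_conv_exp)
  qed auto
  have "fence_band 4 2 4 = ribbon {-4..-2} (c 0) (v 0)"
    using fence_band_ribbon[of 2 4 4] unfolding c_def v_def height_def by simp
  moreover have "right_ribbon (\<lambda>z. pi * height z) = ribbon {-4..-2} (c 1) (v 1)"
    unfolding right_ribbon_def by (intro ribbon_cong) (simp add: c_def v_def)
  moreover have "G (x, y, z) = (x, y, z)" if "z \<le> - 4 \<or> - 2 \<le> z \<or> x \<le> 18 / 5" for x y z
  proof (rule G(3))
    have "2 / 5 \<le> norm (Complex x y - c t z)" if x: "x \<le> 18 / 5" and t: "t \<in> {0..1}" for t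
    proof -
      have "(1 - t) * 4 + t * 4 \<le> (1 - t) * 4 + t * (6 - core z)"
        using t core_bounds[of z] by (intro add_left_mono mult_left_mono) auto
      then have "4 \<le> Re (c t z)" by (simp add: c_def band_center_def)
      then have "2 / 5 \<le> \<bar>Re (Complex x y - c t z)\<bar>" using x by simp
      then show ?thesis using abs_Re_le_cmod order_trans by blast
    qed
    then show "z \<notin> {-4<..<-2} \<or> (\<forall>t\<in>{0..1}. 2 / 5 \<le> norm (Complex x y - c t z))"
      using that by auto
  qed
  ultimately show ?thesis using that G(1,2) by metis
qed

definition slide_fun :: "real \<Rightarrow> real" where
  "slide_fun x = min x (max (6 / 5 + x / 5) (max (x - 1) (5 * x - 14)))"

lemma slide_fun_less: "x < y \<Longrightarrow> slide_fun x < slide_fun y"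
proof -
  have M: "max a b < max a' b'" "min a b < min a' b'" if "a < a'" "b < b'" for a a' b b' :: real
    using that by (auto simp: max_def min_def)
  assume "x < y"
  then show "slide_fun x < slide_fun y"
    unfolding slide_fun_def by (intro M) auto
qed

lemma slide_fun_eq: "x \<le> 3 / 2 \<or> 7 / 2 \<le> x \<Longrightarrow> slide_fun x = x"
  "11 / 4 \<le> x \<Longrightarrow> x \<le> 13 / 4 \<Longrightarrow> slide_fun x = x - 1"
  by (auto simp: slide_fun_def max_def min_def)

definition slide_weight :: "real \<Rightarrow> real" where
  "slide_weight z = max 0 (1 - 4 * \<bar>z + 2\<bar>)"

lemma slide_weight_bounds: "0 \<le> slide_weight z" "slide_weight z \<le> 1"
  by (auto simp: slide_weight_def)

text \<open>Slides the end of the band at position 3 along the front edge of disk 2 to position 2.\<close>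

definition slide_map :: "point \<Rightarrow> point" where
  "slide_map = (\<lambda>(x, y, z). (x + slide_weight z * clip (3 - \<bar>y\<bar>) * (slide_fun x - x), y, z))"

lemma compactly_supported_slide_map: "compactly_supported slide_map"
proof (rule compactly_supportedI[of _ 7])
  show "continuous_on UNIV slide_map"
    unfolding slide_map_def case_prod_unfold slide_weight_def slide_fun_def by (intro continuous_intros) auto
  show "inj slide_map"
  proof (rule injI)
    fix p q assume e: "slide_map p = slide_map q"
    obtain x y z x' y' z' where p: "p = (x, y, z)" "q = (x', y', z')" by (cases p, cases q)
    define l where "l = slide_weight z * clip (3 - \<bar>y\<bar>)"
    have l: "0 \<le> l" "l \<le> 1"
      unfolding l_def using slide_weight_bounds[of z] clip_bounds by (auto intro!: mult_le_one)
    have yz: "y' = y" "z' = z" and x: "x + l * (slide_fun x - x) = x' + l * (slide_fun x' - x')"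
      using e by (auto simp: slide_map_def p l_def)
    then have "x = x'"
      using blend_less[OF _ slide_fun_less l, of x x'] blend_less[OF _ slide_fun_less l, of x' x]
      by (metis less_irrefl linorder_neqE_linordered_idom)
    then show "p = q" by (simp add: p yz)
  qed
  fix x y z :: real assume "7 < \<bar>x\<bar> \<or> 7 < \<bar>y\<bar> \<or> 7 < \<bar>z\<bar>"
  then have "(x \<le> 3 / 2 \<or> 7 / 2 \<le> x) \<or> 3 - \<bar>y\<bar> \<le> 0 \<or> 1 - 4 * \<bar>z + 2\<bar> \<le> 0"
    by (elim disjE) (auto simp: abs_if split: if_splits)
  then consider "x \<le> 3 / 2 \<or> 7 / 2 \<le> x" | "3 - \<bar>y\<bar> \<le> 0" | "1 - 4 * \<bar>z + 2\<bar> \<le> 0" by blast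
  then show "slide_map (x, y, z) = (x, y, z)"
    by cases (simp_all add: slide_map_def slide_fun_eq clip_eq slide_weight_def)
qed

lemma slide_map_fixed:
  "x \<le> 3 / 2 \<or> 7 / 2 \<le> x \<or> z \<le> - 9 / 4 \<or> - 7 / 4 \<le> z \<Longrightarrow> slide_map (x, y, z) = (x, y, z)"
  by (auto simp: slide_map_def slide_fun_eq slide_weight_def)

lemma slide_map_disk: "slide_map ` fence_disk 5 2 = fence_disk 5 2"
proof (intro subset_antisym subsetI)
  have pt: "slide_map (x, y, - 2) = (slide_fun x, y, - 2)" if "0 \<le> y" "y \<le> 1" for x y
    using that by (simp add: slide_map_def slide_weight_def clip_eq)
  {
    fix p assume "p \<in> slide_map ` fence_disk 5 2"
    then obtain x y where xy: "0 \<le> x" "x \<le> 6" "0 \<le> y" "y \<le> 1" "p = (slide_fun x, y, - 2)"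
      using pt by (auto simp: fence_disk_def)
    moreover have "0 \<le> slide_fun x" "slide_fun x \<le> 6"
      using xy unfolding slide_fun_def by auto
    ultimately show "p \<in> fence_disk 5 2" by (simp add: fence_disk_def)
  next
    fix p assume "p \<in> fence_disk 5 2"
    then obtain x' y where xy: "0 \<le> x'" "x' \<le> 6" "0 \<le> y" "y \<le> 1" "p = (x', y, - 2)"
      by (auto simp: fence_disk_def)
    have "\<exists>x. 0 \<le> x \<and> x \<le> 6 \<and> slide_fun x = x'"
      by (rule IVT') (use xy in \<open>auto simp: slide_fun_eq\<close>,
        auto simp: slide_fun_def intro!: continuous_intros)
    then obtain x where x: "0 \<le> x" "x \<le> 6" "x' = slide_fun x" by auto
    then have "p = slide_map (x, y, - 2)" "(x, y, - 2) \<in> fence_disk 5 2"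
      using pt xy by (auto simp: fence_disk_def)
    then show "p \<in> slide_map ` fence_disk 5 2" by blast
  }
qed

lemma par_bounds:
  assumes "z \<in> {-4..-2}"
  shows "0 \<le> upper_par z" "upper_par z \<le> 1" "0 \<le> lower_par z" "lower_par z \<le> 1" "\<bar>turn_par z\<bar> \<le> 1"
  using assms by (auto simp: upper_par_def lower_par_def turn_par_def)

text \<open>Clearance data for \<open>zigzag_isotopy\<close>. Ray segments start within 1/4 of
  \<open>x = 5/2\<close> and end within 1, so their midpoints are at most 5/8 away.\<close>

lemma zigzag_Re_bound:
  assumes z: "z \<in> {-4..-2}"
  shows "Re (zigzag_center z) \<le> 25 / 8"
    "z \<le> - 121 / 40 \<Longrightarrow> Re (zigzag_center z) = 2" "- 119 / 40 \<le> z \<Longrightarrow> Re (zigzag_center z) = 3"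
proof -
  show lo: "z \<le> - 121 / 40 \<Longrightarrow> Re (zigzag_center z) = 2"
    and hi: "- 119 / 40 \<le> z \<Longrightarrow> Re (zigzag_center z) = 3"
    using zigzag_upper[of z] zigzag_lower[of z] by (auto simp: band_center_def)
  show "Re (zigzag_center z) \<le> 25 / 8"
  proof -
    consider "z \<le> - 121 / 40" | "- 119 / 40 \<le> z" | "- 121 / 40 \<le> z" "z \<le> - 119 / 40" by linarith
    then show ?thesis
    proof cases
      case 3
      define w where "w = - 40 * (z + 3)"
      have w: "\<bar>w\<bar> \<le> 1" using 3 by (auto simp: w_def abs_le_iff)
      have "\<bar>w\<bar> \<le> ray_gauge w" by (simp add: ray_gauge_def)
      then have "\<bar>w\<bar> * (1 / ray_gauge w) \<le> 1" using ray_gauge_bounds(1)[of w] by (simp add: divide_le_eq)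
      define X where "X = - w * (1 / 4 + 1 / ray_gauge w)"
      have K: "X \<le> 5 / 4"
        unfolding X_def
      proof -
        have "- w * (1 / 4 + 1 / ray_gauge w) \<le> \<bar>w\<bar> * (1 / 4 + 1 / ray_gauge w)"
          using ray_gauge_bounds(1)[of w] by (intro mult_right_mono) auto
        also have "\<dots> = \<bar>w\<bar> / 4 + \<bar>w\<bar> * (1 / ray_gauge w)" by (simp add: algebra_simps)
        also have "\<dots> \<le> 1 / 4 + 1"
          using \<open>\<bar>w\<bar> * (1 / ray_gauge w) \<le> 1\<close> w by (intro add_mono) auto
        also have "\<dots> = 5 / 4" by simp
        finally show "- w * (1 / 4 + 1 / ray_gauge w) \<le> 5 / 4" .
      qed
      have "Re (zigzag_center z) = 5 / 2 + X / 2"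
        using zigzag_middle(1)[OF 3] unfolding w_def[symmetric] by (simp add: ray_def X_def)
      then show ?thesis using K by simp
    qed (use lo hi in auto)
  qed
qed

lemma norm_zigzag_dir:
  assumes z: "z \<in> {-4..-2}"
  shows "norm (zigzag_dir z) \<le> 3 / 4"
proof -
  consider "z \<le> - 121 / 40" | "- 119 / 40 \<le> z" | "- 121 / 40 \<le> z" "z \<le> - 119 / 40" by linarith
  then show ?thesis
  proof cases
    case 1
    have "norm (zigzag_dir z) \<le> 1 / 4"
      unfolding zigzag_lower(2)[OF 1] using par_bounds[OF z] by (intro norm_band_dir)
    then show ?thesis by simp
  next
    case 2
    have "norm (zigzag_dir z) \<le> 1 / 4"
      unfolding zigzag_upper(2)[OF 2] using par_bounds[OF z] by (intro norm_band_dir)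
    then show ?thesis by simp
  next
    case 3
    define w g where "w = - 40 * (z + 3)" and "g = 1 / ray_gauge w"
    have w: "\<bar>w\<bar> \<le> 1" using 3 by (auto simp: w_def abs_le_iff)
    have g: "3 / 4 \<le> g" using ray_gauge_bounds[of w] w by (simp add: g_def field_simps)
    have "\<bar>w\<bar> \<le> ray_gauge w" "1 - \<bar>w\<bar> \<le> ray_gauge w" by (simp_all add: ray_gauge_def)
    then have gw: "\<bar>w\<bar> * g \<le> 1" "(1 - \<bar>w\<bar>) * g \<le> 1"
      using ray_gauge_bounds(1)[of w] by (simp_all add: g_def divide_le_eq)
    have n: "norm (of_real g * ray w) \<le> 3 / 2"
    proof -
      have "(g * w)\<^sup>2 \<le> 1\<^sup>2" "(g * (1 - \<bar>w\<bar>))\<^sup>2 \<le> 1\<^sup>2"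
        using gw g w by (intro power2_le_iff_abs_le[THEN iffD2]; simp add: abs_mult mult.commute)+
      then have "(g * w)\<^sup>2 + (g * (1 - \<bar>w\<bar>))\<^sup>2 \<le> (3 / 2)\<^sup>2" by (simp add: power2_eq_square)
      then have "sqrt ((g * w)\<^sup>2 + (g * (1 - \<bar>w\<bar>))\<^sup>2) \<le> 3 / 2" by (intro real_le_lsqrt) auto
      then show ?thesis by (simp add: ray_def cmod_def)
    qed
    have "norm (zigzag_dir z) = \<bar>(g - 1 / 4) / 2\<bar> * norm (ray w)"
      unfolding zigzag_middle(2)[OF 3] unfolding w_def[symmetric] unfolding g_def[symmetric]
      by (simp only: norm_minus_cancel norm_mult norm_of_real)
    also have "\<bar>(g - 1 / 4) / 2\<bar> = (g - 1 / 4) / 2" using g by simp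
    also have "(g - 1 / 4) / 2 * norm (ray w) \<le> g / 2 * norm (ray w)" by (intro mult_right_mono) auto
    also have "\<dots> = norm (of_real g * ray w) / 2" using g by (simp add: norm_mult)
    finally show ?thesis using n by simp
  qed
qed

text \<open>The ribbon makes half a turn along each of the two bands and another one along the disk.\<close>

definition zigzag_angle :: "real \<Rightarrow> real" where
  "zigzag_angle z = pi * upper_par z + pi * ((turn_par z + 1) / 2) + pi * lower_par z"

text \<open>On each of the three stretches the actual direction and the rotating one pass through
  the same open half plane: upper, lower, upper. The segment between them therefore misses
  0.\<close>

lemma zigzag_dir_blend:
  assumes z: "z \<in> {-4..-2}" and l: "0 \<le> l" "l \<le> 1"
  shows "of_real (1 - l) * zigzag_dir z + of_real l * (cis (zigzag_angle z) / 4) \<noteq> 0"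
proof -
  consider "- 119 / 40 \<le> z" | "z \<le> - 121 / 40" | "- 121 / 40 < z" "z < - 119 / 40" by linarith
  then show ?thesis
  proof cases
    case 1
    then have "turn_par z = - 1" "lower_par z = 0"
      by (auto simp: turn_par_def lower_par_def max_def min_def)
    then show ?thesis
      using band_dir_blend[OF par_bounds(1,2)[OF z] l] zigzag_upper(2)[OF 1] by (simp add: zigzag_angle_def)
  next
    case 2
    then have "turn_par z = 1" "upper_par z = 1"
      by (auto simp: turn_par_def upper_par_def max_def min_def)
    then have "cis (zigzag_angle z) = cis (pi * lower_par z) * cis (2 * pi)"
      by (simp add: zigzag_angle_def cis_mult algebra_simps)
    then show ?thesis
      using band_dir_blend[OF par_bounds(3,4)[OF z] l] zigzag_lower(2)[OF 2] by simp
  next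
    case 3
    define w where "w = - 40 * (z + 3)"
    have t: "turn_par z = w" "upper_par z = 1" "lower_par z = 0"
      using 3 by (auto simp: w_def turn_par_def upper_par_def lower_par_def max_def min_def)
    have w: "\<bar>w\<bar> < 1" using 3 by (auto simp: w_def abs_less_iff)
    then have "1 / ray_gauge w - 1 / 4 > 0" using ray_gauge_bounds[of w] by (simp add: field_simps)
    then have "Im (zigzag_dir z) < 0"
      using zigzag_middle(2)[of z] 3 w unfolding w_def[symmetric] by (simp add: ray_def mult_neg_pos)
    moreover have "0 < sin (pi * ((w + 1) / 2))"
      using w by (intro sin_gt_zero) (auto simp: abs_less_iff)
    then have "Im (cis (zigzag_angle z) / 4) < 0"
      by (simp add: zigzag_angle_def t sin_add)
    ultimately have "0 < (1 - l) * - Im (zigzag_dir z) + l * - Im (cis (zigzag_angle z) / 4)"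
    proof (cases "l = 0")
      case False
      then have "0 < l * - Im (cis (zigzag_angle z) / 4)" using l \<open>Im (cis (zigzag_angle z) / 4) < 0\<close>
        by (intro mult_pos_pos) auto
      moreover have "0 \<le> (1 - l) * - Im (zigzag_dir z)" using l \<open>Im (zigzag_dir z) < 0\<close>
        by (intro mult_nonneg_nonneg) auto
      ultimately show ?thesis by linarith
    qed auto
    then have "Im (of_real (1 - l) * zigzag_dir z + of_real l * (cis (zigzag_angle z) / 4)) < 0" by simp
    then show ?thesis by (metis less_irrefl zero_complex.simps(2))
  qed
qed

lemma continuous_on_zigzag [continuous_intros]:
  assumes "continuous_on S f"
  shows "continuous_on S (\<lambda>x. zigzag_center (f x))" "continuous_on S (\<lambda>x. zigzag_dir (f x))"
    "continuous_on S (\<lambda>x. zigzag_angle (f x))"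
proof -
  have g: "ray_gauge w \<noteq> 0" for w using ray_gauge_bounds(1)[of w] by linarith
  note d = zigzag_center_def zigzag_dir_def zigzag_angle_def upper_par_def lower_par_def turn_par_def
    ray_def Complex_eq
  have tp: "continuous_on S (\<lambda>x. turn_par (f x))"
    unfolding turn_par_def by (intro continuous_intros assms)
  have gc: "continuous_on S (\<lambda>x. ray_gauge (turn_par (f x)))"
    unfolding ray_gauge_def by (intro continuous_intros tp) auto
  have rc: "continuous_on S (\<lambda>x. ray (turn_par (f x)))"
    unfolding ray_def Complex_eq by (intro continuous_intros tp)
  show "continuous_on S (\<lambda>x. zigzag_center (f x))"
    unfolding zigzag_center_def upper_par_def lower_par_def by (intro continuous_intros assms gc rc) (auto simp: g)
  show "continuous_on S (\<lambda>x. zigzag_dir (f x))"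
    unfolding zigzag_dir_def upper_par_def lower_par_def by (intro continuous_intros assms gc rc) (auto simp: g)
  show "continuous_on S (\<lambda>x. zigzag_angle (f x))"
    unfolding zigzag_angle_def upper_par_def lower_par_def by (intro continuous_intros assms tp) auto
qed

text \<open>\<open>G\<close> moves the centers and blends the directions into the rotation by
  \<open>zigzag_angle\<close>; \<open>H\<close> interpolates this angle with
  \<open>pi * height z + ramp z\<close>. Both run from 0 to \<open>3 * pi\<close>, so the ends stay
  put.\<close>

lemma zigzag_isotopy:
  obtains G where "compactly_supported G"
    "G ` ribbon {-4..-2} (\<lambda>z. zigzag_center z - of_real (slide_weight z)) zigzag_dir =
      left_ribbon (\<lambda>z. pi * height z + ramp z)"
    "\<And>x y z. z \<le> - 4 \<or> - 2 \<le> z \<or> 23 / 4 - core z \<le> x \<Longrightarrow> G (x, y, z) = (x, y, z)"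
proof -
  define c where "c t z = of_real (1 - t) * (zigzag_center z - of_real (slide_weight z)) + of_real (t * core z)"
    for t z :: real
  define v where "v t z = of_real (1 - t) * zigzag_dir z + of_real t * (cis (zigzag_angle z) / 4)"
    for t z :: real
  define v' where "v' t z = cis ((1 - t) * zigzag_angle z + t * (pi * height z + ramp z)) / 4" for t z :: real
  have ends: "zigzag_center (- 4) = 2" "zigzag_center (- 2) = 3" "zigzag_dir (- 4) = - 1 / 4" "zigzag_dir (- 2) = 1 / 4"
    "zigzag_angle (- 4) = 3 * pi" "zigzag_angle (- 2) = 0" "height (- 4) = 1" "height (- 2) = 0"
    "ramp (- 4) = 2 * pi" "ramp (- 2) = 0" "slide_weight (- 4) = 0" "slide_weight (- 2) = 1"
    using zigzag_upper[of "- 2"] zigzag_lower[of "- 4"]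
    by (simp_all add: zigzag_angle_def upper_par_def lower_par_def turn_par_def band_ends height_def
        ramp_def slide_weight_def)
  have cis3: "cis (pi * 3) = - 1"
  proof -
    have "cis (pi * 3) = cis pi * cis (2 * pi)" by (simp only: cis_mult) (simp add: algebra_simps)
    then show ?thesis by simp
  qed
  have cc: "continuous_on ({0..1} \<times> {-4..-2}) (\<lambda>p. c (fst p) (snd p))"
    unfolding c_def slide_weight_def by (intro continuous_intros)
  obtain G where G: "compactly_supported G"
    "G ` ribbon {-4..-2} (c 0) (v 0) = ribbon {-4..-2} (c 1) (v 1)"
    "\<And>x y z. z \<notin> {-4<..<-2} \<or> (\<forall>t\<in>{0..1}. 4 / 5 \<le> norm (Complex x y - c t z)) \<Longrightarrow>
      G (x, y, z) = (x, y, z)"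
  proof (rule ribbon_isotopy[of "- 4" "- 2" "3 / 4" "4 / 5" c v])
    show "continuous_on ({0..1} \<times> {-4..-2}) (\<lambda>p. v (fst p) (snd p))"
      unfolding v_def by (intro continuous_intros) auto
    fix t z :: real assume t: "t \<in> {0..1}"
    show "v t z \<noteq> 0 \<and> norm (v t z) \<le> 3 / 4" if z: "z \<in> {-4..-2}"
      unfolding v_def using t z
      by (intro conjI zigzag_dir_blend norm_blend norm_zigzag_dir) (auto simp: norm_divide)
    show "c t z = c 0 z \<and> v t z = v 0 z" if "z \<in> {-4, -2}"
      using that by (auto simp: c_def v_def ends core_ends cis3 algebra_simps)
  qed (use cc in auto)
  obtain H where H: "compactly_supported H"
    "H ` ribbon {-4..-2} (c 1) (v' 0) = ribbon {-4..-2} (c 1) (v' 1)"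
    "\<And>x y z. z \<notin> {-4<..<-2} \<or> (\<forall>t\<in>{0..1::real}. 4 / 5 \<le> norm (Complex x y - c 1 z)) \<Longrightarrow>
      H (x, y, z) = (x, y, z)"
  proof (rule ribbon_isotopy[of "- 4" "- 2" "3 / 4" "4 / 5" "\<lambda>t. c 1" v'])
    show "continuous_on ({0..1} \<times> {-4..-2}) (\<lambda>p. v' (fst p) (snd p))"
      unfolding v'_def height_def by (intro continuous_intros) auto
    show "continuous_on ({0..1::real} \<times> {-4..-2}) (\<lambda>p. c 1 (snd p))"
      unfolding c_def slide_weight_def by (intro continuous_intros)
    fix t z :: real
    show "v' t z \<noteq> 0 \<and> norm (v' t z) \<le> 3 / 4"
      by (simp add: v'_def norm_divide)
    show "c 1 z = c 1 z \<and> v' t z = v' 0 z" if "z \<in> {-4, -2}"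
      using that by (auto simp: v'_def ends algebra_simps)
  qed auto
  have e: "v 1 = v' 0" by (simp add: v_def v'_def fun_eq_iff)
  have "ribbon {-4..-2} (\<lambda>z. zigzag_center z - of_real (slide_weight z)) zigzag_dir = ribbon {-4..-2} (c 0) (v 0)"
    by (rule ribbon_cong) (simp add: c_def v_def)
  moreover have "left_ribbon (\<lambda>z. pi * height z + ramp z) = ribbon {-4..-2} (c 1) (v' 1)"
    unfolding left_ribbon_def by (rule ribbon_cong) (simp add: c_def v'_def)
  ultimately have "(H \<circ> G) ` ribbon {-4..-2} (\<lambda>z. zigzag_center z - of_real (slide_weight z)) zigzag_dir =
      left_ribbon (\<lambda>z. pi * height z + ramp z)"
    using G(2) H(2) e by (simp only: image_comp[symmetric])
  moreover have "(H \<circ> G) (x, y, z) = (x, y, z)" if xz: "z \<le> - 4 \<or> - 2 \<le> z \<or> 23 / 4 - core z \<le> x" for x y z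
  proof -
    have far: "4 / 5 \<le> norm (Complex x y - c t z)"
      if x: "23 / 4 - core z \<le> x" and z: "z \<in> {-4<..<-2}" and t: "t \<in> {0..1}" for t
    proof -
      \<comment> \<open>With radius 4/5, centers left of \<open>19/4 - core z\<close> do not reach
        the right ribbon, which begins at \<open>23/4 - core z\<close>. Where the rays extend
        furthest to the right, \<open>core\<close> is 1; near \<open>z = - 2\<close>, where it
        approaches 2, the slide has already moved the zigzag away.\<close>
      have k: "Re (zigzag_center z) - slide_weight z + core z \<le> 19 / 4"
      proof -
        have zz: "z \<in> {-4..-2}" using z by auto
        consider "z \<le> - 121 / 40" | "- 121 / 40 \<le> z" "z \<le> - 119 / 40" | "- 119 / 40 \<le> z" "z \<le> - 9 / 4" | "- 9 / 4 \<le> z"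
          by linarith
        then show ?thesis
        proof cases
          case 1
          then show ?thesis using zigzag_Re_bound(2)[OF zz 1] slide_weight_bounds(1)[of z] core_bounds(2)[of z] by linarith
        next
          case 2
          then have "core z = 1" by (intro core_middle) auto
          then show ?thesis using zigzag_Re_bound(1)[OF zz] slide_weight_bounds(1)[of z] by linarith
        next
          case 3
          have "core z \<le> 7 / 4" using 3 unfolding core_def by (auto simp: max_def min_def abs_if)
          then show ?thesis using zigzag_Re_bound(3)[OF zz 3(1)] slide_weight_bounds(1)[of z] by linarith
        next
          case 4
          then have "slide_weight z = 1 + 4 * (z + 2)" using z by (simp add: slide_weight_def)
          moreover have "core z = 1 + (z + 11 / 4) * (4 / 3)" using 4 z unfolding core_def by (auto simp: max_def min_def abs_if)
          moreover have "Re (zigzag_center z) = 3" using 4 by (intro zigzag_Re_bound(3)[OF zz]) linarith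
          ultimately show ?thesis using 4 z by (simp add: field_simps)
        qed
      qed
      define K R where "K = 19 / 4 - core z" and "R = Re (zigzag_center z) - slide_weight z"
      have "Re (c t z) = (1 - t) * R + t * core z" by (simp add: c_def R_def)
      also have "\<dots> \<le> (1 - t) * K + t * K"
        using k core_bounds[of z] t unfolding K_def R_def by (intro add_mono mult_left_mono) auto
      also have "\<dots> = K" by (simp add: algebra_simps)
      finally have "Re (c t z) \<le> 19 / 4 - core z" by (simp add: K_def)
      then have "4 / 5 \<le> \<bar>Re (Complex x y - c t z)\<bar>" using x by simp
      then show ?thesis using abs_Re_le_cmod order_trans by blast
    qed
    have "G (x, y, z) = (x, y, z)"
    proof (rule G(3))
      show "z \<notin> {-4<..<-2} \<or> (\<forall>t\<in>{0..1}. 4 / 5 \<le> norm (Complex x y - c t z))"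
        using xz far by auto
    qed
    moreover have "H (x, y, z) = (x, y, z)"
    proof (rule H(3))
      show "z \<notin> {-4<..<-2} \<or> (\<forall>t\<in>{0..1::real}. 4 / 5 \<le> norm (Complex x y - c 1 z))"
        using xz far[of 1] by auto
    qed
    ultimately show ?thesis by simp
  qed
  ultimately show ?thesis
    using that[of "H \<circ> G"] compactly_supported_comp[OF G(1) H(1)] by blast
qed

section \<open>The isotopy between the two fences\<close>

lemma image_eq_self: "(\<And>p. p \<in> S \<Longrightarrow> f p = p) \<Longrightarrow> f ` S = S"
  by force

lemma straighten_long_band: "p \<in> fence_band 4 2 4 \<Longrightarrow> straighten p = p"
proof -
  assume "p \<in> fence_band 4 2 4"
  then obtain s t where st: "\<bar>s\<bar> \<le> 1" "0 \<le> t" "t \<le> 1"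
    and p: "p = (4 + s * (1 - 2 * t) / 4, - ((2 - s) * t * (1 - t)), - (2 + t * 2))"
    unfolding fence_band_def by (force simp: abs_le_iff)
  show ?thesis
    unfolding p
  proof (rule straighten_fixed)
    have "- ((2 - s) * t * (1 - t)) \<le> - 1 / 5" if "\<bar>- (2 + t * 2) + 3\<bar> < 1 / 20"
    proof -
      have t: "19 / 40 \<le> t" "19 / 40 \<le> 1 - t" using that by (auto simp: abs_if split: if_splits)
      have "1 * (19 / 40) * (19 / 40) \<le> (2 - s) * t * (1 - t)"
        using t st by (intro mult_mono) (auto simp: abs_le_iff)
      then show ?thesis by linarith
    qed
    then show "1 / 20 \<le> \<bar>- (2 + t * 2) + 3\<bar> \<or> - ((2 - s) * t * (1 - t)) \<le> - 1 / 5" by force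
  qed
qed

text \<open>Read off from the preimage under \<open>straighten\<close>: the bands stay left of 13/4,
  a fixed point of the increasing \<open>squeeze\<close>, and the narrowed disk ends at 7/2.\<close>

lemma zigzag_ribbon_bound:
  assumes "(x, y, z) \<in> ribbon {-4..-2} zigzag_center zigzag_dir"
  shows "x \<le> 7 / 2"
proof -
  have band: "x' \<le> 13 / 4" if mem: "(x', y', z') \<in> fence_band P i j" and P: "P \<le> 3" for x' y' z' P i j
  proof -
    obtain s t where st: "\<bar>s\<bar> \<le> 1" "0 \<le> t" "t \<le> 1" "x' = P + s * (1 - 2 * t) / 4"
      using mem unfolding fence_band_def by (force simp: abs_le_iff)
    have "\<bar>s * (1 - 2 * t)\<bar> \<le> 1 * 1" unfolding abs_mult using st by (intro mult_mono) auto
    then have "s * (1 - 2 * t) \<le> 1" by (simp add: abs_le_iff)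
    then show ?thesis using st(4) P by simp
  qed
  have "(x, y, z) \<in> straighten ` (fence_band 3 2 3 \<union> fence_disk 5 3 \<union> fence_band 2 3 4)"
    unfolding straighten_zigzag by (rule assms)
  then obtain x' y' z' where q: "(x, y, z) = straighten (x', y', z')"
    "(x', y', z') \<in> fence_band 3 2 3 \<union> fence_disk 5 3 \<union> fence_band 2 3 4" by auto
  consider "(x', y', z') \<in> fence_disk 5 3" | "x' \<le> 13 / 4"
    using q(2) band[of x' y' z' 3] band[of x' y' z' 2] by auto
  then show ?thesis
  proof cases
    case 1
    then have "(x, y, z) \<in> straighten ` fence_disk 5 3" unfolding q(1) by (rule imageI)
    then show ?thesis unfolding straighten_disk by (auto simp: abs_le_iff)
  next
    case 2
    define l where "l = tent z' * clip (4 + 20 * y') * clip (2 - y')"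
    have l: "0 \<le> l" "l \<le> 1"
      unfolding l_def using tent_bounds[of z'] clip_bounds by (auto intro!: mult_le_one)
    have "squeeze x' \<le> squeeze (13 / 4)" using squeeze_less[of x' "13 / 4"] 2 by (metis less_eq_real_def)
    then have "squeeze x' \<le> 13 / 4" by (simp add: squeeze_fixed)
    then have "(1 - l) * x' + l * squeeze x' \<le> (1 - l) * (13 / 4) + l * (13 / 4)"
      using l 2 by (intro add_mono mult_left_mono) auto
    also have "\<dots> = 13 / 4" by (simp add: field_simps)
    finally have "(1 - l) * x' + l * squeeze x' \<le> 13 / 4" .
    moreover have "x = (1 - l) * x' + l * squeeze x'"
      using q(1) by (simp add: straighten_def squeeze_map_def push_map_def shear_map_def l_def algebra_simps)
    ultimately show ?thesis by simp
  qed
qed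

lemma slide_map_zigzag:
  "slide_map ` ribbon {-4..-2} zigzag_center zigzag_dir =
    ribbon {-4..-2} (\<lambda>z. zigzag_center z - of_real (slide_weight z)) zigzag_dir"
proof (rule image_ribbon)
  fix s z :: real assume s: "\<bar>s\<bar> \<le> 1" and z: "z \<in> {-4..-2}"
  show "slide_map (Re (zigzag_center z + of_real s * zigzag_dir z),
      Im (zigzag_center z + of_real s * zigzag_dir z), z) =
    (Re (zigzag_center z - of_real (slide_weight z) + of_real s * zigzag_dir z),
      Im (zigzag_center z - of_real (slide_weight z) + of_real s * zigzag_dir z), z)"
  proof (cases "z \<le> - 9 / 4")
    case True
    then have "slide_weight z = 0" by (simp add: slide_weight_def)
    then show ?thesis by (simp add: slide_map_def)
  next
    case False
    define t where "t = upper_par z"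
    have t: "0 \<le> t" "t \<le> 1" using par_bounds[OF z] by (auto simp: t_def)
    have "- 119 / 40 \<le> z" using False by linarith
    note zz = zigzag_upper[OF this, folded t_def]
    have "\<bar>s * (1 - 2 * t)\<bar> \<le> 1 * 1" unfolding abs_mult using s t by (intro mult_mono) auto
    then have x: "11 / 4 \<le> 3 + s * (1 - 2 * t) / 4" "3 + s * (1 - 2 * t) / 4 \<le> 13 / 4"
      by (simp_all add: abs_le_iff)
    define y where "y = Im (zigzag_center z + of_real s * zigzag_dir z)"
    have "y = - ((2 - s) * t * (1 - t))"
      by (simp add: y_def zz band_center_def band_dir_def algebra_simps)
    moreover have "(2 - s) * t * (1 - t) \<le> 2" "0 \<le> (2 - s) * t * (1 - t)"
    proof -
      have "0 \<le> (t - 1 / 2)\<^sup>2" by simp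
      then have "t * (1 - t) \<le> 1 / 4" by (simp add: power2_eq_square algebra_simps)
      then have "(2 - s) * (t * (1 - t)) \<le> 3 * (1 / 4)" using s t by (intro mult_mono) auto
      then show "(2 - s) * t * (1 - t) \<le> 2" unfolding mult.assoc by linarith
      show "0 \<le> (2 - s) * t * (1 - t)" using s t by simp
    qed
    ultimately have "\<bar>y\<bar> \<le> 2" by simp
    then have "clip (3 - \<bar>y\<bar>) = 1" by (intro clip_eq) simp
    moreover have "Re (zigzag_center z + of_real s * zigzag_dir z) = 3 + s * (1 - 2 * t) / 4"
      by (simp add: zz band_center_def band_dir_def)
    ultimately show ?thesis
      using slide_fun_eq(2)[OF x] unfolding y_def[symmetric]
      by (simp add: slide_map_def) (simp add: y_def)
  qed
qed

lemma right_ribbon_bound: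
  assumes "(x, y, z) \<in> right_ribbon \<alpha>"
  shows "23 / 4 - core z \<le> x"
proof -
  obtain s where s: "\<bar>s\<bar> \<le> 1" "x = Re (of_real (6 - core z) + of_real s * (cis (\<alpha> z) / 4))"
    using assms unfolding right_ribbon_def ribbon_def by auto
  have "\<bar>s * cos (\<alpha> z)\<bar> \<le> 1 * 1" unfolding abs_mult using s by (intro mult_mono) auto
  then show ?thesis using s(2) by (simp add: abs_le_iff)
qed

text \<open>What the fences share from the level -2 upwards. Disk 4 is common too, but stands apart
  because \<open>flip\<close> exchanges it with disk 2.\<close>

definition frame :: "point set" where
  "frame = fence_disk 5 1 \<union> fence_disk 5 2 \<union> fence_band 1 1 2 \<union> fence_band 5 1 2"

lemma fence_band_bounds:
  assumes "(x, y, z) \<in> fence_band P i j" "i < j"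
  shows "P - 1 / 4 \<le> x" "x \<le> P + 1 / 4" "- real j \<le> z" "z \<le> - real i"
proof -
  obtain s t where st: "\<bar>s\<bar> \<le> 1" "0 \<le> t" "t \<le> 1" "x = P + s * (1 - 2 * t) / 4"
    "z = - (real i + t * (real j - real i))"
    using assms(1) unfolding fence_band_def by (force simp: abs_le_iff)
  have "\<bar>s * (1 - 2 * t)\<bar> \<le> 1 * 1" unfolding abs_mult using st by (intro mult_mono) auto
  then show "P - 1 / 4 \<le> x" "x \<le> P + 1 / 4" using st(4) by (simp_all add: abs_le_iff)
  define q where "q = t * (real j - real i)"
  have "q \<le> 1 * (real j - real i)" unfolding q_def using st assms(2) by (intro mult_right_mono) auto
  moreover have "0 \<le> q" unfolding q_def using st assms(2) by simp
  moreover have "z = - (real i + q)" unfolding q_def by (rule st(5))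
  ultimately show "- real j \<le> z" "z \<le> - real i" by simp_all
qed

text \<open>The order matters: \<open>A\<close> takes the long band out of the way to the right
  before the zigzag is slid and bent into the left model ribbon. Disk 2 is kept only as a set, since
  the slide moves points along it.\<close>

lemma unwind:
  obtains G where "compactly_supported G"
    "G ` (fence_band 3 2 3 \<union> fence_disk 5 3 \<union> fence_band 2 3 4 \<union> fence_band 4 2 4) =
      left_ribbon (\<lambda>z. pi * height z + ramp z) \<union> right_ribbon (\<lambda>z. pi * height z)"
    "G ` frame = frame" "G ` fence_disk 5 2 = fence_disk 5 2"
    "\<And>x y z. z \<le> - 4 \<or> - 7 / 4 \<le> z \<Longrightarrow> G (x, y, z) = (x, y, z)"
proof -
  obtain A where A: "compactly_supported A"
    "A ` fence_band 4 2 4 = right_ribbon (\<lambda>z. pi * height z)"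
    "\<And>x y z. z \<le> - 4 \<or> - 2 \<le> z \<or> x \<le> 18 / 5 \<Longrightarrow> A (x, y, z) = (x, y, z)"
    by (rule long_band_isotopy) (rule that, assumption, assumption, simp)
  obtain B where B: "compactly_supported B"
    "B ` ribbon {-4..-2} (\<lambda>z. zigzag_center z - of_real (slide_weight z)) zigzag_dir =
      left_ribbon (\<lambda>z. pi * height z + ramp z)"
    "\<And>x y z. z \<le> - 4 \<or> - 2 \<le> z \<or> 23 / 4 - core z \<le> x \<Longrightarrow> B (x, y, z) = (x, y, z)"
    by (rule zigzag_isotopy) (rule that, assumption, assumption, simp)
  define G where "G = B \<circ> (slide_map \<circ> (A \<circ> straighten))"
  let ?Z = "fence_band 3 2 3 \<union> fence_disk 5 3 \<union> fence_band 2 3 4"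
  have compact: "compactly_supported G"
    unfolding G_def by (intro compactly_supported_comp compactly_supported_straighten A(1)
        compactly_supported_slide_map B(1))
  have Z: "G ` (?Z \<union> fence_band 4 2 4) =
      left_ribbon (\<lambda>z. pi * height z + ramp z) \<union> right_ribbon (\<lambda>z. pi * height z)"
  proof -
    have "A ` ribbon {-4..-2} zigzag_center zigzag_dir = ribbon {-4..-2} zigzag_center zigzag_dir"
    proof (rule image_eq_self)
      fix p assume p: "p \<in> ribbon {-4..-2} zigzag_center zigzag_dir"
      obtain x y z where xyz: "p = (x, y, z)" by (cases p)
      have "x \<le> 18 / 5" using zigzag_ribbon_bound[OF p[unfolded xyz]] by simp
      then show "A p = p" unfolding xyz by (intro A(3)) auto
    qed
    then have "G ` ?Z = left_ribbon (\<lambda>z. pi * height z + ramp z)"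
      unfolding G_def by (simp only: image_comp[symmetric] straighten_zigzag slide_map_zigzag B(2))
    moreover have "straighten ` fence_band 4 2 4 = fence_band 4 2 4"
      by (intro image_eq_self straighten_long_band)
    moreover have "slide_map ` right_ribbon \<alpha> = right_ribbon \<alpha>" "B ` right_ribbon \<alpha> = right_ribbon \<alpha>" for \<alpha>
    proof -
      have "slide_map p = p \<and> B p = p" if p: "p \<in> right_ribbon \<alpha>" for p
      proof -
        obtain x y z where xyz: "p = (x, y, z)" by (cases p)
        have "23 / 4 - core z \<le> x" using right_ribbon_bound[OF p[unfolded xyz]] .
        then show ?thesis using core_bounds[of z] unfolding xyz
          by (intro conjI B(3) slide_map_fixed) auto
      qed
      then show "slide_map ` right_ribbon \<alpha> = right_ribbon \<alpha>" "B ` right_ribbon \<alpha> = right_ribbon \<alpha>"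
        by (auto intro!: image_eq_self)
    qed
    then have "B ` slide_map ` A ` straighten ` fence_band 4 2 4 = right_ribbon (\<lambda>z. pi * height z)"
      by (simp only: calculation(2) A(2))
    ultimately show ?thesis
      unfolding image_Un[of G ?Z] by (simp only: G_def image_comp[symmetric])
  qed
  have fixed: "G (x, y, z) = (x, y, z)"
    if "z \<le> - 4 \<or> - 7 / 4 \<le> z \<or> (- 2 \<le> z \<and> (x \<le> 3 / 2 \<or> 7 / 2 \<le> x))" for x y z
  proof -
    have "1 / 20 \<le> \<bar>z + 3\<bar>" using that by (auto simp: abs_if)
    then have "straighten (x, y, z) = (x, y, z)" by (intro straighten_fixed) simp
    moreover have "A (x, y, z) = (x, y, z)" "B (x, y, z) = (x, y, z)"
      using that by (auto intro!: A(3) B(3))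
    moreover have "slide_map (x, y, z) = (x, y, z)"
      using that by (intro slide_map_fixed) auto
    ultimately show ?thesis by (simp add: G_def)
  qed
  have disk: "G ` fence_disk 5 2 = fence_disk 5 2"
  proof -
    have "straighten p = p" "A p = p" "B p = p" if "p \<in> fence_disk 5 2" for p
      using that by (auto simp: fence_disk_def intro!: straighten_fixed A(3) B(3))
    then have "straighten ` fence_disk 5 2 = fence_disk 5 2" "A ` fence_disk 5 2 = fence_disk 5 2"
      "B ` fence_disk 5 2 = fence_disk 5 2" by (auto intro!: image_eq_self)
    then show ?thesis
      unfolding G_def by (simp only: image_comp[symmetric] slide_map_disk)
  qed
  have frame: "G ` frame = frame"
  proof -
    have "G ` fence_disk 5 1 = fence_disk 5 1"
      by (rule image_eq_self) (auto simp: fence_disk_def intro!: fixed)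
    moreover have "G ` fence_band 1 1 2 = fence_band 1 1 2"
    proof (rule image_eq_self)
      fix p assume p: "p \<in> fence_band 1 1 2"
      obtain x y z where xyz: "p = (x, y, z)" by (cases p)
      show "G p = p" unfolding xyz
        using fence_band_bounds[OF p[unfolded xyz]] by (intro fixed) auto
    qed
    moreover have "G ` fence_band 5 1 2 = fence_band 5 1 2"
    proof (rule image_eq_self)
      fix p assume p: "p \<in> fence_band 5 1 2"
      obtain x y z where xyz: "p = (x, y, z)" by (cases p)
      show "G p = p" unfolding xyz
        using fence_band_bounds[OF p[unfolded xyz]] by (intro fixed) auto
    qed
    ultimately show ?thesis unfolding frame_def by (simp only: image_Un disk)
  qed
  show ?thesis by (rule that[OF compact Z frame disk fixed]) auto
qed

section \<open>The half turn\<close>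

definition flip :: "point \<Rightarrow> point" where
  "flip = (\<lambda>(x, y, z). (6 - x, y, - 6 - z))"

lemma flip_flip: "flip (flip p) = p"
  by (simp add: flip_def split: prod.split)

lemma flip_disk: "k \<le> 6 \<Longrightarrow> flip ` fence_disk 5 k = fence_disk 5 (6 - k)"
proof -
  have sub: "flip ` fence_disk 5 k \<subseteq> fence_disk 5 (6 - k)" if "k \<le> 6" for k
    using that by (auto simp: flip_def fence_disk_def of_nat_diff)
  assume k: "k \<le> 6"
  have "fence_disk 5 (6 - k) = flip ` flip ` fence_disk 5 (6 - k)"
    by (simp add: image_comp comp_def flip_flip)
  also have "\<dots> \<subseteq> flip ` fence_disk 5 k"
    using sub[of "6 - k"] k by (intro image_mono) simp
  finally show ?thesis using sub[OF k] by blast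
qed

lemma flip_band:
  assumes "i < j" "j \<le> 6"
  shows "flip ` fence_band P i j = fence_band (6 - P) (6 - j) (6 - i)"
proof -
  have sub: "flip ` fence_band P i j \<subseteq> fence_band (6 - P) (6 - j) (6 - i)" if "i < j" "j \<le> 6" for P i j
  proof
    fix p assume "p \<in> flip ` fence_band P i j"
    then obtain s t where st: "- 1 \<le> s" "s \<le> 1" "0 \<le> t" "t \<le> 1"
      "p = flip (P + s * (1 - 2 * t) / 4, - ((2 - s) * t * (1 - t)), - (real i + t * (real j - real i)))"
      unfolding fence_band_def by blast
    then have "p = (6 - P + s * (1 - 2 * (1 - t)) / 4, - ((2 - s) * (1 - t) * (1 - (1 - t))),
        - (real (6 - j) + (1 - t) * (real (6 - i) - real (6 - j))))"
      using that by (simp add: flip_def of_nat_diff field_simps)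
    then show "p \<in> fence_band (6 - P) (6 - j) (6 - i)"
      unfolding fence_band_def using st
      by (intro CollectI exI[of _ s] exI[of _ "1 - t"]) auto
  qed
  have "fence_band (6 - P) (6 - j) (6 - i) = flip ` flip ` fence_band (6 - P) (6 - j) (6 - i)"
    by (simp add: image_comp comp_def flip_flip)
  also have "\<dots> \<subseteq> flip ` fence_band P i j"
    using sub[of "6 - j" "6 - i" "6 - P"] assms by (intro image_mono) simp
  finally show ?thesis using sub[OF assms] by blast
qed

text \<open>Reversing \<open>x\<close> turns the direction \<open>cis \<alpha>\<close> into
  \<open>cis (pi - \<alpha>)\<close>. The odd multiples of \<open>pi\<close> absorb full turns, so
  that the angle again starts from 0 at the top: \<open>n = 1\<close> serves the ribbon with three
  half turns.\<close>

lemma flip_ribbon: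
  assumes "\<And>z. z \<in> {-4..-2} \<Longrightarrow> c' (- 6 - z) = 6 - c z"
    and "\<And>z. z \<in> {-4..-2} \<Longrightarrow> \<beta> (- 6 - z) = (2 * real n + 1) * pi - \<alpha> z"
  shows "flip ` ribbon {-4..-2} (\<lambda>z. of_real (c z)) (\<lambda>z. cis (\<alpha> z) / 4) =
    ribbon {-4..-2} (\<lambda>z. of_real (c' z)) (\<lambda>z. cis (\<beta> z) / 4)"
proof -
  have pt: "flip (Re (of_real (c z) + of_real s * (cis (\<alpha> z) / 4)),
        Im (of_real (c z) + of_real s * (cis (\<alpha> z) / 4)), z) =
      (Re (of_real (c' (- 6 - z)) + of_real s * (cis (\<beta> (- 6 - z)) / 4)),
        Im (of_real (c' (- 6 - z)) + of_real s * (cis (\<beta> (- 6 - z)) / 4)), - 6 - z)"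
    if z: "z \<in> {-4..-2}" for s z
  proof -
    have "cos ((2 * real n + 1) * pi) = - 1" "sin ((2 * real n + 1) * pi) = 0"
      using cos_npi[of "2 * n + 1"] sin_npi[of "2 * n + 1"] by (simp_all add: add.commute)
    then have "cos ((2 * real n + 1) * pi - \<alpha> z) = - cos (\<alpha> z)"
      "sin ((2 * real n + 1) * pi - \<alpha> z) = sin (\<alpha> z)"
      by (simp_all add: cos_diff sin_diff)
    then show ?thesis using assms[OF z] by (simp add: flip_def)
  qed
  show ?thesis
  proof (intro subset_antisym subsetI)
    fix p assume "p \<in> flip ` ribbon {-4..-2} (\<lambda>z. of_real (c z)) (\<lambda>z. cis (\<alpha> z) / 4)"
    then obtain s z where sz: "\<bar>s\<bar> \<le> 1" "z \<in> {-4..-2}"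
      "p = flip (Re (of_real (c z) + of_real s * (cis (\<alpha> z) / 4)),
        Im (of_real (c z) + of_real s * (cis (\<alpha> z) / 4)), z)"
      unfolding ribbon_def by blast
    moreover have "- 6 - z \<in> {-4..-2}" using sz(2) by auto
    ultimately show "p \<in> ribbon {-4..-2} (\<lambda>z. of_real (c' z)) (\<lambda>z. cis (\<beta> z) / 4)"
      unfolding pt[OF sz(2)] ribbon_def by blast
  next
    fix p assume "p \<in> ribbon {-4..-2} (\<lambda>z. of_real (c' z)) (\<lambda>z. cis (\<beta> z) / 4)"
    then obtain s z where sz: "\<bar>s\<bar> \<le> 1" "z \<in> {-4..-2}"
      "p = (Re (of_real (c' z) + of_real s * (cis (\<beta> z) / 4)),
        Im (of_real (c' z) + of_real s * (cis (\<beta> z) / 4)), z)"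
      unfolding ribbon_def by blast
    define z' where "z' = - 6 - z"
    have z': "z' \<in> {-4..-2}" "- 6 - z' = z" using sz(2) by (auto simp: z'_def)
    have "(Re (of_real (c z') + of_real s * (cis (\<alpha> z') / 4)),
        Im (of_real (c z') + of_real s * (cis (\<alpha> z') / 4)), z') \<in>
        ribbon {-4..-2} (\<lambda>z. of_real (c z)) (\<lambda>z. cis (\<alpha> z) / 4)"
      unfolding ribbon_def using sz(1) z'(1) by blast
    from imageI[OF this, of flip]
    show "p \<in> flip ` ribbon {-4..-2} (\<lambda>z. of_real (c z)) (\<lambda>z. cis (\<alpha> z) / 4)"
      unfolding pt[OF z'(1)] z'(2) sz(3) .
  qed
qed

lemma core_flip: "core (- 6 - z) = core z"
proof -
  have "\<bar>- 6 - z + 3\<bar> = \<bar>z + 3\<bar>" by linarith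
  then show ?thesis by (simp add: core_def)
qed

lemma ramp_flip: "ramp (- 6 - z) = 2 * pi - ramp z"
proof -
  have "max 0 (min 1 ((- 11 / 4 - (- 6 - z)) * 2)) = 1 - max 0 (min 1 ((- 11 / 4 - z) * 2))"
    by (auto simp: max_def min_def)
  then show ?thesis unfolding ramp_def by (simp only: right_diff_distrib mult_1_right)
qed

lemma height_flip: "height (- 6 - z) = 1 - height z"
  by (simp add: height_def field_simps)

lemma flip_left_ribbon:
  "flip ` left_ribbon (\<lambda>z. pi * height z + ramp z) = right_ribbon (\<lambda>z. pi * height z + ramp z)"
  unfolding left_ribbon_def right_ribbon_def
  by (rule flip_ribbon[where n = 1]) (simp_all add: core_flip ramp_flip height_flip algebra_simps)

lemma flip_right_ribbon: "flip ` right_ribbon (\<lambda>z. pi * height z) = left_ribbon (\<lambda>z. pi * height z)"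
  unfolding left_ribbon_def right_ribbon_def
  by (rule flip_ribbon[where n = 0]) (simp_all add: core_flip height_flip algebra_simps)

section \<open>The two surfaces\<close>

definition fence_left :: fence where
  "fence_left = (4, [(1,2), (3,4), (2,3), (2,4), (1,2)])"

definition fence_right :: fence where
  "fence_right = (4, [(1,2), (2,4), (3,4), (2,3), (1,2)])"

definition tangle :: "point set" where
  "tangle = fence_band 3 2 3 \<union> fence_disk 5 3 \<union> fence_band 2 3 4 \<union> fence_band 4 2 4"

lemma fence_set_four:
  "fence_set (4, [(i1,j1), (i2,j2), (i3,j3), (i4,j4), (i5,j5)]) =
    fence_disk 5 1 \<union> fence_disk 5 2 \<union> fence_disk 5 3 \<union> fence_disk 5 4 \<union>
    fence_band 1 i1 j1 \<union> fence_band 2 i2 j2 \<union> fence_band 3 i3 j3 \<union> fence_band 4 i4 j4 \<union> fence_band 5 i5 j5"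
proof -
  let ?w = "[(i1,j1), (i2,j2), (i3,j3), (i4,j4), (i5,j5)]"
  have "{1..4::nat} = {1, 2, 3, 4}" "{..<5::nat} = {0, 1, 2, 3, 4}" "length ?w = 5" by auto
  then have "fence_set (4, ?w) = (\<Union>k\<in>{1, 2, 3, 4}. fence_disk 5 k) \<union>
      (\<Union>p\<in>{0, 1, 2, 3, 4}. fence_band (real p + 1) (fst (?w ! p)) (snd (?w ! p)))"
    unfolding fence_set_def fst_conv snd_conv by (simp only:)
  then show ?thesis by (simp add: Un_ac)
qed

lemma fence_set_left: "fence_set fence_left = frame \<union> fence_disk 5 4 \<union> tangle"
  unfolding fence_left_def fence_set_four frame_def tangle_def by blast

lemma fence_set_right: "fence_set fence_right = frame \<union> fence_disk 5 4 \<union> flip ` tangle"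
  unfolding fence_right_def fence_set_four frame_def tangle_def image_Un
  by (simp add: flip_disk flip_band) blast

lemma compactly_supported_flip_conj:
  assumes "compactly_supported G"
  shows "compactly_supported (flip \<circ> G \<circ> flip)"
proof (rule compactly_supported_conj[OF assms, where C = 12])
  show "continuous_on UNIV flip"
    unfolding flip_def split_def by (intro continuous_intros)
  show "norm p \<le> norm (flip p) + 12" for p
  proof -
    obtain x y z where p: "p = (x, y, z)" by (cases p)
    have "p = (6, 0, - 6) - (6 - x, - y, - 6 - z)" by (simp add: p)
    then have "norm p \<le> norm (6 :: real, 0 :: real, - 6 :: real) + norm (6 - x, - y, - 6 - z)"
      by (metis norm_triangle_ineq4)
    moreover have "norm (6 :: real, 0 :: real, - 6 :: real) \<le> 12"
      using norm_Pair_le[of "6 :: real" "(0 :: real, - 6 :: real)"]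
        norm_Pair_le[of "0 :: real" "- 6 :: real"] by simp
    ultimately show ?thesis by (simp add: flip_def p norm_Pair)
  qed
qed (rule flip_flip)

lemma frame_above: "(x, y, z) \<in> frame \<Longrightarrow> - 2 \<le> z"
  unfolding frame_def using fence_band_bounds(3)[of x y z _ 1 2] by (auto simp: fence_disk_def)

lemma fence_isotopy:
  obtains h where "compactly_supported h" "h ` fence_set fence_left = fence_set fence_right"
    "\<And>p. p \<in> fence_disk 5 1 \<Longrightarrow> h p = p"
proof -
  obtain G where G: "compactly_supported G"
    "G ` tangle = left_ribbon (\<lambda>z. pi * height z + ramp z) \<union> right_ribbon (\<lambda>z. pi * height z)"
    "G ` frame = frame" "G ` fence_disk 5 2 = fence_disk 5 2"
    "\<And>x y z. z \<le> - 4 \<or> - 7 / 4 \<le> z \<Longrightarrow> G (x, y, z) = (x, y, z)"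
    unfolding tangle_def by (rule unwind) blast
  define G' where "G' = flip \<circ> G \<circ> flip"
  have G': "compactly_supported G'" unfolding G'_def by (rule compactly_supported_flip_conj[OF G(1)])
  let ?F = "frame \<union> fence_disk 5 4"
  have "G ` fence_disk 5 4 = fence_disk 5 4"
    by (rule image_eq_self) (auto simp: fence_disk_def intro!: G(5))
  then have left: "torus_twist 1 ` G ` fence_set fence_left =
      torus_twist 1 ` ?F \<union> (torus_twist 1 ` left_ribbon (\<lambda>z. pi * height z + ramp z) \<union>
        torus_twist 1 ` right_ribbon (\<lambda>z. pi * height z))"
    by (simp only: fence_set_left image_Un G)
  have twist: "torus_twist 1 ` ?F = ?F"
  proof (rule image_eq_self)
    fix p assume "p \<in> ?F"
    moreover have "torus_twist 1 p = p" if "p \<in> frame"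
      using that by (cases p) (auto dest!: frame_above intro!: torus_twist_above)
    ultimately show "torus_twist 1 p = p" using torus_twist_bottom by blast
  qed
  have "G' ` frame = frame"
  proof (rule image_eq_self)
    fix p assume "p \<in> frame"
    then show "G' p = p"
      using flip_flip[of p] by (cases p) (auto simp: G'_def flip_def G(5) dest!: frame_above)
  qed
  moreover have "G' ` fence_disk 5 4 = fence_disk 5 4"
    unfolding G'_def by (simp only: image_comp[symmetric] flip_disk[of 4, simplified] G(4))
      (simp add: flip_disk)
  moreover have "G' ` flip ` tangle =
      right_ribbon (\<lambda>z. pi * height z + ramp z) \<union> left_ribbon (\<lambda>z. pi * height z)"
  proof -
    have "flip ` flip ` tangle = tangle" by (simp add: image_comp comp_def flip_flip)
    then show ?thesis
      unfolding G'_def by (simp only: image_comp[symmetric] G(2) image_Un flip_left_ribbon flip_right_ribbon)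
  qed
  ultimately have right: "G' ` fence_set fence_right =
      ?F \<union> (right_ribbon (\<lambda>z. pi * height z + ramp z) \<union> left_ribbon (\<lambda>z. pi * height z))"
    by (simp only: fence_set_right image_Un)
  \<comment> \<open>The twist subtracts \<open>ramp\<close> on the left and adds it on the right,
    which is the position that \<open>G'\<close> gives to the flipped tangle.\<close>
  have meet: "torus_twist 1 ` G ` fence_set fence_left = G' ` fence_set fence_right"
    unfolding left right twist torus_twist_left_ribbon torus_twist_right_ribbon by (simp add: Un_ac)
  have inj: "inj G'" using compactly_supported_bij[OF G'] by (rule bij_is_inj)
  define h where "h = inv G' \<circ> (torus_twist 1 \<circ> G)"
  have "compactly_supported h"
    unfolding h_def
    by (intro compactly_supported_comp compactly_supported_inv G' G(1) compactly_supported_torus_twist)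
  moreover have "h ` fence_set fence_left = fence_set fence_right"
    unfolding h_def image_comp[symmetric] meet by (simp add: image_inv_f_f inj)
  moreover have "h p = p" if p: "p \<in> fence_disk 5 1" for p
  proof -
    obtain x y where xy: "p = (x, y, - 1)" using p by (auto simp: fence_disk_def)
    have "G' p = p" by (simp add: xy G'_def flip_def G(5))
    then have "inv G' p = p" using inv_f_f[OF inj, of p] by simp
    then show ?thesis by (simp add: h_def xy G(5) torus_twist_above)
  qed
  ultimately show ?thesis by (rule that)
qed

lemma fence_left_right_connected:
  assumes "D \<in> {fence_left, fence_right}" "k \<in> {1..fst D}"
  shows "disk_isotopic (fence_set D) (std_disk 5 1) (std_disk 5 k)"
proof -
  obtain w where D: "D = (4, w)" "length w = 5" "(1, 2) \<in> set w" "(2, 3) \<in> set w" "(3, 4) \<in> set w"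
    and diag: "fence_diagram (4, w)"
    using assms(1) by (auto simp: fence_left_def fence_right_def fence_diagram_def)
  note band = std_disk_isotopic_band[OF diag, unfolded D(2), folded D(1)]
  note d = band[OF D(3)] band[OF D(4)] band[OF D(5)]
  have "k = 1 \<or> k = 2 \<or> k = 3 \<or> k = 4" using assms(2) D(1) by auto
  then show ?thesis
    using d disk_isotopic_trans disk_isotopic_sym by metis
qed

lemma fence_diagrams: "fence_diagram fence_left" "fence_diagram fence_right"
  by (auto simp: fence_left_def fence_right_def fence_diagram_def)

lemma fence_surfaces_isotopic:
  "ambient_isotopic (fence_surface fence_left) (fence_surface fence_left)"
  "ambient_isotopic (fence_surface fence_left) (fence_surface fence_right)"
proof -
  have dims: "length (snd fence_left) = 5" "length (snd fence_right) = 5"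
    "1 \<le> fst fence_left" "1 \<le> fst fence_right"
    by (simp_all add: fence_left_def fence_right_def)
  have con: "\<And>k. k \<in> {1..fst fence_left} \<Longrightarrow> disk_isotopic (fence_set fence_left) (std_disk 5 1) (std_disk 5 k)"
    "\<And>k. k \<in> {1..fst fence_right} \<Longrightarrow> disk_isotopic (fence_set fence_right) (std_disk 5 1) (std_disk 5 k)"
    by (rule fence_left_right_connected; simp)+
  obtain h where h: "compactly_supported h" "h ` fence_set fence_left = fence_set fence_right"
    "\<And>p. p \<in> fence_disk 5 1 \<Longrightarrow> h p = p"
    using fence_isotopy by metis
  show "ambient_isotopic (fence_surface fence_left) (fence_surface fence_right)"
    by (rule ambient_isotopic_fences[OF h dims con])
  show "ambient_isotopic (fence_surface fence_left) (fence_surface fence_left)"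
    by (rule ambient_isotopic_fences[OF compactly_supported_id _ _ dims(1,1,3,3) con(1,1)]) simp_all
qed

section \<open>A self-linking form invariant under the moves\<close>

declare One_nat_def [simp del]

definition swap_label :: "nat \<times> nat \<Rightarrow> (nat \<Rightarrow> int) \<Rightarrow> nat \<Rightarrow> int" where
  "swap_label = (\<lambda>(i, j) s. s(i := s j, j := s i))"

definition letter_weight :: "nat \<times> nat \<Rightarrow> (nat \<Rightarrow> int) \<Rightarrow> int" where
  "letter_weight = (\<lambda>(i, j) s. s i * s j + (s i - s j) * sum s {i<..<j})"

fun carry :: "(nat \<times> nat) list \<Rightarrow> (nat \<Rightarrow> int) \<Rightarrow> nat \<Rightarrow> int" where
  "carry [] s = s"
| "carry (a # w) s = carry w (swap_label a s)"

fun word_weight :: "(nat \<times> nat) list \<Rightarrow> (nat \<Rightarrow> int) \<Rightarrow> int" where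
  "word_weight [] s = 0"
| "word_weight (a # w) s = letter_weight a s + word_weight w (swap_label a s)"

text \<open>The entry \<open>s k\<close> is the weight of the component through the strand \<open>k\<close> of the boundary braid. In the
  braid of a letter \<open>(i, j)\<close> the strands \<open>i\<close> and \<open>j\<close> cross positively and are exchanged, while the strand
  \<open>i\<close> crosses the strands in between positively and \<open>j\<close> crosses them negatively.\<close>

definition attains :: "fence \<Rightarrow> int \<Rightarrow> bool" where
  "attains D n \<longleftrightarrow>
     (\<exists>s. carry (snd D) s = s \<and> word_weight (snd D) s - (\<Sum>k\<in>{1..fst D}. (s k)\<^sup>2) = n)"

lemma carry_append: "carry (u @ v) s = carry v (carry u s)"
  by (induction u arbitrary: s) auto

lemma word_weight_append: "word_weight (u @ v) s = word_weight u s + word_weight v (carry u s)"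
  by (induction u arbitrary: s) auto

lemma sum_swap_label:
  assumes "finite A" "i \<in> A \<longleftrightarrow> j \<in> A"
  shows "(\<Sum>k\<in>A. f (swap_label (i, j) s k)) = (\<Sum>k\<in>A. f (s k))"
proof -
  have *: "swap_label (i, j) s = s \<circ> Transposition.transpose i j"
    by (auto simp: swap_label_def fun_eq_iff Transposition.transpose_def)
  have "bij_betw (Transposition.transpose i j) A A"
    using assms(2) by (intro bij_betwI[where g = "Transposition.transpose i j"])
      (auto simp: Transposition.transpose_def)
  then show ?thesis
    unfolding * using sum.reindex_bij_betw[of "Transposition.transpose i j" A A "\<lambda>k. f (s k)"] by simp
qed

section \<open>Slips, slides and turns\<close>

lemma attains_replace:
  assumes "\<And>s. carry w s = carry w' s" "\<And>s. word_weight w s = word_weight w' s"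
  shows "attains (b, u @ w @ v) n \<longleftrightarrow> attains (b, u @ w' @ v) n"
  by (simp add: attains_def carry_append word_weight_append assms)

text \<open>Disjoint or nested intervals contain both endpoints of the other letter or neither, so
  its exchange of labels does not affect the sum over the strands in between.\<close>

lemma attains_slip:
  assumes "slip D D'" "fence_diagram D"
  shows "attains D n \<longleftrightarrow> attains D' n"
  using assms
proof (induction rule: slip.induct)
  case (1 i j k l b u v)
  then have le: "i < j" "k < l" by (auto simp: fence_diagram_def)
  have "carry [(i, j), (k, l)] s = carry [(k, l), (i, j)] s" for s
    using 1(1) by (auto simp: swap_label_def fun_eq_iff)
  moreover have "word_weight [(i, j), (k, l)] s = word_weight [(k, l), (i, j)] s" for s
  proof -
    have "k \<in> {i<..<j} \<longleftrightarrow> l \<in> {i<..<j}" "i \<in> {k<..<l} \<longleftrightarrow> j \<in> {k<..<l}"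
    proof -
      from 1(2) have "j < k \<or> l < i \<or> (k \<le> i \<and> j \<le> l) \<or> (i \<le> k \<and> l \<le> j)"
      proof (elim disjE)
        assume e: "{i..j} \<inter> {k..l} = {}"
        show ?thesis
        proof (rule ccontr)
          assume "\<not> ?thesis"
          then have "max i k \<in> {i..j} \<inter> {k..l}" using le by auto
          then show False using e by blast
        qed
      qed (use le in auto)
      then show "k \<in> {i<..<j} \<longleftrightarrow> l \<in> {i<..<j}" "i \<in> {k<..<l} \<longleftrightarrow> j \<in> {k<..<l}"
        using 1(1) le by auto
    qed
    then have "sum (swap_label (k, l) s) {i<..<j} = sum s {i<..<j}"
      "sum (swap_label (i, j) s) {k<..<l} = sum s {k<..<l}"
      using sum_swap_label[of _ _ _ "\<lambda>x. x"] by auto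
    moreover have "swap_label (k, l) s i = s i" "swap_label (k, l) s j = s j"
      "swap_label (i, j) s k = s k" "swap_label (i, j) s l = s l"
      using 1(1) by (auto simp: swap_label_def)
    ultimately show ?thesis
      by (simp add: letter_weight_def)
  qed
  ultimately show ?case by (rule attains_replace)
qed

lemma sum_greaterThanLessThan_split:
  fixes s :: "nat \<Rightarrow> int"
  assumes "i < j" "j < k"
  shows "sum s {i<..<k} = sum s {i<..<j} + s j + sum s {j<..<k}"
proof -
  have "{i<..<k} = {i<..<j} \<union> ({j} \<union> {j<..<k})" using assms by auto
  also have "sum s \<dots> = sum s {i<..<j} + sum s ({j} \<union> {j<..<k})"
    by (rule sum.union_disjoint) auto
  finally show ?thesis by simp
qed

text \<open>The words are equal as braids, and the weights agree for every labelling of the strands,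
  closed up or not.\<close>

lemma attains_slide:
  assumes "slide D D'"
  shows "attains D n \<longleftrightarrow> attains D' n"
proof -
  have r: "sum (s(x := a, y := c)) A = sum s A" if "x \<notin> A" "y \<notin> A"
    for s :: "nat \<Rightarrow> int" and x y a c A
    using that by (intro sum.cong) auto
  show ?thesis using assms
  proof (induction rule: slide.induct)
    case (1 i j k b u v)
    show ?case
    proof (rule attains_replace)
      fix s
      show "carry [(i, j), (j, k)] s = carry [(i, k), (i, j)] s"
        using 1 by (auto simp: swap_label_def fun_eq_iff)
      show "word_weight [(i, j), (j, k)] s = word_weight [(i, k), (i, j)] s"
        using 1 by (simp add: swap_label_def letter_weight_def r sum_greaterThanLessThan_split[OF 1])
          (simp add: algebra_simps)
    qed
  next
    case (2 i j k b u v)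
    show ?case
    proof (rule attains_replace)
      fix s
      show "carry [(i, j), (j, k)] s = carry [(j, k), (i, k)] s"
        using 2 by (auto simp: swap_label_def fun_eq_iff)
      show "word_weight [(i, j), (j, k)] s = word_weight [(j, k), (i, k)] s"
        using 2 by (simp add: swap_label_def letter_weight_def r sum_greaterThanLessThan_split[OF 2])
          (simp add: algebra_simps)
    qed
  qed
qed

lemma sum_squares_carry:
  assumes "\<forall>(i, j) \<in> set w. 1 \<le> i \<and> i < j \<and> j \<le> b"
  shows "(\<Sum>k\<in>{1..b}. f (carry w s k)) = (\<Sum>k\<in>{1..b}. f (s k))"
  using assms
proof (induction w arbitrary: s)
  case (Cons a w)
  obtain i j where a: "a = (i, j)" by force
  have "(\<Sum>k\<in>{1..b}. f (swap_label (i, j) s k)) = (\<Sum>k\<in>{1..b}. f (s k))"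
    using Cons.prems a by (intro sum_swap_label) auto
  with Cons a show ?case by auto
qed simp

text \<open>The same labelling of the closure, read one letter later or earlier.\<close>

lemma attains_turn:
  assumes "turn D D'" "fence_diagram D"
  shows "attains D n \<longleftrightarrow> attains D' n"
  using assms
proof (induction rule: turn.induct)
  case (1 b a w)
  have sq: "(\<Sum>k\<in>{1..b}. (swap_label a s k)\<^sup>2) = (\<Sum>k\<in>{1..b}. (s k)\<^sup>2)" for s
    using sum_squares_carry[of "[a]" b "\<lambda>x. x\<^sup>2" s] 1 by (auto simp: fence_diagram_def)
  have sqw: "(\<Sum>k\<in>{1..b}. (carry w s k)\<^sup>2) = (\<Sum>k\<in>{1..b}. (s k)\<^sup>2)" for s
    using sum_squares_carry[of w b "\<lambda>x. x\<^sup>2" s] 1 by (auto simp: fence_diagram_def)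
  show ?case
  proof
    assume "attains (b, a # w) n"
    then obtain s where s: "carry w (swap_label a s) = s"
      "letter_weight a s + word_weight w (swap_label a s) - (\<Sum>k\<in>{1..b}. (s k)\<^sup>2) = n"
      by (auto simp: attains_def)
    then show "attains (b, w @ [a]) n" unfolding attains_def
      by (intro exI[of _ "swap_label a s"]) (simp add: carry_append word_weight_append sq)
  next
    assume "attains (b, w @ [a]) n"
    then obtain s where s: "swap_label a (carry w s) = s"
      "word_weight w s + letter_weight a (carry w s) - (\<Sum>k\<in>{1..b}. (s k)\<^sup>2) = n"
      by (auto simp: attains_def carry_append word_weight_append)
    then show "attains (b, a # w) n" unfolding attains_def
      by (intro exI[of _ "carry w s"]) (simp add: sqw)
  qed
qed

section \<open>Twirls\<close>

definition cycle_line :: "nat \<Rightarrow> nat \<Rightarrow> nat" where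
  "cycle_line b k = (if k = b then 1 else if 1 \<le> k \<and> k < b then k + 1 else k)"

lemma bij_cycle_line: "1 \<le> b \<Longrightarrow> bij (cycle_line b)"
  by (rule o_bij[where g = "\<lambda>k. if k = 1 then b else if 2 \<le> k \<and> k \<le> b then k - 1 else k"])
    (auto simp: fun_eq_iff cycle_line_def)

text \<open>Labels are pulled back: line \<open>k\<close> after the twirl was line
  \<open>cycle_line b k\<close> before it.\<close>

definition cycle_label :: "nat \<Rightarrow> (nat \<Rightarrow> int) \<Rightarrow> nat \<Rightarrow> int" where
  "cycle_label b s = s \<circ> cycle_line b"

lemma bij_cycle_label:
  assumes "1 \<le> b"
  shows "bij (cycle_label b)"
proof -
  obtain g where g: "g \<circ> cycle_line b = id" "cycle_line b \<circ> g = id"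
    using bij_cycle_line[OF assms] bij_imp_bij_inv by (metis bij_is_inj bij_is_surj inv_o_cancel surj_iff)
  show ?thesis
    by (rule o_bij[where g = "\<lambda>s. s \<circ> g"]) (simp_all add: fun_eq_iff cycle_label_def g o_assoc[symmetric] comp_assoc)
qed

lemma swap_label_sym: "swap_label (i, j) s = swap_label (j, i) s"
  by (auto simp: swap_label_def fun_eq_iff)

lemma swap_label_comp:
  "inj f \<Longrightarrow> swap_label (f i, f j) s \<circ> f = swap_label (i, j) (s \<circ> f)"
  by (auto simp: swap_label_def fun_eq_iff inj_eq)

lemma sum_cycle_label:
  assumes "1 \<le> b"
  shows "(\<Sum>k\<in>{1..b}. f (cycle_label b s k)) = (\<Sum>k\<in>{1..b}. f (s k))"
proof -
  have "bij_betw (cycle_line b) {1..b} {1..b}"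
    using assms
    by (intro bij_betwI[where g = "\<lambda>k. if k = 1 then b else k - 1"]) (auto simp: cycle_line_def)
  then show ?thesis
    using sum.reindex_bij_betw[of "cycle_line b" "{1..b}" "{1..b}" "\<lambda>k. f (s k)"]
    by (simp add: cycle_label_def)
qed

text \<open>The weight changes by \<open>F s - F s'\<close>, where \<open>s'\<close> is the
  labelling after the letter and \<open>F s\<close> is the total label sum times \<open>s 1\<close>,
  minus \<open>(s 1)\<^sup>2\<close>. The total is the same for \<open>s\<close> and
  \<open>s'\<close>, so over a word these differences telescope and vanish for a closed
  labelling.\<close>

lemma twirl_letter:
  assumes "1 \<le> i" "i < j" "j \<le> b"
  shows "cycle_label b (swap_label (i, j) s) = swap_label (twirl_segment b (i, j)) (cycle_label b s)"
    and "letter_weight (i, j) s - letter_weight (twirl_segment b (i, j)) (cycle_label b s) =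
      (\<Sum>k\<in>{1..b}. s k) * (s 1 - swap_label (i, j) s 1) - ((s 1)\<^sup>2 - (swap_label (i, j) s 1)\<^sup>2)"
proof -
  have inj: "inj (cycle_line b)" using bij_is_inj[OF bij_cycle_line] assms by simp
  show "cycle_label b (swap_label (i, j) s) = swap_label (twirl_segment b (i, j)) (cycle_label b s)"
  proof (cases "i = 1")
    case True
    then have "cycle_line b b = i" "cycle_line b (j - 1) = j" using assms by (auto simp: cycle_line_def)
    then show ?thesis
      using swap_label_comp[OF inj, of b "j - 1" s] True
      by (simp add: twirl_segment_def cycle_label_def swap_label_sym[of b])
  next
    case False
    then have "cycle_line b (i - 1) = i" "cycle_line b (j - 1) = j" using assms by (auto simp: cycle_line_def)
    then show ?thesis
      using swap_label_comp[OF inj, of "i - 1" "j - 1" s] False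
      by (simp add: twirl_segment_def cycle_label_def)
  qed
  have shift: "sum (cycle_label b s) {x - 1<..<y - 1} = sum s {x<..<y}"
    if "1 \<le> x" "y \<le> b + 1" for x y
  proof -
    have "sum (cycle_label b s) {x - 1<..<y - 1} = (\<Sum>k\<in>{x..<y - 1}. s (k + 1))"
      using that by (intro sum.cong) (auto simp: cycle_label_def cycle_line_def)
    also have "\<dots> = (\<Sum>k\<in>{x + 1..<y - 1 + 1}. s k)"
      using sum.shift_bounds_nat_ivl[of s x 1 "y - 1"] by simp
    also have "{x + 1..<y - 1 + 1} = {x<..<y}" using that by auto
    finally show ?thesis .
  qed
  show "letter_weight (i, j) s - letter_weight (twirl_segment b (i, j)) (cycle_label b s) =
      (\<Sum>k\<in>{1..b}. s k) * (s 1 - swap_label (i, j) s 1) - ((s 1)\<^sup>2 - (swap_label (i, j) s 1)\<^sup>2)"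
  proof (cases "i = 1")
    case True
    have c: "cycle_label b s (j - 1) = s j" "cycle_label b s b = s 1"
      using assms True by (auto simp: cycle_label_def cycle_line_def)
    have n: "sum (cycle_label b s) {j - 1<..<b} = sum s {j<..<b + 1}"
      using shift[of j "b + 1"] assms by simp
    have "{1..b} = {0<..<b + 1}" "{0<..<1::nat} = {}" by auto
    then have S: "sum s {1..b} = s 1 + (sum s {1<..<j} + (s j + sum s {j<..<b + 1}))"
      using assms True sum_greaterThanLessThan_split[of 0 1 "b + 1" s]
        sum_greaterThanLessThan_split[of 1 j "b + 1" s]
      by simp
    show ?thesis
      using True assms
      by (simp add: letter_weight_def twirl_segment_def c n S swap_label_def)
        (simp add: algebra_simps power2_eq_square)
  next
    case False
    then have "cycle_label b s (j - 1) = s j" "cycle_label b s (i - 1) = s i"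
      using assms by (auto simp: cycle_label_def cycle_line_def)
    moreover have "sum (cycle_label b s) {i - 1<..<j - 1} = sum s {i<..<j}"
      using assms by (intro shift) auto
    ultimately show ?thesis
      using False assms by (simp add: letter_weight_def twirl_segment_def swap_label_def)
  qed
qed

lemma twirl_word:
  assumes "\<forall>(i, j) \<in> set w. 1 \<le> i \<and> i < j \<and> j \<le> b"
  shows "carry (map (twirl_segment b) w) (cycle_label b s) = cycle_label b (carry w s) \<and>
    word_weight w s - word_weight (map (twirl_segment b) w) (cycle_label b s) =
      (\<Sum>k\<in>{1..b}. s k) * (s 1 - carry w s 1) - ((s 1)\<^sup>2 - (carry w s 1)\<^sup>2)"
  using assms
proof (induction w arbitrary: s)
  case (Cons a w)
  obtain i j where a: "a = (i, j)" by force
  have ij: "1 \<le> i" "i < j" "j \<le> b" using Cons.prems a by auto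
  have "(\<Sum>k\<in>{1..b}. swap_label a s k) = (\<Sum>k\<in>{1..b}. s k)"
    using sum_squares_carry[of "[a]" b "\<lambda>x. x" s] ij a by auto
  moreover have IH: "carry (map (twirl_segment b) w) (cycle_label b (swap_label a s)) =
      cycle_label b (carry w (swap_label a s)) \<and>
    word_weight w (swap_label a s) -
      word_weight (map (twirl_segment b) w) (cycle_label b (swap_label a s)) =
      (\<Sum>k\<in>{1..b}. swap_label a s k) * (swap_label a s 1 - carry w (swap_label a s) 1) -
      ((swap_label a s 1)\<^sup>2 - (carry w (swap_label a s) 1)\<^sup>2)"
    using Cons by auto
  ultimately show ?case
    using twirl_letter[OF ij, of s] a by (simp add: algebra_simps)
qed auto

lemma attains_twirl:
  assumes "twirl D D'" "fence_diagram D"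
  shows "attains D n \<longleftrightarrow> attains D' n"
  using assms
proof (induction rule: twirl.induct)
  case (1 b w)
  then have b: "1 \<le> b" and w: "\<forall>(i, j) \<in> set w. 1 \<le> i \<and> i < j \<and> j \<le> b"
    by (auto simp: fence_diagram_def)
  let ?w = "map (twirl_segment b) w"
  have inj: "cycle_label b x = cycle_label b y \<longleftrightarrow> x = y" for x y
    using bij_cycle_label[OF b] by (auto simp: bij_def inj_def)
  have *: "(carry ?w (cycle_label b s) = cycle_label b s \<and>
      word_weight ?w (cycle_label b s) - (\<Sum>k\<in>{1..b}. (cycle_label b s k)\<^sup>2) = n) \<longleftrightarrow>
      (carry w s = s \<and> word_weight w s - (\<Sum>k\<in>{1..b}. (s k)\<^sup>2) = n)" for s
    using twirl_word[OF w, of s] sum_cycle_label[OF b, of "\<lambda>x. x\<^sup>2" s] inj[of "carry w s" s]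
    by auto
  have ex: "(\<exists>s. P s) \<longleftrightarrow> (\<exists>s. P (cycle_label b s))" for P
  proof
    assume "\<exists>s. P s"
    then obtain s where "P s" ..
    moreover obtain s' where "s = cycle_label b s'"
      using bij_is_surj[OF bij_cycle_label[OF b]] by (rule surjE)
    ultimately show "\<exists>s. P (cycle_label b s)" by auto
  qed auto
  show ?case unfolding attains_def fst_conv snd_conv
    by (subst (2) ex) (simp only: *)
qed

section \<open>Inflations\<close>

definition extend_label :: "nat \<Rightarrow> int \<Rightarrow> (nat \<Rightarrow> int) \<Rightarrow> nat \<Rightarrow> int" where
  "extend_label h t s k = (if k < h then s k else if k = h then t else s (k - 1))"

lemma extend_label_shift [simp]: "extend_label h t s (shift_line h k) = s k"
  by (auto simp: extend_label_def shift_line_def)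

lemma extend_label_self [simp]: "extend_label h t s h = t"
  by (simp add: extend_label_def)

lemma shift_line_neq [simp]: "shift_line h k \<noteq> h" "h \<noteq> shift_line h k"
  by (auto simp: shift_line_def)

lemma inj_shift_line: "inj (shift_line h)"
  by (auto simp: inj_def shift_line_def split: if_splits)

lemma shift_line_cases: obtains "k = h" | i where "k = shift_line h i"
proof (cases k h rule: linorder_cases)
  case less then show ?thesis using that(2)[of k] by (auto simp: shift_line_def)
next
  case greater then show ?thesis using that(2)[of "k - 1"] by (auto simp: shift_line_def)
qed (use that in auto)

lemma label_eq_extend: "s = extend_label h (s h) (s \<circ> shift_line h)"
proof
  fix k show "s k = extend_label h (s h) (s \<circ> shift_line h) k"
    by (cases k rule: shift_line_cases[where h = h]) auto
qed

lemma extend_label_inject [simp]: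
  "extend_label h t s = extend_label h t' s' \<longleftrightarrow> t = t' \<and> s = s'"
proof
  assume e: "extend_label h t s = extend_label h t' s'"
  have "s k = s' k" for k
    using fun_cong[OF e, of "shift_line h k"] by simp
  then show "t = t' \<and> s = s'"
    using fun_cong[OF e, of h] by auto
qed auto

lemma sum_extend_label:
  assumes "h \<in> {1..b + 1}"
  shows "(\<Sum>k\<in>{1..b + 1}. f (extend_label h t s k)) = f t + (\<Sum>k\<in>{1..b}. f (s k))"
proof -
  have "{1..b + 1} = insert h (shift_line h ` {1..b})"
  proof (intro subset_antisym subsetI)
    fix k assume "k \<in> {1..b + 1}"
    then show "k \<in> insert h (shift_line h ` {1..b})"
      using assms by (cases k rule: shift_line_cases[where h = h])
        (auto simp: shift_line_def split: if_splits)
  qed (use assms in \<open>auto simp: shift_line_def\<close>)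
  moreover have "h \<notin> shift_line h ` {1..b}" by auto
  ultimately show ?thesis
    by (simp add: sum.reindex[OF inj_on_subset[OF inj_shift_line subset_UNIV]])
qed

text \<open>Crossings with the inserted strand again contribute a difference, now of
  \<open>t\<close> times the sum of the labels above line \<open>h\<close>, so they too telescope
  along a word.\<close>

lemma extend_letter:
  assumes "1 \<le> i" "i < j" "1 \<le> h"
  defines "a \<equiv> map_prod (shift_line h) (shift_line h) (i, j)"
  shows "swap_label a (extend_label h t s) = extend_label h t (swap_label (i, j) s)"
    and "letter_weight a (extend_label h t s) = letter_weight (i, j) s +
      t * (sum s {1..<h} - sum (swap_label (i, j) s) {1..<h})"
proof -
  let ?\<sigma> = "shift_line h"
  show "swap_label a (extend_label h t s) = extend_label h t (swap_label (i, j) s)"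
  proof
    fix k show "swap_label a (extend_label h t s) k = extend_label h t (swap_label (i, j) s) k"
      using inj_shift_line[of h] by (cases k rule: shift_line_cases[where h = h])
       (auto simp: a_def swap_label_def inj_def)
  qed
  have d: "sum s {1..<h} - sum (swap_label (i, j) s) {1..<h} = (if i < h \<and> h \<le> j then s i - s j else 0)"
  proof (cases "i < h \<and> h \<le> j")
    case True
    then have "sum f {1..<h} = f i + sum f ({1..<h} - {i})" for f :: "nat \<Rightarrow> int"
      using assms by (intro sum.remove) auto
    moreover have "sum (swap_label (i, j) s) ({1..<h} - {i}) = sum s ({1..<h} - {i})"
      using True by (intro sum.cong) (auto simp: swap_label_def)
    moreover have "swap_label (i, j) s i = s j" using assms by (simp add: swap_label_def)
    ultimately show ?thesis using True by simp
  next
    case False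
    then have "i \<in> {1..<h} \<longleftrightarrow> j \<in> {1..<h}" using assms by auto
    then show ?thesis using sum_swap_label[of "{1..<h}" i j "\<lambda>x. x" s] False by auto
  qed
  have m: "sum (extend_label h t s) {?\<sigma> i<..<?\<sigma> j} = sum s {i<..<j} + (if i < h \<and> h \<le> j then t else 0)"
  proof -
    have "{?\<sigma> i<..<?\<sigma> j} = ?\<sigma> ` {i<..<j} \<union> (if i < h \<and> h \<le> j then {h} else {})"
    proof (intro subset_antisym subsetI)
      fix k assume k: "k \<in> {?\<sigma> i<..<?\<sigma> j}"
      show "k \<in> ?\<sigma> ` {i<..<j} \<union> (if i < h \<and> h \<le> j then {h} else {})"
      proof (cases k rule: shift_line_cases[where h = h])
        case 1 with k show ?thesis by (auto simp: shift_line_def split: if_splits)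
      next
        case (2 l)
        with k have "l \<in> {i<..<j}" by (auto simp: shift_line_def split: if_splits)
        with 2 show ?thesis by auto
      qed
    qed (use assms in \<open>auto simp: shift_line_def split: if_splits\<close>)
    moreover have "h \<notin> ?\<sigma> ` {i<..<j}" by auto
    moreover have "sum (extend_label h t s) (?\<sigma> ` {i<..<j}) = sum s {i<..<j}"
      by (simp add: sum.reindex[OF inj_on_subset[OF inj_shift_line subset_UNIV]])
    ultimately show ?thesis by auto
  qed
  show "letter_weight a (extend_label h t s) = letter_weight (i, j) s +
      t * (sum s {1..<h} - sum (swap_label (i, j) s) {1..<h})"
    unfolding d letter_weight_def a_def map_prod_simp prod.case m extend_label_shift
    by (simp add: algebra_simps)
qed

lemma extend_word:
  assumes "\<forall>(i, j) \<in> set w. 1 \<le> i \<and> i < j" "1 \<le> h"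
  defines "w' \<equiv> map (map_prod (shift_line h) (shift_line h)) w"
  shows "carry w' (extend_label h t s) = extend_label h t (carry w s) \<and>
    word_weight w' (extend_label h t s) =
      word_weight w s + t * (sum s {1..<h} - sum (carry w s) {1..<h})"
  using assms(1) unfolding w'_def
proof (induction w arbitrary: s)
  case (Cons a w)
  obtain i j where a: "a = (i, j)" by force
  have ij: "1 \<le> i" "i < j" using Cons.prems a by auto
  show ?case
    using Cons extend_letter[OF ij assms(2), of t s] a by (auto simp: algebra_simps)
qed auto

text \<open>Closed labellings correspond: the label of the new line is forced to be the one that
  line \<open>k\<close> carries at the new letter.\<close>

lemma attains_inflation:
  assumes "inflation D D'" "fence_diagram D"
  shows "attains D n \<longleftrightarrow> attains D' n"
  using assms
proof (induction rule: inflation.induct)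
  case (1 h b k k' w' u v)
  let ?\<sigma> = "map_prod (shift_line h) (shift_line h)"
  let ?a = "(min h k', max h k')"
  have h: "1 \<le> h" and hb: "h \<in> {1..b + 1}" using 1 by auto
  have u: "\<forall>(i, j) \<in> set u. 1 \<le> i \<and> i < j" and v: "\<forall>(i, j) \<in> set v. 1 \<le> i \<and> i < j"
    using 1 by (auto simp: fence_diagram_def)
  have sw: "swap_label ?a (extend_label h t s) h = s k" for t s
    using 1 by (auto simp: swap_label_def min_def max_def)
  have sw': "swap_label ?a (extend_label h t s) = extend_label h t s" if "s k = t" for t s
    using 1 that by (auto simp: swap_label_def min_def max_def fun_eq_iff)
  \<comment> \<open>With equal labels the contributions of the strands in between cancel. The
    remaining \<open>t\<^sup>2\<close> makes up for the extra strand in the sum of squares.\<close>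
  have lw: "letter_weight ?a (extend_label h t s) = t\<^sup>2" if "s k = t" for t s
    using 1 that by (auto simp: letter_weight_def min_def max_def power2_eq_square)
  have car: "carry w' (extend_label h t s) = extend_label h t (carry (u @ v) s)"
    if "carry u s k = t" for t s
    using 1(4) that extend_word[OF u h, of t s] extend_word[OF v h, of t "carry u s"]
    by (simp add: carry_append sw')
  have tot: "word_weight w' (extend_label h t s) - (\<Sum>k\<in>{1..b + 1}. (extend_label h t s k)\<^sup>2) =
      word_weight (u @ v) s - (\<Sum>k\<in>{1..b}. (s k)\<^sup>2)"
    if "carry u s k = t" "carry (u @ v) s = s" for t s
    using 1(4) that extend_word[OF u h, of t s] extend_word[OF v h, of t "carry u s"]
    unfolding sum_extend_label[OF hb, of "\<lambda>x. x\<^sup>2"]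
    by (simp add: carry_append word_weight_append sw' lw algebra_simps)
  show ?case
  proof
    assume "attains (b, u @ v) n"
    then obtain s where "carry (u @ v) s = s"
      "word_weight (u @ v) s - (\<Sum>k\<in>{1..b}. (s k)\<^sup>2) = n" by (auto simp: attains_def)
    then show "attains (b + 1, w') n" unfolding attains_def
      using car[of s] tot[of s] by (intro exI[of _ "extend_label h (carry u s k) s"]) auto
  next
    assume "attains (b + 1, w') n"
    then obtain s' where s': "carry w' s' = s'"
      "word_weight w' s' - (\<Sum>k\<in>{1..b + 1}. (s' k)\<^sup>2) = n" by (auto simp: attains_def)
    define t s where "t = s' h" and "s = s' \<circ> shift_line h"
    have es: "s' = extend_label h t s" unfolding t_def s_def by (rule label_eq_extend)
    obtain t' s'' where e2: "swap_label ?a (extend_label h t (carry u s)) = extend_label h t' s''"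
      using label_eq_extend[of "swap_label ?a (extend_label h t (carry u s))" h] by (rule that)
    \<comment> \<open>Line \<open>h\<close> changes its label only at the new letter, receiving that
      of line \<open>k\<close>; closedness then forces \<open>t = carry u s k\<close>.\<close>
    have "t' = carry u s k" using arg_cong[OF e2, of "\<lambda>f. f h"] by (simp add: sw)
    moreover have "carry w' s' = extend_label h t' (carry v s'')"
      using 1(4) extend_word[OF u h, of t s] extend_word[OF v h, of t' s''] e2 es
      by (simp add: carry_append)
    ultimately have t: "carry u s k = t" using s' es by simp
    then have "carry (u @ v) s = s" using car[of s t] s' es by simp
    then show "attains (b, u @ v) n" using tot[of s t] t s' es unfolding attains_def by auto
  qed
qed

lemma attains_fence_move: "fence_move D D' \<Longrightarrow> attains D n \<longleftrightarrow> attains D' n"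
  unfolding fence_move_def
  using attains_inflation attains_slip attains_slide attains_twirl attains_turn by blast

lemma attains_move_equivalent:
  assumes "move_equivalent D D'"
  shows "attains D n \<longleftrightarrow> attains D' n"
  using assms unfolding move_equivalent_def
  by (induction rule: equivclp_induct) (simp, metis attains_fence_move)

section \<open>Values of the two forms\<close>

lemma greaterThanLessThan_Suc_numeral: "{2<..<4::nat} = {3}" "{n<..<Suc n} = {}" "{1<..<2::nat} = {}"
  "{2<..<3::nat} = {}" "{3<..<4::nat} = {}"
  by auto

lemma atLeastAtMost_1_4: "{1..4::nat} = {1, 2, 3, 4}"
  by auto

text \<open>In both links one component links the other two, once and twice, and these two are
  unlinked. The self-linking number -3 belongs to that common component on the left, and to the one
  linked twice with it on the right.\<close>

lemma not_move_equivalent: "\<not> move_equivalent fence_left fence_right"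
proof
  assume "move_equivalent fence_left fence_right"
  moreover have "attains fence_left (- 2)"
    unfolding attains_def fence_left_def fst_conv snd_conv
    \<comment> \<open>The strands 2 and 4 are the two unlinked components, each of self-linking
      number -1.\<close>
    by (intro exI[of _ "\<lambda>k. if k = 2 \<or> k = 4 then 1 else 0"])
      (simp add: swap_label_def letter_weight_def fun_eq_iff atLeastAtMost_1_4
        greaterThanLessThan_Suc_numeral)
  ultimately have "attains fence_right (- 2)"
    using attains_move_equivalent by blast
  then obtain s where c: "carry (snd fence_right) s = s"
    and n: "word_weight (snd fence_right) s - (\<Sum>k\<in>{1..4}. (s k)\<^sup>2) = - 2"
    by (auto simp: attains_def fence_right_def)
  have "s 3 = s 4"
    using fun_cong[OF c, of 3] fun_cong[OF c, of 4] by (auto simp: fence_right_def swap_label_def)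
  \<comment> \<open>Modulo 4 the form is a difference of two squares, and such a difference is never
    2.\<close>
  then have "- 2 = (s 4 * s 4 - (s 1 - s 2)\<^sup>2) + 4 * (s 1 * s 4 - s 4 * s 4)"
    using n by (simp add: fence_right_def swap_label_def letter_weight_def atLeastAtMost_1_4
        greaterThanLessThan_Suc_numeral power2_eq_square algebra_simps)
  then have e: "(s 1 - s 2)\<^sup>2 = (s 4)\<^sup>2 + 2 + 4 * (s 1 * s 4 - s 4 * s 4)"
    by (simp add: power2_eq_square)
  have sq: "x\<^sup>2 mod 4 = 0 \<or> x\<^sup>2 mod 4 = 1" for x :: int
  proof (cases "even x")
    case True
    then obtain y where "x = 2 * y" by blast
    then show ?thesis by (simp add: power2_eq_square)
  next
    case False
    then obtain y where "x = 2 * y + 1" by (elim oddE)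
    then have "x\<^sup>2 = 4 * (y * y + y) + 1" by (simp add: power2_eq_square algebra_simps)
    then show ?thesis by presburger
  qed
  show False
    using sq[of "s 4"] sq[of "s 1 - s 2"] using e by presburger
qed

theorem corollary6p4:
  shows "\<exists>S. quasipositive S \<and>
           (\<exists>D D'. is_diagram_of D S \<and> is_diagram_of D' S \<and> \<not> move_equivalent D D')"
  using fence_diagrams fence_surfaces_isotopic not_move_equivalent
  unfolding quasipositive_def is_diagram_of_def by blast

end
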